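(* Let $N\geq 2$, $s\geq 1$, and let $\mathcal A$ be an $N$-homogeneous algebra generated by $s+1$ elements $x^\lambda$ $(\lambda\in\{0,\dots,s\})$ (a basis of $\mathcal A_1$) which is Koszul of finite global dimension $D$ and which is Gorenstein. Then $\mathcal A=\mathcal A(w,N)$ for some preregular $m$-linear form $w$ on $\mathbb K^{s+1}$ (with $m\geq N$), where: if $N\geq 3$ then $m=Np+1$ and $D=2p+1$ for some integer $p\geq 1$, while if $N=2$ then $m=D$. Under these conditions $w$ is unique up to a multiplicative factor in $\mathbb K\setminus\{0\}$.
   Context: $\mathbb K$ is an algebraically closed field of characteristic zero; all algebras are unital associative over $\mathbb K$ and $\otimes=\otimes_{\mathbb K}$. $N$-homogeneous algebra: $\mathcal A=A(E,R)=T(E)/(R)$ with $E$ a finite-dimensional vector space and $R\subset E^{\otimes N}$ a linear subspace, graded by the tensor degree, so $\mathcal A_1=E$. Its dual is $\mathcal A^!=A(E^*,R^\perp)$, $R^\perp\subset (E^{\otimes N})^*=(E^* )^{\otimes N}$ being the annihilator of $R$. One has $(\mathcal A^!_n)^*=E^{\otimes n}$ for $n<N$ and $(\mathcal A^!_n)^*=\bigcap_{r=0}^{n-N}E^{\otimes(n-N-r)}\otimes R\otimes E^{\otimes r}\subset E^{\otimes n}$ for $n\geq N$. Let $d:\mathcal A\otimes(\mathcal A^!_{n+1})^*\to\mathcal A\otimes(\mathcal A^!_n)^*$ be induced by $a\otimes(v_1\otimes\cdots\otimes v_{n+1})\mapsto av_1\otimes(v_2\otimes\cdots\otimes v_{n+1})$;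 then $d^N=0$. Koszul: the Koszul complex $\mathcal K(\mathcal A,\mathbb K)$ has $\mathcal K_{2k}=\mathcal A\otimes(\mathcal A^!_{Nk})^*$, $\mathcal K_{2k+1}=\mathcal A\otimes(\mathcal A^!_{Nk+1})^*$, with differential $d^{N-1}:\mathcal K_{2k}\to\mathcal K_{2k-1}$ and $d:\mathcal K_{2k+1}\to\mathcal K_{2k}$; $\mathcal A$ is Koszul if this complex is acyclic in positive degrees. Gorenstein: a Koszul algebra $\mathcal A$ of finite global dimension $D$ is Gorenstein if, for the trivial left module $\mathbb K$, $\mathrm{Ext}^i_{\mathcal A}(\mathbb K,\mathcal A)=0$ for $i\neq D$ and $\mathrm{Ext}^D_{\mathcal A}(\mathbb K,\mathcal A)\cong\mathbb K$ (the trivial right module, up to a shift of grading). Preregular: an $m$-linear form $w$ on a vector space $V$ ($\dim V\geq 2$, $m\geq 2$) is preregular if (i) $w(X,X_1,\dots,X_{m-1})=0$ for all $X_1,\dots,X_{m-1}\in V$ implies $X=0$, and (ii) there is $Q_w\in GL(V)$ with $w(X_1,\dots,X_m)=w(Q_wX_m,X_1,\dots,X_{m-1})$ for all $X_i\in V$. $\mathcal A(w,N)$: for $m\geq N\geq 2$ and a preregular $m$-linear form $w$ on $\mathbb K^{s+1}$ with components $W_{\lambda_1\dots\lambda_m}=w(e_{\lambda_1},\dots,e_{\lambda_m})$ in the canonical basis, $\mathcal A(w,N)$ is the $N$-homogeneous algebra generated by $x^0,\dots,x^s$ with the relations $\sum_{\mu_1,\dots,\mu_N}W_{\lambda_1\dots\lambda_{m-N}\mu_1\dots\mu_N}x^{\mu_1}\cdots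 x^{\mu_N}=0$ for all $\lambda_1,\dots,\lambda_{m-N}\in\{0,\dots,s\}$. *)

theory Defs
  imports
    "HOL-Algebra.QuotRing"
    "HOL-Library.Extended_Nat"
    "HOL-Computational_Algebra.Polynomial"
    "Jordan_Normal_Form.Matrix"
begin

section \<open>Free algebras and homogeneous algebras\<close>

text \<open>Throughout, \<open>E\<close> is the vector space with basis \<open>x\<^sup>0, \<dots>, x\<^sup>s\<close>. An element of the tensor algebra
  \<open>T(E)\<close> is a finitely supported function on words (lists over \<open>{0..s}\<close>): the value at
  \<open>[\<mu>\<^sub>1, \<dots>, \<mu>\<^sub>n]\<close> is the coefficient of \<open>x\<^bsup>\<mu>1\<^esup> \<cdots> x\<^bsup>\<mu>n\<^esup>\<close>. The product is concatenation, so it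
  restricts to the tensor product \<open>E\<^bsup>\<otimes>a\<^esup> \<times> E\<^bsup>\<otimes>b\<^esup> \<rightarrow> E\<^bsup>\<otimes>(a+b)\<^esup>\<close>.\<close>

definition words :: "nat \<Rightarrow> nat \<Rightarrow> nat list set" where
  "words s n = {u. length u = n \<and> set u \<subseteq> {..s}}"

definition word_mult :: "(nat list \<Rightarrow> 'k::comm_ring_1) \<Rightarrow> (nat list \<Rightarrow> 'k) \<Rightarrow> nat list \<Rightarrow> 'k" where
  "word_mult f g = (\<lambda>u. \<Sum>i\<le>length u. f (take i u) * g (drop i u))"

definition monomial :: "nat list \<Rightarrow> 'k::comm_ring_1 \<Rightarrow> nat list \<Rightarrow> 'k" where
  "monomial v c = (\<lambda>u. if u = v then c else 0)"

definition free_algebra :: "nat \<Rightarrow> (nat list \<Rightarrow> 'k::comm_ring_1) ring" where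
  "free_algebra s =
    \<lparr>carrier = {f. finite {u. f u \<noteq> 0} \<and> (\<forall>u. f u \<noteq> 0 \<longrightarrow> set u \<subseteq> {..s})},
     monoid.mult = word_mult, one = monomial [] 1, zero = (\<lambda>_. 0), add = (\<lambda>f g u. f u + g u)\<rparr>"

definition tensor_power :: "nat \<Rightarrow> nat \<Rightarrow> (nat list \<Rightarrow> 'k::comm_ring_1) set" where
  "tensor_power s n = {f. \<forall>u. f u \<noteq> 0 \<longrightarrow> u \<in> words s n}"

definition linear_subspace ::
    "(nat list \<Rightarrow> 'k::comm_ring_1) set \<Rightarrow> (nat list \<Rightarrow> 'k) set \<Rightarrow> bool" where
  "linear_subspace U V \<longleftrightarrow> U \<subseteq> V \<and> (\<lambda>_. 0) \<in> U \<and>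
     (\<forall>f\<in>U. \<forall>g\<in>U. (\<lambda>u. f u + g u) \<in> U) \<and> (\<forall>c. \<forall>f\<in>U. (\<lambda>u. c * f u) \<in> U)"

inductive_set tensor_prod ::
    "(nat list \<Rightarrow> 'k::comm_ring_1) set \<Rightarrow> (nat list \<Rightarrow> 'k) set \<Rightarrow> (nat list \<Rightarrow> 'k) set"
  for U V where
  zero: "(\<lambda>_. 0) \<in> tensor_prod U V"
| add: "\<lbrakk>f \<in> tensor_prod U V; g \<in> U; h \<in> V\<rbrakk> \<Longrightarrow> (\<lambda>u. f u + word_mult g h u) \<in> tensor_prod U V"

text \<open>\<open>A(E, R) = T(E)/(R)\<close>. Its elements are cosets in \<open>T(E)\<close>, so two such algebras on the same
  generators are equal as rings iff the two-sided ideals of relations are equal.\<close>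

definition homogeneous_algebra ::
    "nat \<Rightarrow> (nat list \<Rightarrow> 'k::comm_ring_1) set \<Rightarrow> (nat list \<Rightarrow> 'k) set ring" where
  "homogeneous_algebra s R = free_algebra s Quot (Idl\<^bsub>free_algebra s\<^esub> R)"

definition residue_class ::
    "nat \<Rightarrow> (nat list \<Rightarrow> 'k::comm_ring_1) set \<Rightarrow> (nat list \<Rightarrow> 'k) \<Rightarrow> (nat list \<Rightarrow> 'k) set" where
  "residue_class s R f = (Idl\<^bsub>free_algebra s\<^esub> R) +>\<^bsub>free_algebra s\<^esub> f"

section \<open>The Koszul complex\<close>

text \<open>The space \<open>(A\<^sup>!\<^sub>n)\<^sup>*\<close>, as a subspace of \<open>E\<^bsup>\<otimes>n\<^esup>\<close>.\<close>

definition dual_component ::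
    "nat \<Rightarrow> nat \<Rightarrow> (nat list \<Rightarrow> 'k::comm_ring_1) set \<Rightarrow> nat \<Rightarrow> (nat list \<Rightarrow> 'k) set" where
  "dual_component s N R n =
    (if n < N then tensor_power s n
     else \<Inter>r\<in>{0..n - N}.
       tensor_prod (tensor_prod (tensor_power s (n - N - r)) R) (tensor_power s r))"

text \<open>An element of \<open>A \<otimes> E\<^bsup>\<otimes>n\<^esup>\<close> is represented by the function sending a word \<open>u\<close> of length \<open>n\<close> to
  its \<open>A\<close>-coefficient at the basis tensor of \<open>u\<close>, and all other words to zero. For a subspace \<open>V\<close> of
  \<open>E\<^bsup>\<otimes>n\<^esup>\<close>, the space \<open>A \<otimes> V\<close> is the additive span in \<open>A \<otimes> E\<^bsup>\<otimes>n\<^esup>\<close> of the tensors \<open>a \<otimes> v\<close>.\<close>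

inductive_set algebra_tensor ::
    "nat \<Rightarrow> (nat list \<Rightarrow> 'k::comm_ring_1) set \<Rightarrow> (nat list \<Rightarrow> 'k) set
      \<Rightarrow> (nat list \<Rightarrow> (nat list \<Rightarrow> 'k) set) set"
  for s R V where
  zero: "(\<lambda>_. \<zero>\<^bsub>homogeneous_algebra s R\<^esub>) \<in> algebra_tensor s R V"
| add: "\<lbrakk>F \<in> algebra_tensor s R V; a \<in> carrier (homogeneous_algebra s R); v \<in> V\<rbrakk> \<Longrightarrow>
    (\<lambda>u. F u \<oplus>\<^bsub>homogeneous_algebra s R\<^esub>
          (a \<otimes>\<^bsub>homogeneous_algebra s R\<^esub> residue_class s R (monomial [] (v u))))
      \<in> algebra_tensor s R V"

text \<open>The map \<open>a \<otimes> (v\<^sub>1 \<otimes> \<cdots> \<otimes> v\<^bsub>n+1\<^esub>) \<mapsto> a v\<^sub>1 \<otimes> (v\<^sub>2 \<otimes> \<cdots> \<otimes> v\<^bsub>n+1\<^esub>)\<close> in these coordinates.\<close>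

definition koszul_d ::
    "nat \<Rightarrow> (nat list \<Rightarrow> 'k::comm_ring_1) set \<Rightarrow> (nat list \<Rightarrow> (nat list \<Rightarrow> 'k) set)
      \<Rightarrow> (nat list \<Rightarrow> (nat list \<Rightarrow> 'k) set)" where
  "koszul_d s R F = (\<lambda>u. \<Oplus>\<^bsub>homogeneous_algebra s R\<^esub>l\<in>{..s}.
     F (l # u) \<otimes>\<^bsub>homogeneous_algebra s R\<^esub> residue_class s R (monomial [l] 1))"

definition koszul_module ::
    "nat \<Rightarrow> nat \<Rightarrow> (nat list \<Rightarrow> 'k::comm_ring_1) set \<Rightarrow> nat
      \<Rightarrow> (nat list \<Rightarrow> (nat list \<Rightarrow> 'k) set) set" where
  "koszul_module s N R i = algebra_tensor s R (dual_component s N R (N * (i div 2) + i mod 2))"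

text \<open>The differential \<open>K\<^sub>i \<rightarrow> K\<^bsub>i-1\<^esub>\<close>, for \<open>i \<ge> 1\<close>.\<close>

definition koszul_diff ::
    "nat \<Rightarrow> nat \<Rightarrow> (nat list \<Rightarrow> 'k::comm_ring_1) set \<Rightarrow> nat
      \<Rightarrow> (nat list \<Rightarrow> (nat list \<Rightarrow> 'k) set) \<Rightarrow> (nat list \<Rightarrow> (nat list \<Rightarrow> 'k) set)" where
  "koszul_diff s N R i = (if even i then koszul_d s R ^^ (N - 1) else koszul_d s R)"

definition koszul :: "nat \<Rightarrow> nat \<Rightarrow> (nat list \<Rightarrow> 'k::comm_ring_1) set \<Rightarrow> bool" where
  "koszul s N R \<longleftrightarrow> (\<forall>i\<ge>1.
     {F \<in> koszul_module s N R i. koszul_diff s N R i F = (\<lambda>_. \<zero>\<^bsub>homogeneous_algebra s R\<^esub>)} =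
     koszul_diff s N R (Suc i) ` koszul_module s N R (Suc i))"

section \<open>Modules, projective resolutions and global dimension\<close>

text \<open>The library's module locale requires a commutative base ring. The multiplication and unit
  fields of a module record are never used.\<close>

locale left_module = A?: ring A + M?: abelian_group M
    for A :: "'a ring" (structure) and M :: "('a, 'm) module" (structure) +
  assumes smult_closed: "\<lbrakk>a \<in> carrier A; x \<in> carrier M\<rbrakk> \<Longrightarrow> a \<odot>\<^bsub>M\<^esub> x \<in> carrier M"
    and smult_l_distr: "\<lbrakk>a \<in> carrier A; b \<in> carrier A; x \<in> carrier M\<rbrakk> \<Longrightarrow>
      (a \<oplus>\<^bsub>A\<^esub> b) \<odot>\<^bsub>M\<^esub> x = a \<odot>\<^bsub>M\<^esub> x \<oplus>\<^bsub>M\<^esub> b \<odot>\<^bsub>M\<^esub> x"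
    and smult_r_distr: "\<lbrakk>a \<in> carrier A; x \<in> carrier M; y \<in> carrier M\<rbrakk> \<Longrightarrow>
      a \<odot>\<^bsub>M\<^esub> (x \<oplus>\<^bsub>M\<^esub> y) = a \<odot>\<^bsub>M\<^esub> x \<oplus>\<^bsub>M\<^esub> a \<odot>\<^bsub>M\<^esub> y"
    and smult_assoc: "\<lbrakk>a \<in> carrier A; b \<in> carrier A; x \<in> carrier M\<rbrakk> \<Longrightarrow>
      (a \<otimes>\<^bsub>A\<^esub> b) \<odot>\<^bsub>M\<^esub> x = a \<odot>\<^bsub>M\<^esub> (b \<odot>\<^bsub>M\<^esub> x)"
    and smult_one: "x \<in> carrier M \<Longrightarrow> \<one>\<^bsub>A\<^esub> \<odot>\<^bsub>M\<^esub> x = x"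

text \<open>Homomorphisms of left modules, and also of right modules when \<open>a \<odot> x\<close> is read as \<open>x a\<close>.\<close>

definition mod_hom :: "'a ring \<Rightarrow> ('a, 'm) module \<Rightarrow> ('a, 'n) module \<Rightarrow> ('m \<Rightarrow> 'n) set" where
  "mod_hom A M M' = {f \<in> hom (add_monoid M) (add_monoid M').
     \<forall>a\<in>carrier A. \<forall>x\<in>carrier M. f (a \<odot>\<^bsub>M\<^esub> x) = a \<odot>\<^bsub>M'\<^esub> f x}"

definition mod_isomorphic :: "'a ring \<Rightarrow> ('a, 'm) module \<Rightarrow> ('a, 'n) module \<Rightarrow> bool" where
  "mod_isomorphic A M M' \<longleftrightarrow> (\<exists>f\<in>mod_hom A M M'. bij_betw f (carrier M) (carrier M'))"

text \<open>HOL cannot quantify over the carrier types of all modules. The modules occurring in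
  resolutions and in the definition of the global dimension are carried by subsets of
  \<open>nat list \<Rightarrow> 'a\<close>, where \<open>'a\<close> is the type of the ring elements. Unless \<open>'a\<close> is a singleton,
  this type is infinite; it is at least as large as the ring, so every module on a subset of it is a quotient of a free module on a subset
  of it, and up to isomorphism every cyclic module occurs; hence projectivity, projective dimension,
  Ext and global dimension have their usual meaning.\<close>

type_synonym 'a univ_module = "('a, nat list \<Rightarrow> 'a) module"

definition projective :: "'a ring \<Rightarrow> 'a univ_module \<Rightarrow> bool" where
  "projective A P \<longleftrightarrow> left_module A P \<and>
     (\<forall>(M :: 'a univ_module) (M' :: 'a univ_module) g h.
        left_module A M \<and> left_module A M' \<and>
        g \<in> mod_hom A M M' \<and> g ` carrier M = carrier M' \<and> h \<in> mod_hom A P M' \<longrightarrow>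
        (\<exists>l\<in>mod_hom A P M. \<forall>x\<in>carrier P. g (l x) = h x))"

definition projective_resolution ::
    "'a ring \<Rightarrow> ('a, 'm) module \<Rightarrow> (nat \<Rightarrow> 'a univ_module)
      \<Rightarrow> (nat \<Rightarrow> (nat list \<Rightarrow> 'a) \<Rightarrow> (nat list \<Rightarrow> 'a)) \<Rightarrow> ((nat list \<Rightarrow> 'a) \<Rightarrow> 'm) \<Rightarrow> bool" where
  "projective_resolution A M P d e \<longleftrightarrow>
     (\<forall>i. projective A (P i)) \<and>
     (\<forall>i. d i \<in> mod_hom A (P (Suc i)) (P i)) \<and>
     e \<in> mod_hom A (P 0) M \<and>
     e ` carrier (P 0) = carrier M \<and>
     d 0 ` carrier (P 1) = {x \<in> carrier (P 0). e x = \<zero>\<^bsub>M\<^esub>} \<and>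
     (\<forall>i. d (Suc i) ` carrier (P (Suc (Suc i))) = {x \<in> carrier (P (Suc i)). d i x = \<zero>\<^bsub>P i\<^esub>})"

definition projective_dimension :: "'a ring \<Rightarrow> ('a, 'm) module \<Rightarrow> enat" where
  "projective_dimension A M =
     (INF n \<in> {n. \<exists>P d e. projective_resolution A M P d e \<and> (\<forall>i>n. carrier (P i) = {\<zero>\<^bsub>P i\<^esub>})}. enat n)"

definition global_dimension :: "'a ring \<Rightarrow> enat" where
  "global_dimension A = (SUP M \<in> {M :: 'a univ_module. left_module A M}. projective_dimension A M)"

section \<open>Ext with values in the algebra and the Gorenstein property\<close>

definition regular_module :: "'a ring \<Rightarrow> ('a, 'a) module" where
  "regular_module A =
    \<lparr>carrier = carrier A, monoid.mult = monoid.mult A, one = one A, zero = zero A, add = add A,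
     smult = monoid.mult A\<rparr>"

text \<open>\<open>Hom\<^sub>A(P, A)\<close> for a left module \<open>P\<close>; it is a right module through \<open>(f a)(x) = f(x) a\<close>.\<close>

definition dual_module :: "'a ring \<Rightarrow> ('a, 'm) module \<Rightarrow> ('a, 'm \<Rightarrow> 'a) module" where
  "dual_module A P =
    \<lparr>carrier = mod_hom A P (regular_module A) \<inter> extensional (carrier P),
     monoid.mult = undefined, one = undefined,
     zero = (\<lambda>x\<in>carrier P. \<zero>\<^bsub>A\<^esub>),
     add = (\<lambda>f g. \<lambda>x\<in>carrier P. f x \<oplus>\<^bsub>A\<^esub> g x),
     smult = (\<lambda>a f. \<lambda>x\<in>carrier P. f x \<otimes>\<^bsub>A\<^esub> a)\<rparr>"

definition dual_cocycles ::
    "'a ring \<Rightarrow> (nat \<Rightarrow> ('a, 'm) module) \<Rightarrow> (nat \<Rightarrow> 'm \<Rightarrow> 'm) \<Rightarrow> nat \<Rightarrow> ('m \<Rightarrow> 'a) set" where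
  "dual_cocycles A P d i =
     {f \<in> carrier (dual_module A (P i)). \<forall>x\<in>carrier (P (Suc i)). f (d i x) = \<zero>\<^bsub>A\<^esub>}"

definition dual_coboundaries ::
    "'a ring \<Rightarrow> (nat \<Rightarrow> ('a, 'm) module) \<Rightarrow> (nat \<Rightarrow> 'm \<Rightarrow> 'm) \<Rightarrow> nat \<Rightarrow> ('m \<Rightarrow> 'a) set" where
  "dual_coboundaries A P d i =
     (case i of 0 \<Rightarrow> {\<zero>\<^bsub>dual_module A (P 0)\<^esub>}
      | Suc j \<Rightarrow> (\<lambda>f. \<lambda>x\<in>carrier (P (Suc j)). f (d j x)) ` carrier (dual_module A (P j)))"

text \<open>The right module \<open>Z/B\<close> for submodules \<open>B \<subseteq> Z\<close> of the right module \<open>M\<close>.\<close>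

definition subquotient ::
    "('a, 'm) module \<Rightarrow> 'm set \<Rightarrow> 'm set \<Rightarrow> ('a, 'm set) module" where
  "subquotient M Z B =
    \<lparr>carrier = (\<lambda>z. B +>\<^bsub>M\<^esub> z) ` Z, monoid.mult = undefined, one = undefined,
     zero = B, add = set_add M, smult = (\<lambda>a X. B <+>\<^bsub>M\<^esub> ((\<lambda>x. a \<odot>\<^bsub>M\<^esub> x) ` X))\<rparr>"

text \<open>The right module \<open>Ext\<^sup>i\<^sub>A(M, A)\<close>, computed from a projective resolution \<open>P\<close> of the left module \<open>M\<close>.\<close>

definition Ext_module ::
    "'a ring \<Rightarrow> (nat \<Rightarrow> ('a, 'm) module) \<Rightarrow> (nat \<Rightarrow> 'm \<Rightarrow> 'm) \<Rightarrow> nat \<Rightarrow> ('a, ('m \<Rightarrow> 'a) set) module" where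
  "Ext_module A P d i =
     subquotient (dual_module A (P i)) (dual_cocycles A P d i) (dual_coboundaries A P d i)"

text \<open>The trivial module, on which a coset acts by its constant coefficient; this is well defined
  when the relations have positive degree. As the ground field is commutative, the same record is
  both the trivial left and the trivial right module.\<close>

definition trivial_module ::
    "(nat list \<Rightarrow> 'k::comm_ring_1) set ring \<Rightarrow> ((nat list \<Rightarrow> 'k) set, 'k) module" where
  "trivial_module A =
    \<lparr>carrier = UNIV, monoid.mult = (*), one = 1, zero = 0, add = (+),
     smult = (\<lambda>a c. the_elem ((\<lambda>f. f []) ` a) * c)\<rparr>"

text \<open>Ext does not depend on the chosen resolution up to isomorphism of right modules; the
  conditions on Ext are stated for every projective resolution of the trivial module. For a Koszul
  algebra at least one such resolution exists, namely the Koszul complex.\<close>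

definition gorenstein :: "(nat list \<Rightarrow> 'k::comm_ring_1) set ring \<Rightarrow> nat \<Rightarrow> bool" where
  "gorenstein A D \<longleftrightarrow> (\<forall>P d e. projective_resolution A (trivial_module A) P d e \<longrightarrow>
     (\<forall>i. i \<noteq> D \<longrightarrow> carrier (Ext_module A P d i) = {\<zero>\<^bsub>Ext_module A P d i\<^esub>}) \<and>
     mod_isomorphic A (Ext_module A P d D) (trivial_module A))"

section \<open>Preregular multilinear forms and their algebras\<close>

text \<open>An \<open>m\<close>-linear form on \<open>K\<^sup>n\<close> is a function on lists of \<open>m\<close> vectors of dimension \<open>n\<close>; its values
  on other lists are irrelevant.\<close>

definition vec_lists :: "nat \<Rightarrow> nat \<Rightarrow> 'k::field vec list set" where
  "vec_lists n m = {Xs. length Xs = m \<and> set Xs \<subseteq> carrier_vec n}"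

definition multilinear_form :: "nat \<Rightarrow> nat \<Rightarrow> ('k::field vec list \<Rightarrow> 'k) \<Rightarrow> bool" where
  "multilinear_form n m w \<longleftrightarrow>
     (\<forall>Xs\<in>vec_lists n m. \<forall>i<m. \<forall>x\<in>carrier_vec n. \<forall>y\<in>carrier_vec n. \<forall>c.
        w (Xs[i := x + y]) = w (Xs[i := x]) + w (Xs[i := y]) \<and>
        w (Xs[i := c \<cdot>\<^sub>v x]) = c * w (Xs[i := x]))"

definition preregular :: "nat \<Rightarrow> nat \<Rightarrow> ('k::field vec list \<Rightarrow> 'k) \<Rightarrow> bool" where
  "preregular n m w \<longleftrightarrow> 2 \<le> n \<and> 2 \<le> m \<and> multilinear_form n m w \<and>
     (\<forall>X\<in>carrier_vec n. (\<forall>Xs\<in>vec_lists n (m - 1). w (X # Xs) = 0) \<longrightarrow> X = 0\<^sub>v n) \<and>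
     (\<exists>Q\<in>carrier_mat n n. invertible_mat Q \<and>
        (\<forall>Xs\<in>vec_lists n (m - 1). \<forall>X\<in>carrier_vec n. w (Xs @ [X]) = w ((Q *\<^sub>v X) # Xs)))"

definition form_component :: "nat \<Rightarrow> ('k::field vec list \<Rightarrow> 'k) \<Rightarrow> nat list \<Rightarrow> 'k" where
  "form_component n w u = w (map (unit_vec n) u)"

definition form_relations ::
    "nat \<Rightarrow> nat \<Rightarrow> nat \<Rightarrow> ('k::field vec list \<Rightarrow> 'k) \<Rightarrow> (nat list \<Rightarrow> 'k) set" where
  "form_relations s N m w =
     (\<lambda>v u. if u \<in> words s N then form_component (Suc s) w (v @ u) else 0) ` words s (m - N)"

definition form_algebra ::
    "nat \<Rightarrow> nat \<Rightarrow> nat \<Rightarrow> ('k::field vec list \<Rightarrow> 'k) \<Rightarrow> (nat list \<Rightarrow> 'k) set ring" where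
  "form_algebra s N m w = homogeneous_algebra s (form_relations s N m w)"

end

theory Submission
  imports Defs "Jordan_Normal_Form.Determinant"
begin

text \<open>The Koszul complex consists of the free modules \<open>A \<otimes> V\<^sub>n\<close> with \<open>V\<^sub>n = (A\<^sup>!\<^sub>n)\<^sup>*\<close>, and its
  differentials vanish modulo the augmentation ideal \<open>A\<^sub>+\<close>. Comparison with a resolution of length
  \<open>D\<close> therefore forces it to stop in degree \<open>D\<close>, and \<open>Ext\<^sup>D(K, A) = K\<close> then says that its last term is
  \<open>A \<otimes> w\<close> for a single tensor \<open>w \<in> V\<^sub>m\<close> and that the dual of the last differential has image \<open>A\<^sub>+\<close>.
  As \<open>A\<^sub>+\<close> contains the generators, this differential has degree \<open>1\<close>, which fixes the parity of \<open>D\<close>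
  for \<open>N \<ge> 3\<close>, and the contractions \<open>w\<^sub>\<nu>\<close> of \<open>w\<close> on the left by the dual basis are linearly independent.
  The vanishing of \<open>Ext\<^bsup>D-1\<^esup>(K, A)\<close> shows that the \<open>w\<^sub>\<nu>\<close> span \<open>V\<^bsub>m-1\<^esub>\<close>, and, applied to the cocycle
  \<open>w\<^sub>\<nu> \<mapsto> r\<^sub>\<nu>\<close> of a relation \<open>r = \<Sum> x\<^sup>\<nu> r\<^sub>\<nu>\<close>, that every relation is a contraction of \<open>w\<close> on the right.
  Expressing the right contractions in \<open>V\<^bsub>m-1\<^esub>\<close> by the left ones yields the matrix \<open>Q\<close>; it makes left
  and right contractions interchangeable, and conversely places the tensor of any preregular form that
  defines \<open>A\<close> in the line \<open>V\<^sub>m\<close>.\<close>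

section \<open>The free algebra and its homogeneous quotients\<close>

text \<open>The resolutions, the homotopies and the isomorphism of Ext with the trivial module come
  without any grading, so no map may be assumed homogeneous. What replaces the grading is that the
  ideal of relations vanishes below degree \<open>N\<close>: coefficients of elements of
  \<open>A\<close> at words shorter than \<open>N\<close> are well defined, and no others are
  needed. A generator is recognised by its coefficients of length at most 1, the part of a relation
  behind its first letter by those of length \<open>N - 1\<close>. Applying an arbitrary linear map
  to a differential of \<open>1 \<otimes> v\<close> that consumes k letters, and reading a
  coefficient of length k, gives the constant term of the map at a contraction of \<open>v\<close>.
  These constant terms are linear functionals on \<open>V n\<close>, and the linear algebra is done
  with them. In particular, the functionals dual to the left contractions of the tensor w are the
  constant terms of preimages of the generators under the dual of the last differential. The
  assignment attached to a relation r is a cocycle because its value on the last differential is the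
  class of r itself, which is zero in \<open>A\<close>.\<close>

lemma word_mult_assoc: "word_mult (word_mult f g) h = word_mult f (word_mult g h)"
proof
  fix u :: "nat list"
  let ?n = "length u"
  let ?F = "\<lambda>i j. f (take j u) * g (take (i - j) (drop j u)) * h (drop i u)"
  have "word_mult (word_mult f g) h u = (\<Sum>i\<le>?n. \<Sum>j\<le>i. ?F i j)"
    by (auto simp: word_mult_def sum_distrib_right min_def drop_take intro!: sum.cong)
  also have "\<dots> = (\<Sum>(i, j)\<in>Sigma {..?n} (\<lambda>i. {..i}). ?F i j)"
    by (rule sum.Sigma) auto
  also have "\<dots> = (\<Sum>(j, k)\<in>Sigma {..?n} (\<lambda>j. {..?n - j}). ?F (j + k) j)"
    by (rule sum.reindex_bij_witness[of _ "\<lambda>(j, k). (j + k, j)" "\<lambda>(i, j). (j, i - j)"]) auto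
  also have "\<dots> = (\<Sum>j\<le>?n. \<Sum>k\<le>?n - j. ?F (j + k) j)"
    by (rule sum.Sigma[symmetric]) auto
  also have "\<dots> = word_mult f (word_mult g h) u"
    by (auto simp: word_mult_def sum_distrib_left mult.assoc add.commute intro!: sum.cong)
  finally show "word_mult (word_mult f g) h u = word_mult f (word_mult g h) u" .
qed

lemma word_mult_monomial_left:
  "word_mult (monomial v c) f u = (if take (length v) u = v then c * f (drop (length v) u) else 0)"
proof -
  have "word_mult (monomial v c) f u
      = (\<Sum>i\<le>length u. if i = length v \<and> take i u = v then c * f (drop i u) else 0)"
    unfolding word_mult_def by (rule sum.cong) (auto simp: monomial_def min_absorb2)
  also have "\<dots> = (\<Sum>i\<le>length u. if i = length v then (if take i u = v then c * f (drop i u) else 0) else 0)"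
    by (rule sum.cong) auto
  also have "\<dots> = (if length v \<le> length u then (if take (length v) u = v then c * f (drop (length v) u) else 0) else 0)"
    by (subst sum.delta) auto
  also have "\<dots> = (if take (length v) u = v then c * f (drop (length v) u) else 0)"
    by (metis length_take min.cobounded1)
  finally show ?thesis .
qed

lemma word_mult_monomial_right:
  "word_mult f (monomial v c) u
     = (if length v \<le> length u \<and> drop (length u - length v) u = v then f (take (length u - length v) u) * c else 0)"
proof -
  have "word_mult f (monomial v c) u
      = (\<Sum>i\<le>length u. if i = length u - length v then
          (if length v \<le> length u \<and> drop i u = v then f (take i u) * c else 0) else 0)"
    unfolding word_mult_def by (rule sum.cong) (auto simp: monomial_def)
  also have "\<dots> = (if length v \<le> length u \<and> drop (length u - length v) u = v
      then f (take (length u - length v) u) * c else 0)"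
    by (subst sum.delta) auto
  finally show ?thesis .
qed

lemma word_mult_monomials:
  "word_mult (monomial v c) (monomial v' c') = monomial (v @ v') (c * c')"
proof
  fix u
  show "word_mult (monomial v c) (monomial v' c') u = monomial (v @ v') (c * c') u"
    unfolding word_mult_monomial_left
    by (cases "u = v @ v'") (auto simp: monomial_def, metis append_take_drop_id)
qed

lemma monomial_self [simp]: "monomial v c v = c"
  by (simp add: monomial_def)

lemma word_mult_closed:
  assumes "f \<in> carrier (free_algebra s)" "g \<in> carrier (free_algebra s)"
  shows "word_mult f g \<in> carrier (free_algebra s)"
proof -
  have split: "\<exists>i. f (take i u) \<noteq> 0 \<and> g (drop i u) \<noteq> 0" if "word_mult f g u \<noteq> 0" for u
  proof -
    have "\<not> (\<forall>i. f (take i u) * g (drop i u) = 0)"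
    proof
      assume "\<forall>i. f (take i u) * g (drop i u) = 0"
      then have "word_mult f g u = 0" unfolding word_mult_def by (intro sum.neutral ballI) simp
      with that show False by simp
    qed
    then obtain i where "f (take i u) * g (drop i u) \<noteq> 0" by blast
    then have "f (take i u) \<noteq> 0" "g (drop i u) \<noteq> 0" by auto
    then show ?thesis by blast
  qed
  have "{u. word_mult f g u \<noteq> 0} \<subseteq> (\<lambda>(a, b). a @ b) ` ({u. f u \<noteq> 0} \<times> {u. g u \<noteq> 0})"
  proof
    fix u assume "u \<in> {u. word_mult f g u \<noteq> 0}"
    then obtain i where "f (take i u) \<noteq> 0" "g (drop i u) \<noteq> 0" using split by blast
    then show "u \<in> (\<lambda>(a, b). a @ b) ` ({u. f u \<noteq> 0} \<times> {u. g u \<noteq> 0})"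
      by (intro image_eqI[where x = "(take i u, drop i u)"]) auto
  qed
  moreover have "finite ((\<lambda>(a, b). a @ b) ` ({u. f u \<noteq> 0} \<times> {u. g u \<noteq> 0}))"
    using assms by (auto simp: free_algebra_def)
  ultimately have "finite {u. word_mult f g u \<noteq> 0}" by (rule finite_subset)
  moreover have "set u \<subseteq> {..s}" if nz: "word_mult f g u \<noteq> 0" for u
  proof -
    obtain i where "f (take i u) \<noteq> 0" "g (drop i u) \<noteq> 0" using split[OF nz] by blast
    then have "set (take i u) \<subseteq> {..s}" "set (drop i u) \<subseteq> {..s}"
      using assms unfolding free_algebra_def by auto
    then have "set (take i u @ drop i u) \<subseteq> {..s}" unfolding set_append by blast
    then show ?thesis by simp
  qed
  ultimately show ?thesis by (simp add: free_algebra_def)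
qed

lemma free_algebra_simps:
  "\<one>\<^bsub>free_algebra s\<^esub> = monomial [] 1" "\<zero>\<^bsub>free_algebra s\<^esub> = (\<lambda>_. 0)"
  "f \<oplus>\<^bsub>free_algebra s\<^esub> g = (\<lambda>u. f u + g u)" "f \<otimes>\<^bsub>free_algebra s\<^esub> g = word_mult f g"
  by (simp_all add: free_algebra_def)

lemma monomial_closed [simp]: "set v \<subseteq> {..s} \<Longrightarrow> monomial v c \<in> carrier (free_algebra s)"
  by (auto simp: free_algebra_def monomial_def)

lemma add_closed_free:
  "\<lbrakk>f \<in> carrier (free_algebra s); g \<in> carrier (free_algebra s)\<rbrakk> \<Longrightarrow> (\<lambda>u. f u + g u) \<in> carrier (free_algebra s)"
proof -
  assume f: "f \<in> carrier (free_algebra s)" and g: "g \<in> carrier (free_algebra s)"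
  have "{u. f u + g u \<noteq> 0} \<subseteq> {u. f u \<noteq> 0} \<union> {u. g u \<noteq> 0}" by auto
  then have "finite {u. f u + g u \<noteq> 0}"
    using f g by (auto simp: free_algebra_def intro: finite_subset)
  moreover have "set u \<subseteq> {..s}" if "f u + g u \<noteq> 0" for u
    using that f g by (cases "f u = 0") (auto simp: free_algebra_def)
  ultimately show ?thesis by (simp add: free_algebra_def)
qed

lemma smult_closed_free:
  "f \<in> carrier (free_algebra s) \<Longrightarrow> (\<lambda>u. c * f u) \<in> carrier (free_algebra s)"
proof -
  assume f: "f \<in> carrier (free_algebra s)"
  have "{u. c * f u \<noteq> 0} \<subseteq> {u. f u \<noteq> 0}" by auto
  then have "finite {u. c * f u \<noteq> 0}" using f by (auto simp: free_algebra_def intro: finite_subset)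
  moreover have "set u \<subseteq> {..s}" if "c * f u \<noteq> 0" for u
    using that f by (cases "f u = 0") (auto simp: free_algebra_def)
  ultimately show ?thesis by (simp add: free_algebra_def)
qed

lemma ring_free_algebra: "ring (free_algebra s :: (nat list \<Rightarrow> 'k::comm_ring_1) ring)"
proof (rule ringI)
  let ?T = "free_algebra s :: (nat list \<Rightarrow> 'k) ring"
  show "abelian_group ?T"
  proof (rule abelian_groupI)
    fix f :: "nat list \<Rightarrow> 'k" assume f: "f \<in> carrier ?T"
    show "\<exists>y\<in>carrier ?T. y \<oplus>\<^bsub>?T\<^esub> f = \<zero>\<^bsub>?T\<^esub>"
      using smult_closed_free[OF f, of "-1"] by (intro bexI[of _ "\<lambda>u. - 1 * f u"]) (simp_all add: free_algebra_simps)
  qed (simp_all add: free_algebra_simps add_closed_free add.assoc, simp_all add: free_algebra_def add.commute)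
  show "Group.monoid ?T"
    by (rule monoidI)
      (simp_all add: free_algebra_simps word_mult_closed word_mult_assoc,
       simp_all add: fun_eq_iff word_mult_monomial_left word_mult_monomial_right)
qed (simp_all add: free_algebra_simps word_mult_def distrib_left distrib_right sum.distrib)

lemma tensor_power_subset_free: "tensor_power s n \<subseteq> carrier (free_algebra s)"
proof
  fix f :: "nat list \<Rightarrow> 'k::comm_ring_1" assume f: "f \<in> tensor_power s n"
  have "{u. f u \<noteq> 0} \<subseteq> {u. set u \<subseteq> {..s} \<and> length u = n}"
    using f by (auto simp: tensor_power_def words_def)
  then have "finite {u. f u \<noteq> 0}" by (rule finite_subset) (rule finite_lists_length_eq, simp)
  then show "f \<in> carrier (free_algebra s)" using f by (auto simp: free_algebra_def tensor_power_def words_def)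
qed

lemma finite_words [simp]: "finite (words s n)"
  using finite_lists_length_eq[of "{..s}" n] by (simp add: words_def conj_commute)

text \<open>Every other cut of \<open>u\<close> evaluates \<open>f\<close> at a strictly shorter
  word, so only the constant term of \<open>g\<close> survives.\<close>

lemma word_mult_low_degrees:
  assumes "\<forall>v. length v < length u \<longrightarrow> f v = 0"
  shows "word_mult g f u = g [] * f u" "word_mult f g u = g [] * f u"
proof -
  have "word_mult g f u = (\<Sum>i\<le>length u. if i = 0 then g [] * f u else 0)"
    unfolding word_mult_def by (rule sum.cong) (use assms in auto)
  then show "word_mult g f u = g [] * f u" by simp
  have "word_mult f g u = (\<Sum>i\<le>length u. if i = length u then g [] * f u else 0)"
    unfolding word_mult_def by (rule sum.cong) (use assms in auto)
  then show "word_mult f g u = g [] * f u" by simp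
qed

lemma linear_subspace_sum:
  assumes "linear_subspace U V" "finite S" "\<And>i. i \<in> S \<Longrightarrow> f i \<in> U"
  shows "(\<lambda>u. \<Sum>i\<in>S. f i u) \<in> U"
  using assms(2,3) by (induction S rule: finite_induct) (use assms(1) in \<open>auto simp: linear_subspace_def\<close>)

lemma linear_subspace_lin:
  assumes "linear_subspace U V" "f \<in> U" "g \<in> U"
  shows "(\<lambda>u. c * f u + d * g u) \<in> U"
proof -
  have "(\<lambda>u. c * f u) \<in> U" "(\<lambda>u. d * g u) \<in> U"
    using assms by (auto simp: linear_subspace_def)
  moreover have "\<forall>f\<in>U. \<forall>g\<in>U. (\<lambda>u. f u + g u) \<in> U"
    using assms by (simp add: linear_subspace_def)
  ultimately show ?thesis by (auto dest!: bspec)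
qed

lemma linear_subspaceD:
  assumes "linear_subspace U V"
  shows "(\<lambda>_. 0) \<in> U" "f \<in> U \<Longrightarrow> g \<in> U \<Longrightarrow> (\<lambda>u. f u + g u) \<in> U" "f \<in> U \<Longrightarrow> (\<lambda>u. c * f u) \<in> U"
  using assms unfolding linear_subspace_def by simp_all

text \<open>Contraction of a tensor against the dual basis words \<open>p\<close> on the left and
  \<open>q\<close> on the right, cut down to degree \<open>n\<close>. With \<open>p\<close> and
  \<open>q\<close> empty it is the homogeneous component of degree \<open>n\<close>.\<close>

definition slice :: "nat list \<Rightarrow> nat list \<Rightarrow> nat \<Rightarrow> (nat list \<Rightarrow> 'k::zero) \<Rightarrow> nat list \<Rightarrow> 'k" where
  "slice p q n f = (\<lambda>u. if length u = n then f (p @ u @ q) else 0)"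

section \<open>The quotient algebra and its coefficients in low degrees\<close>

locale homogeneous_relations =
  fixes s N :: nat and R :: "(nat list \<Rightarrow> 'k::field) set"
  assumes two_le_N: "2 \<le> N" and relations: "linear_subspace R (tensor_power s N)"
begin

abbreviation T :: "(nat list \<Rightarrow> 'k) ring" where "T \<equiv> free_algebra s"
abbreviation A :: "(nat list \<Rightarrow> 'k) set ring" where "A \<equiv> homogeneous_algebra s R"
abbreviation mult_A (infixl "\<star>" 70) where "a \<star> b \<equiv> a \<otimes>\<^bsub>A\<^esub> b"
abbreviation I :: "(nat list \<Rightarrow> 'k) set" where "I \<equiv> Idl\<^bsub>T\<^esub> R"
abbreviation cls :: "(nat list \<Rightarrow> 'k) \<Rightarrow> (nat list \<Rightarrow> 'k) set" where "cls \<equiv> residue_class s R"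

sublocale T: ring T by (rule ring_free_algebra)

lemma relations_subset: "R \<subseteq> carrier T"
  using relations tensor_power_subset_free unfolding linear_subspace_def by blast

sublocale I: ideal I T by (rule T.genideal_ideal[OF relations_subset])

sublocale A: ring A unfolding homogeneous_algebra_def by (rule I.quotient_is_ring)

lemma cls_hom: "cls \<in> Ring.ring_hom T A"
  using I.rcos_ring_hom unfolding homogeneous_algebra_def residue_class_def .

lemma cls_closed [simp]: "f \<in> carrier T \<Longrightarrow> cls f \<in> carrier A"
  using cls_hom by (rule ring_hom_closed)

lemma carrier_A: "carrier A = cls ` carrier T"
  unfolding homogeneous_algebra_def residue_class_def FactRing_def A_RCOSETS_def RCOSETS_def a_r_coset_def
  by auto

lemma cls_add: "\<lbrakk>f \<in> carrier T; g \<in> carrier T\<rbrakk> \<Longrightarrow> cls (\<lambda>u. f u + g u) = cls f \<oplus>\<^bsub>A\<^esub> cls g"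
  using ring_hom_add[OF cls_hom] by (simp add: free_algebra_simps)

lemma cls_mult: "\<lbrakk>f \<in> carrier T; g \<in> carrier T\<rbrakk> \<Longrightarrow> cls (word_mult f g) = cls f \<star> cls g"
  using ring_hom_mult[OF cls_hom] by (simp add: free_algebra_simps)

lemma cls_one: "cls (monomial [] 1) = \<one>\<^bsub>A\<^esub>"
  using ring_hom_one[OF cls_hom] by (simp add: free_algebra_simps)

lemma cls_eq_zero_iff: "f \<in> carrier T \<Longrightarrow> cls f = \<zero>\<^bsub>A\<^esub> \<longleftrightarrow> f \<in> I"
  unfolding residue_class_def homogeneous_algebra_def FactRing_def
  using I.a_rcos_const I.a_rcos_self by force

lemma cls_zero: "cls (\<lambda>_. 0) = \<zero>\<^bsub>A\<^esub>"
  using cls_eq_zero_iff[of "\<zero>\<^bsub>T\<^esub>"] T.zero_closed I.zero_closed by (simp add: free_algebra_simps)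

lemma cls_relation: "r \<in> R \<Longrightarrow> cls r = \<zero>\<^bsub>A\<^esub>"
  using cls_eq_zero_iff relations_subset T.genideal_self[OF relations_subset] by blast

text \<open>The elements that vanish below degree \<open>N\<close> and have their degree
  \<open>N\<close> component in \<open>R\<close> form a two-sided ideal \<open>J\<close>:
  multiplying by \<open>x\<close> on either side scales that lowest component by the constant term
  of \<open>x\<close>. As \<open>J\<close> contains \<open>R\<close>, it contains
  \<open>I\<close>.\<close>

lemma ideal_low_degrees:
  assumes "f \<in> I"
  shows "length u < N \<Longrightarrow> f u = 0" and "(\<lambda>u. if length u = N then f u else 0) \<in> R"
proof -
  define J where "J = {f \<in> carrier T. (\<forall>u. length u < N \<longrightarrow> f u = 0) \<and> slice [] [] N f \<in> R}"
  have lin: "linear_subspace R (tensor_power s N)" by (rule relations)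
  have mult: "slice [] [] N (word_mult g f) = (\<lambda>u. g [] * slice [] [] N f u)"
      "slice [] [] N (word_mult f g) = (\<lambda>u. g [] * slice [] [] N f u)"
    if z: "\<forall>u. length u < N \<longrightarrow> f u = 0" for f g :: "nat list \<Rightarrow> 'k"
  proof -
    have "word_mult g f u = g [] * f u" "word_mult f g u = g [] * f u" if "length u = N" for u
      by (rule word_mult_low_degrees, use z that in blast)+
    then show "slice [] [] N (word_mult g f) = (\<lambda>u. g [] * slice [] [] N f u)"
        "slice [] [] N (word_mult f g) = (\<lambda>u. g [] * slice [] [] N f u)"
      by (simp_all add: slice_def fun_eq_iff)
  qed
  have "ideal J T"
  proof (rule idealI)
    show "ring T" by (rule T.ring_axioms)
    show "subgroup J (add_monoid T)"
    proof (rule T.add.subgroupI)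
      show "J \<subseteq> carrier T" by (auto simp: J_def)
      have "(\<lambda>_. 0) \<in> R" using lin by (simp add: linear_subspace_def)
      then show "J \<noteq> {}" using T.zero_closed by (auto simp: J_def free_algebra_simps slice_def)
      show "\<ominus>\<^bsub>T\<^esub> f \<in> J" if f: "f \<in> J" for f
      proof -
        have fT: "f \<in> carrier T" using f by (simp add: J_def)
        have "(\<lambda>u. - 1 * f u) \<oplus>\<^bsub>T\<^esub> f = \<zero>\<^bsub>T\<^esub>" by (simp add: free_algebra_simps)
        then have eq: "\<ominus>\<^bsub>T\<^esub> f = (\<lambda>u. - 1 * f u)" using smult_closed_free[OF fT, of "-1"] fT T.minus_equality by blast
        have "(\<lambda>u. - 1 * slice [] [] N f u) \<in> R" using f unfolding J_def by (intro linear_subspaceD[OF lin]) simp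
        moreover have "(\<lambda>u. - 1 * slice [] [] N f u) = slice [] [] N (\<lambda>u. - 1 * f u)" by (auto simp: slice_def)
        ultimately show ?thesis using f smult_closed_free[OF fT, of "-1"] unfolding eq J_def by simp
      qed
      show "f \<oplus>\<^bsub>T\<^esub> g \<in> J" if "f \<in> J" "g \<in> J" for f g
      proof -
        have "(\<lambda>u. slice [] [] N f u + slice [] [] N g u) \<in> R"
          using that unfolding J_def by (intro linear_subspaceD[OF lin]) simp_all
        moreover have "(\<lambda>u. slice [] [] N f u + slice [] [] N g u) = slice [] [] N (\<lambda>u. f u + g u)"
          by (auto simp: slice_def)
        ultimately show ?thesis using that by (auto simp: J_def free_algebra_simps add_closed_free)
      qed
    qed
    show "x \<otimes>\<^bsub>T\<^esub> a \<in> J" if a: "a \<in> J" and x: "x \<in> carrier T" for a x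
    proof -
      have "word_mult x a u = 0" if "length u < N" for u
        using a that unfolding J_def word_mult_def by (auto intro!: sum.neutral)
      moreover have "(\<lambda>u. x [] * slice [] [] N a u) \<in> R" using a unfolding J_def by (intro linear_subspaceD[OF lin]) simp
      ultimately show ?thesis using a x mult(1)[of a x] by (auto simp: J_def free_algebra_simps word_mult_closed)
    qed
    show "a \<otimes>\<^bsub>T\<^esub> x \<in> J" if a: "a \<in> J" and x: "x \<in> carrier T" for a x
    proof -
      have "word_mult a x u = 0" if "length u < N" for u
        using a that unfolding J_def word_mult_def by (auto intro!: sum.neutral)
      moreover have "(\<lambda>u. x [] * slice [] [] N a u) \<in> R" using a unfolding J_def by (intro linear_subspaceD[OF lin]) simp
      ultimately show ?thesis using a x mult(2)[of a x] by (auto simp: J_def free_algebra_simps word_mult_closed)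
    qed
  qed
  moreover have "R \<subseteq> J"
  proof
    fix r assume r: "r \<in> R"
    then have t: "r u \<noteq> 0 \<Longrightarrow> length u = N" for u
      using relations by (auto simp: linear_subspace_def tensor_power_def words_def)
    then have "slice [] [] N r = r" unfolding slice_def by fastforce
    then show "r \<in> J" using r t relations_subset by (force simp: J_def)
  qed
  ultimately have "f \<in> J" using T.genideal_minimal assms by blast
  then show "length u < N \<Longrightarrow> f u = 0" and "(\<lambda>u. if length u = N then f u else 0) \<in> R"
    by (simp_all add: J_def slice_def cong: if_cong)
qed

text \<open>The coefficient of a residue class at a word \<open>u\<close> is meaningful only for \<open>length u < N\<close>,
  where the ideal of relations vanishes.\<close>

definition coef :: "(nat list \<Rightarrow> 'k) set \<Rightarrow> nat list \<Rightarrow> 'k" where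
  "coef a u = the_elem ((\<lambda>f. f u) ` a)"

abbreviation sc :: "'k \<Rightarrow> (nat list \<Rightarrow> 'k) set" where "sc c \<equiv> cls (monomial [] c)"
abbreviation X :: "nat list \<Rightarrow> (nat list \<Rightarrow> 'k) set" where "X v \<equiv> cls (monomial v 1)"

text \<open>Two representatives differ by an element of \<open>I\<close>, which vanishes at words
  shorter than \<open>N\<close>; so \<open>the_elem\<close> is applied to a singleton.\<close>

lemma coef_cls:
  assumes "f \<in> carrier T" "length u < N"
  shows "coef (cls f) u = f u"
proof -
  have "g u = f u" if g: "g \<in> cls f" for g
  proof -
    obtain h where h: "h \<in> I" "g = h \<oplus>\<^bsub>T\<^esub> f"
      using g unfolding residue_class_def a_r_coset_def r_coset_def by auto
    then show ?thesis using ideal_low_degrees(1)[OF h(1) assms(2)] by (simp add: free_algebra_simps)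
  qed
  moreover have "f \<in> cls f" unfolding residue_class_def by (rule I.a_rcos_self[OF assms(1)])
  ultimately have "(\<lambda>g. g u) ` cls f = {f u}" by (intro equalityI subsetI) (blast, blast)
  then show ?thesis by (simp add: coef_def)
qed

lemma obtain_rep:
  assumes "a \<in> carrier A" obtains f where "f \<in> carrier T" "a = cls f"
  using assms carrier_A by blast

lemma N_pos [simp]: "0 < N" using two_le_N by simp

lemma coef_add:
  assumes "a \<in> carrier A" "b \<in> carrier A" "length u < N"
  shows "coef (a \<oplus>\<^bsub>A\<^esub> b) u = coef a u + coef b u"
proof -
  obtain f where f: "f \<in> carrier T" "a = cls f" using assms(1) by (rule obtain_rep)
  obtain g where g: "g \<in> carrier T" "b = cls g" using assms(2) by (rule obtain_rep)
  show ?thesis using f g assms(3) by (simp add: cls_add[symmetric] coef_cls add_closed_free)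
qed

lemma coef_mult:
  assumes "a \<in> carrier A" "b \<in> carrier A" "length u < N"
  shows "coef (a \<star> b) u = word_mult (coef a) (coef b) u"
proof -
  obtain f where f: "f \<in> carrier T" "a = cls f" using assms(1) by (rule obtain_rep)
  obtain g where g: "g \<in> carrier T" "b = cls g" using assms(2) by (rule obtain_rep)
  have "coef (a \<star> b) u = word_mult f g u"
    using f g assms(3) by (simp add: cls_mult[symmetric] coef_cls word_mult_closed)
  also have "\<dots> = word_mult (coef a) (coef b) u"
    unfolding word_mult_def using f g assms(3) by (auto intro!: sum.cong simp: coef_cls)
  finally show ?thesis .
qed

lemma coef_zero: "length u < N \<Longrightarrow> coef \<zero>\<^bsub>A\<^esub> u = 0"
  using coef_cls[of "\<lambda>_. 0" u] T.zero_closed by (simp add: cls_zero free_algebra_simps)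

lemma coef_finsum:
  assumes "finite S" "\<And>i. i \<in> S \<Longrightarrow> F i \<in> carrier A" "length u < N"
  shows "coef (\<Oplus>\<^bsub>A\<^esub>i\<in>S. F i) u = (\<Sum>i\<in>S. coef (F i) u)"
  using assms(1,2)
proof (induction S rule: finite_induct)
  case (insert i S)
  then have "F \<in> S \<rightarrow> carrier A" by auto
  with insert show ?case by (simp add: coef_add assms(3))
qed (simp add: coef_zero assms(3))

lemma eps_mult: "\<lbrakk>a \<in> carrier A; b \<in> carrier A\<rbrakk> \<Longrightarrow> coef (a \<star> b) [] = coef a [] * coef b []"
  using coef_mult[of a b "[]"] by (simp add: word_mult_def)

lemma sc_closed [simp]: "sc c \<in> carrier A" by simp
lemma X_closed [simp]: "set v \<subseteq> {..s} \<Longrightarrow> X v \<in> carrier A" by simp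

lemma X_closed_words [simp]: "v \<in> words s n \<Longrightarrow> X v \<in> carrier A" by (simp add: words_def)

lemma coef_sc [simp]: "coef (sc c) [] = c"
  by (subst coef_cls) simp_all

lemma sc_zero: "sc 0 = \<zero>\<^bsub>A\<^esub>"
  using cls_zero by (simp add: monomial_def)

lemma sc_one: "sc 1 = \<one>\<^bsub>A\<^esub>" by (rule cls_one)

lemma sc_add: "sc (c + d) = sc c \<oplus>\<^bsub>A\<^esub> sc d"
proof -
  have "monomial [] (c + d) = (\<lambda>u. monomial [] c u + monomial [] d u)" by (auto simp: monomial_def)
  then show ?thesis by (simp add: cls_add)
qed

lemma sc_mult: "sc (c * d) = sc c \<star> sc d"
  by (subst cls_mult[symmetric]) (simp_all add: word_mult_monomials)

lemma sc_sum: "finite S \<Longrightarrow> sc (\<Sum>i\<in>S. f i) = (\<Oplus>\<^bsub>A\<^esub>i\<in>S. sc (f i))"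
  by (induction S rule: finite_induct) (simp_all add: sc_zero sc_add)

lemma sc_cls: "f \<in> carrier T \<Longrightarrow> sc c \<star> cls f = cls (\<lambda>u. c * f u)"
  by (subst cls_mult[symmetric]) (simp_all add: word_mult_monomial_left[abs_def])

lemma sc_comm: "a \<in> carrier A \<Longrightarrow> sc c \<star> a = a \<star> sc c"
proof -
  assume "a \<in> carrier A"
  then obtain f where f: "f \<in> carrier T" "a = cls f" using obtain_rep by blast
  have "word_mult (monomial [] c) f = word_mult f (monomial [] c)"
    by (simp add: fun_eq_iff word_mult_monomial_left word_mult_monomial_right mult.commute)
  then show ?thesis using f by (simp add: cls_mult[symmetric])
qed

lemma X_append: "\<lbrakk>set v \<subseteq> {..s}; set v' \<subseteq> {..s}\<rbrakk> \<Longrightarrow> X (v @ v') = X v \<star> X v'"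
  by (subst cls_mult[symmetric]) (simp_all add: word_mult_monomials)

lemma cls_sum:
  assumes "finite S" "\<And>i. i \<in> S \<Longrightarrow> f i \<in> carrier T"
  shows "cls (\<lambda>u. \<Sum>i\<in>S. f i u) = (\<Oplus>\<^bsub>A\<^esub>i\<in>S. cls (f i)) \<and> (\<lambda>u. \<Sum>i\<in>S. f i u) \<in> carrier T"
  using assms
proof (induction S rule: finite_induct)
  case empty
  show ?case using T.zero_closed by (simp add: cls_zero free_algebra_simps)
next
  case (insert i S)
  then have "(\<lambda>i. cls (f i)) \<in> S \<rightarrow> carrier A" by auto
  with insert show ?case by (simp add: cls_add add_closed_free)
qed

lemma coef_X_mult:
  assumes "set v \<subseteq> {..s}" "a \<in> carrier A" "length u < N"
  shows "coef (X v \<star> a) u = (if take (length v) u = v then coef a (drop (length v) u) else 0)"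
proof -
  obtain f where f: "f \<in> carrier T" "a = cls f" using assms obtain_rep by blast
  have "coef (X v \<star> a) u = word_mult (monomial v 1) f u"
    using f assms by (simp add: cls_mult[symmetric] coef_cls word_mult_closed)
  then show ?thesis using f assms(3) by (simp add: word_mult_monomial_left coef_cls)
qed

lemma coef_X: "\<lbrakk>set v \<subseteq> {..s}; length u < N\<rbrakk> \<Longrightarrow> coef (X v) u = (if u = v then 1 else 0)"
  by (simp add: coef_cls) (simp add: monomial_def)

text \<open>The augmentation ideal is generated as a left ideal by the letters: sort the words of a
  representative by their last letter.\<close>

lemma augmentation_ideal:
  assumes "a \<in> carrier A" "coef a [] = 0"
  obtains b where "\<And>l. b l \<in> carrier A" "a = (\<Oplus>\<^bsub>A\<^esub>l\<in>{..s}. b l \<star> X [l])"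
proof -
  obtain f where f: "f \<in> carrier T" "a = cls f" using assms obtain_rep by blast
  have f0: "f [] = 0" using assms f by (simp add: coef_cls)
  define g where "g l = (\<lambda>u. f (u @ [l]))" for l
  have gT: "g l \<in> carrier T" for l
  proof -
    have "finite {u. f u \<noteq> 0}" using f by (simp add: free_algebra_def)
    then have "finite ((\<lambda>u. u @ [l]) -` {u. f u \<noteq> 0})" by (rule finite_vimageI) (simp add: inj_def)
    then have "finite {u. g l u \<noteq> 0}" by (simp add: g_def vimage_def)
    then show ?thesis using f by (force simp: g_def free_algebra_def)
  qed
  have "f = (\<lambda>u. \<Sum>l\<le>s. word_mult (g l) (monomial [l] 1) u)"
  proof
    fix u
    show "f u = (\<Sum>l\<le>s. word_mult (g l) (monomial [l] 1) u)"
    proof (cases u rule: rev_cases)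
      case Nil
      then show ?thesis by (simp add: word_mult_monomial_right f0)
    next
      case (snoc v k)
      have "(\<Sum>l\<le>s. word_mult (g l) (monomial [l] 1) u) = (\<Sum>l\<le>s. if k = l then f u else 0)"
        by (rule sum.cong) (auto simp: word_mult_monomial_right snoc g_def)
      also have "\<dots> = (if k \<le> s then f u else 0)" by simp
      also have "\<dots> = f u" using f snoc by (auto simp: free_algebra_def)
      finally show ?thesis by simp
    qed
  qed
  then have "a = cls (\<lambda>u. \<Sum>l\<le>s. word_mult (g l) (monomial [l] 1) u)" using f by simp
  also have "\<dots> = (\<Oplus>\<^bsub>A\<^esub>l\<in>{..s}. cls (word_mult (g l) (monomial [l] 1)))"
    by (rule cls_sum[THEN conjunct1]) (simp_all add: word_mult_closed gT)
  also have "\<dots> = (\<Oplus>\<^bsub>A\<^esub>l\<in>{..s}. cls (g l) \<star> X [l])"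
    by (rule A.finsum_cong') (simp_all add: cls_mult gT)
  finally show ?thesis using that[of "\<lambda>l. cls (g l)"] gT by simp
qed

end

section \<open>Modules and comparison of resolutions\<close>

context left_module
begin

lemma smult_l_null: "x \<in> carrier M \<Longrightarrow> \<zero> \<odot>\<^bsub>M\<^esub> x = \<zero>\<^bsub>M\<^esub>"
  using smult_l_distr[of \<zero> \<zero> x] smult_closed[of \<zero> x] M.add.r_cancel_one' by force

lemma smult_r_null: "a \<in> carrier A \<Longrightarrow> a \<odot>\<^bsub>M\<^esub> \<zero>\<^bsub>M\<^esub> = \<zero>\<^bsub>M\<^esub>"
  using smult_r_distr[of a "\<zero>\<^bsub>M\<^esub>" "\<zero>\<^bsub>M\<^esub>"] smult_closed[of a "\<zero>\<^bsub>M\<^esub>"] M.add.r_cancel_one' by force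

lemma smult_r_minus:
  assumes "a \<in> carrier A" "x \<in> carrier M"
  shows "a \<odot>\<^bsub>M\<^esub> (\<ominus>\<^bsub>M\<^esub> x) = \<ominus>\<^bsub>M\<^esub> (a \<odot>\<^bsub>M\<^esub> x)"
proof (rule M.minus_equality[symmetric])
  show "a \<odot>\<^bsub>M\<^esub> (\<ominus>\<^bsub>M\<^esub> x) \<oplus>\<^bsub>M\<^esub> a \<odot>\<^bsub>M\<^esub> x = \<zero>\<^bsub>M\<^esub>"
    using assms by (simp add: smult_r_distr[symmetric] M.l_neg smult_r_null)
qed (use assms in \<open>simp_all add: smult_closed\<close>)

lemma smult_finsum:
  assumes "finite S" "a \<in> carrier A" "\<And>i. i \<in> S \<Longrightarrow> f i \<in> carrier M"
  shows "a \<odot>\<^bsub>M\<^esub> (\<Oplus>\<^bsub>M\<^esub>i\<in>S. f i) = (\<Oplus>\<^bsub>M\<^esub>i\<in>S. a \<odot>\<^bsub>M\<^esub> f i)"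
  using assms(1,3)
proof (induction S rule: finite_induct)
  case empty
  then show ?case by (simp add: smult_r_null assms)
next
  case (insert i S)
  then have "f \<in> S \<rightarrow> carrier M" "(\<lambda>i. a \<odot>\<^bsub>M\<^esub> f i) \<in> S \<rightarrow> carrier M"
    using assms(2) by (auto simp: smult_closed)
  with insert show ?case by (simp add: smult_r_distr smult_closed assms(2))
qed

end

lemma mod_homI:
  assumes "\<And>x. x \<in> carrier M \<Longrightarrow> f x \<in> carrier M'"
    and "\<And>x y. \<lbrakk>x \<in> carrier M; y \<in> carrier M\<rbrakk> \<Longrightarrow> f (x \<oplus>\<^bsub>M\<^esub> y) = f x \<oplus>\<^bsub>M'\<^esub> f y"
    and "\<And>a x. \<lbrakk>a \<in> carrier A; x \<in> carrier M\<rbrakk> \<Longrightarrow> f (a \<odot>\<^bsub>M\<^esub> x) = a \<odot>\<^bsub>M'\<^esub> f x"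
  shows "f \<in> mod_hom A M M'"
  using assms by (auto simp: mod_hom_def hom_def)

lemma mod_hom_closed: "\<lbrakk>f \<in> mod_hom A M M'; x \<in> carrier M\<rbrakk> \<Longrightarrow> f x \<in> carrier M'"
  by (auto simp: mod_hom_def hom_def)

lemma mod_hom_add:
  "\<lbrakk>f \<in> mod_hom A M M'; x \<in> carrier M; y \<in> carrier M\<rbrakk> \<Longrightarrow> f (x \<oplus>\<^bsub>M\<^esub> y) = f x \<oplus>\<^bsub>M'\<^esub> f y"
  by (auto simp: mod_hom_def hom_def)

lemma mod_hom_smult:
  "\<lbrakk>f \<in> mod_hom A M M'; a \<in> carrier A; x \<in> carrier M\<rbrakk> \<Longrightarrow> f (a \<odot>\<^bsub>M\<^esub> x) = a \<odot>\<^bsub>M'\<^esub> f x"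
  by (auto simp: mod_hom_def)

lemma mod_hom_zero:
  assumes "f \<in> mod_hom A M M'" "left_module A M" "left_module A M'"
  shows "f \<zero>\<^bsub>M\<^esub> = \<zero>\<^bsub>M'\<^esub>"
proof -
  interpret M: left_module A M by fact
  interpret M': left_module A M' by fact
  have "f \<zero>\<^bsub>M\<^esub> = f (\<zero>\<^bsub>A\<^esub> \<odot>\<^bsub>M\<^esub> \<zero>\<^bsub>M\<^esub>)" by (simp add: M.smult_l_null)
  then show ?thesis using mod_hom_closed[OF assms(1), of "\<zero>\<^bsub>M\<^esub>"]
    by (simp add: mod_hom_smult[OF assms(1)] M'.smult_l_null)
qed

lemma mod_hom_minus:
  assumes "f \<in> mod_hom A M M'" "left_module A M" "left_module A M'" "x \<in> carrier M"
  shows "f (\<ominus>\<^bsub>M\<^esub> x) = \<ominus>\<^bsub>M'\<^esub> f x"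
proof -
  interpret M: left_module A M by fact
  interpret M': left_module A M' by fact
  have "f (\<ominus>\<^bsub>M\<^esub> x) \<oplus>\<^bsub>M'\<^esub> f x = \<zero>\<^bsub>M'\<^esub>"
    using mod_hom_add[OF assms(1), of "\<ominus>\<^bsub>M\<^esub> x" x] assms(4) mod_hom_zero[OF assms(1-3)] by (simp add: M.M.l_neg)
  then show ?thesis using assms mod_hom_closed[OF assms(1)] by (intro M'.M.minus_equality[symmetric]) auto
qed

lemma mod_hom_finsum:
  assumes "f \<in> mod_hom A M M'" "left_module A M" "left_module A M'"
    and "finite S" "\<And>i. i \<in> S \<Longrightarrow> g i \<in> carrier M"
  shows "f (\<Oplus>\<^bsub>M\<^esub>i\<in>S. g i) = (\<Oplus>\<^bsub>M'\<^esub>i\<in>S. f (g i))"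
proof -
  interpret M: left_module A M by fact
  interpret M': left_module A M' by fact
  show ?thesis using assms(4,5)
  proof (induction S rule: finite_induct)
    case empty
    then show ?case by (simp add: mod_hom_zero[OF assms(1-3)])
  next
    case (insert i S)
    then have "g \<in> S \<rightarrow> carrier M" "(\<lambda>i. f (g i)) \<in> S \<rightarrow> carrier M'"
      using mod_hom_closed[OF assms(1)] by auto
    with insert show ?case by (simp add: mod_hom_add[OF assms(1)] mod_hom_closed[OF assms(1)])
  qed
qed

lemma mod_hom_comp:
  assumes "f \<in> mod_hom A M M'" "g \<in> mod_hom A M' M''"
  shows "(\<lambda>x. g (f x)) \<in> mod_hom A M M''"
  using mod_hom_closed[OF assms(1)] mod_hom_closed[OF assms(2)]
  by (intro mod_homI)
    (simp_all add: mod_hom_add[OF assms(1)] mod_hom_add[OF assms(2)]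
      mod_hom_smult[OF assms(1)] mod_hom_smult[OF assms(2)])

lemma mod_hom_ident: "(\<lambda>x. x) \<in> mod_hom A M M"
  by (auto simp: mod_hom_def hom_def)

lemma mod_hom_diff:
  assumes "f \<in> mod_hom A M M'" "g \<in> mod_hom A M M'" "left_module A M'"
  shows "(\<lambda>x. f x \<ominus>\<^bsub>M'\<^esub> g x) \<in> mod_hom A M M'"
proof -
  interpret M': left_module A M' by fact
  note closed = mod_hom_closed[OF assms(1)] mod_hom_closed[OF assms(2)]
  show ?thesis
  proof (rule mod_homI)
    fix x y assume "x \<in> carrier M" "y \<in> carrier M"
    then show "f (x \<oplus>\<^bsub>M\<^esub> y) \<ominus>\<^bsub>M'\<^esub> g (x \<oplus>\<^bsub>M\<^esub> y) = f x \<ominus>\<^bsub>M'\<^esub> g x \<oplus>\<^bsub>M'\<^esub> (f y \<ominus>\<^bsub>M'\<^esub> g y)"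
      using closed assms(1,2) by (simp add: mod_hom_add M'.M.minus_eq M'.M.minus_add M'.M.a_ac)
  next
    fix a x assume "a \<in> carrier A" "x \<in> carrier M"
    then show "f (a \<odot>\<^bsub>M\<^esub> x) \<ominus>\<^bsub>M'\<^esub> g (a \<odot>\<^bsub>M\<^esub> x) = a \<odot>\<^bsub>M'\<^esub> (f x \<ominus>\<^bsub>M'\<^esub> g x)"
      using closed assms(1,2)
      by (simp add: mod_hom_smult M'.M.minus_eq M'.smult_r_distr M'.smult_r_minus)
  qed (use closed in auto)
qed

lemma left_module_kernel:
  assumes "left_module A M" "left_module A M'" "f \<in> mod_hom A M M'"
  shows "left_module A (M\<lparr>carrier := {x \<in> carrier M. f x = \<zero>\<^bsub>M'\<^esub>}\<rparr>)"
proof -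
  interpret M: left_module A M by fact
  interpret M': left_module A M' by fact
  note f = mod_hom_add[OF assms(3)] mod_hom_smult[OF assms(3)] mod_hom_zero[OF assms(3,1,2)]
    mod_hom_minus[OF assms(3,1,2)]
  have "abelian_group (M\<lparr>carrier := {x \<in> carrier M. f x = \<zero>\<^bsub>M'\<^esub>}\<rparr>)"
  proof (rule abelian_groupI, goal_cases)
    case (6 x)
    then show ?case by (auto simp: f M.M.l_neg intro!: bexI[of _ "\<ominus>\<^bsub>M\<^esub> x"])
  qed (auto simp: f M.M.a_ac)
  then show ?thesis
    unfolding left_module_def left_module_axioms_def
    by (auto simp: f M.A.ring_axioms M'.smult_r_null M.smult_closed M.smult_l_distr M.smult_r_distr
        M.smult_assoc M.smult_one)
qed

text \<open>\<open>projective\<close> speaks of surjections only, so exactness at \<open>C\<close>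
  is restated as surjectivity of \<open>d\<close> onto the kernel \<open>Z\<close> of
  \<open>d0\<close>, a module on the same carrier type.\<close>

lemma projective_lift:
  fixes A :: "'a ring" and P C' C :: "'a univ_module"
  assumes P: "projective A P" and C': "left_module A C'" and C: "left_module A C" and C0: "left_module A C0"
    and d: "d \<in> mod_hom A C' C" and d0: "d0 \<in> mod_hom A C C0"
    and exact: "d ` carrier C' = {x \<in> carrier C. d0 x = \<zero>\<^bsub>C0\<^esub>}"
    and f: "f \<in> mod_hom A P C" "\<And>x. x \<in> carrier P \<Longrightarrow> d0 (f x) = \<zero>\<^bsub>C0\<^esub>"
  shows "\<exists>g \<in> mod_hom A P C'. \<forall>x\<in>carrier P. d (g x) = f x"
proof -
  define Z where "Z = C\<lparr>carrier := {x \<in> carrier C. d0 x = \<zero>\<^bsub>C0\<^esub>}\<rparr>"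
  have "left_module A Z" unfolding Z_def by (rule left_module_kernel[OF C C0 d0])
  moreover have "d \<in> mod_hom A C' Z"
  proof (rule mod_homI)
    show "d x \<in> carrier Z" if "x \<in> carrier C'" for x using that exact by (auto simp: Z_def)
  qed (use d in \<open>simp_all add: Z_def mod_hom_add mod_hom_smult\<close>)
  moreover have "d ` carrier C' = carrier Z" by (simp add: Z_def exact)
  moreover have "f \<in> mod_hom A P Z"
  proof (rule mod_homI)
    show "f x \<in> carrier Z" if "x \<in> carrier P" for x using that f mod_hom_closed by (force simp: Z_def)
  qed (use f in \<open>simp_all add: Z_def mod_hom_add mod_hom_smult\<close>)
  ultimately show ?thesis using P C' unfolding projective_def by blast
qed

text \<open>The augmented complex \<open>\<cdots> \<rightarrow> P 1 \<rightarrow> P 0 \<rightarrow> M \<rightarrow> 0\<close>, shifted by one.\<close>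

definition augmented :: "'b \<Rightarrow> (nat \<Rightarrow> 'b) \<Rightarrow> nat \<Rightarrow> 'b" where
  "augmented x f n = (case n of 0 \<Rightarrow> x | Suc i \<Rightarrow> f i)"

lemma augmented_simps [simp]: "augmented x f 0 = x" "augmented x f (Suc i) = f i"
  by (simp_all add: augmented_def)

context
  fixes A :: "'a ring" and M :: "'a univ_module" and C d e
  assumes res: "projective_resolution A M C d e" and M: "left_module A M"
begin

lemma resolution_modules: "left_module A (C i)" "left_module A (augmented M C i)"
  using res M unfolding projective_resolution_def projective_def augmented_def by (auto split: nat.split)

lemma resolution_maps: "d i \<in> mod_hom A (C (Suc i)) (C i)"
  "augmented e d i \<in> mod_hom A (C i) (augmented M C i)"
  using res unfolding projective_resolution_def augmented_def by (auto split: nat.split)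

lemma resolution_exact:
  "d i ` carrier (C (Suc i)) = {x \<in> carrier (C i). augmented e d i x = \<zero>\<^bsub>augmented M C i\<^esub>}"
  using res unfolding projective_resolution_def augmented_def by (auto split: nat.split)

lemma resolution_complex: "x \<in> carrier (C (Suc i)) \<Longrightarrow> augmented e d i (d i x) = \<zero>\<^bsub>augmented M C i\<^esub>"
  using resolution_exact[of i] by auto

lemma resolution_lift:
  assumes "projective A P" "f \<in> mod_hom A P (C i)"
    and "\<And>x. x \<in> carrier P \<Longrightarrow> augmented e d i (f x) = \<zero>\<^bsub>augmented M C i\<^esub>"
  shows "\<exists>g\<in>mod_hom A P (C (Suc i)). \<forall>x\<in>carrier P. d i (g x) = f x"
  by (rule projective_lift[OF assms(1) resolution_modules(1,1,2) resolution_maps resolution_exact assms(2,3)])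

end

lemma comparison_map:
  fixes A :: "'a ring" and M :: "'a univ_module"
  assumes P: "projective_resolution A M P d e" and C: "projective_resolution A M C d' e'" and M: "left_module A M"
  obtains f where "\<And>i. f i \<in> mod_hom A (P i) (C i)" "\<And>x. x \<in> carrier (P 0) \<Longrightarrow> e' (f 0 x) = e x"
    "\<And>i x. x \<in> carrier (P (Suc i)) \<Longrightarrow> d' i (f (Suc i) x) = f i (d i x)"
proof -
  have proj: "projective A (P i)" for i using P unfolding projective_resolution_def by blast
  note P_mod = resolution_modules[OF P M] and C_mod = resolution_modules[OF C M]
  note P_maps = resolution_maps[OF P M] and C_maps = resolution_maps[OF C M]
  have e: "e \<in> mod_hom A (P 0) M" using P_maps(2)[of 0] by simp
  have e': "e' \<in> mod_hom A (C 0) M" using C_maps(2)[of 0] by simp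
  \<comment> \<open>Besides the map, \<open>good\<close> records that its composite with
    \<open>d i\<close> is annihilated by the map leaving \<open>C i\<close>, which is what the next
    lift requires. The clause for \<open>i = 0\<close> is the compatibility with the
    augmentations.\<close>
  define good where "good i f \<longleftrightarrow> f \<in> mod_hom A (P i) (C i) \<and>
    (\<forall>x\<in>carrier (P (Suc i)). augmented e' d' i (f (d i x)) = \<zero>\<^bsub>augmented M C i\<^esub>) \<and>
    (i = 0 \<longrightarrow> (\<forall>x\<in>carrier (P 0). e' (f x) = e x))" for i f
  have "\<exists>f. good 0 f"
  proof -
    have "e' ` carrier (C 0) = carrier M" using C unfolding projective_resolution_def by blast
    then obtain f where f: "f \<in> mod_hom A (P 0) (C 0)" "\<forall>x\<in>carrier (P 0). e' (f x) = e x"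
      using proj[of 0] C_mod(1)[of 0] M e e' unfolding projective_def by blast
    moreover have "e' (f (d 0 x)) = \<zero>\<^bsub>M\<^esub>" if "x \<in> carrier (P (Suc 0))" for x
      using resolution_complex[OF P M that] f(2) mod_hom_closed[OF P_maps(1) that] by simp
    ultimately show ?thesis unfolding good_def by auto
  qed
  moreover have "\<exists>g. good (Suc i) g \<and> (\<forall>x\<in>carrier (P (Suc i)). d' i (g x) = f (d i x))" if f: "good i f" for i f
  proof -
    have fd: "(\<lambda>x. f (d i x)) \<in> mod_hom A (P (Suc i)) (C i)"
      using f mod_hom_comp[OF P_maps(1)] unfolding good_def by blast
    obtain g where g: "g \<in> mod_hom A (P (Suc i)) (C (Suc i))" "\<forall>x\<in>carrier (P (Suc i)). d' i (g x) = f (d i x)"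
      using resolution_lift[OF C M proj fd] f unfolding good_def by blast
    have "d' i (g (d (Suc i) x)) = \<zero>\<^bsub>C i\<^esub>" if x: "x \<in> carrier (P (Suc (Suc i)))" for x
    proof -
      have "d i (d (Suc i) x) = \<zero>\<^bsub>P i\<^esub>" using resolution_complex[OF P M x] by simp
      then show ?thesis using g(2) mod_hom_closed[OF P_maps(1) x] f mod_hom_zero[OF _ P_mod(1) C_mod(1)]
        unfolding good_def by auto
    qed
    then show ?thesis using g unfolding good_def by (intro exI[of _ g]) simp
  qed
  ultimately obtain f where "\<forall>i. good i (f i) \<and> (\<forall>x\<in>carrier (P (Suc i)). d' i (f (Suc i) x) = f i (d i x))"
    using dependent_nat_choice[of good "\<lambda>i f g. \<forall>x\<in>carrier (P (Suc i)). d' i (g x) = f (d i x)"] by blast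
  then show ?thesis using that[of f] unfolding good_def by blast
qed

lemma null_homotopy:
  fixes A :: "'a ring" and M :: "'a univ_module"
  assumes C: "projective_resolution A M C d e" and M: "left_module A M"
    and f: "\<And>i. f i \<in> mod_hom A (C i) (C i)" "\<And>x. x \<in> carrier (C 0) \<Longrightarrow> e (f 0 x) = \<zero>\<^bsub>M\<^esub>"
      "\<And>i x. x \<in> carrier (C (Suc i)) \<Longrightarrow> d i (f (Suc i) x) = f i (d i x)"
  obtains h where "\<And>i. h i \<in> mod_hom A (C i) (C (Suc i))"
    "\<And>i x. x \<in> carrier (C (Suc i)) \<Longrightarrow> d (Suc i) (h (Suc i) x) = f (Suc i) x \<ominus>\<^bsub>C (Suc i)\<^esub> h i (d i x)"
proof -
  have proj: "projective A (C i)" for i using C unfolding projective_resolution_def by blast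
  note C_mod = resolution_modules[OF C M] and C_maps = resolution_maps[OF C M]
  \<comment> \<open>Only the composite with \<open>d i\<close> is remembered:
    \<open>d h d = f d\<close> is exactly what puts \<open>f (Suc i) - h d\<close> into the kernel
    of \<open>d i\<close>. In degree 0 it follows from a lift of \<open>f 0\<close> itself.\<close>
  define good where "good i h \<longleftrightarrow> h \<in> mod_hom A (C i) (C (Suc i)) \<and>
    (\<forall>x\<in>carrier (C (Suc i)). d i (h (d i x)) = f i (d i x))" for i h
  have "\<exists>h. good 0 h"
  proof -
    obtain h where "h \<in> mod_hom A (C 0) (C (Suc 0))" "\<forall>x\<in>carrier (C 0). d 0 (h x) = f 0 x"
      using resolution_lift[OF C M proj f(1), of 0] f(2) by auto
    then show ?thesis using mod_hom_closed[OF C_maps(1)] unfolding good_def by blast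
  qed
  moreover have "\<exists>g. good (Suc i) g \<and>
      (\<forall>x\<in>carrier (C (Suc i)). d (Suc i) (g x) = f (Suc i) x \<ominus>\<^bsub>C (Suc i)\<^esub> h (d i x))" if h: "good i h" for i h
  proof -
    interpret S: left_module A "C (Suc i)" by (rule C_mod)
    interpret Z: left_module A "C i" by (rule C_mod)
    have hd: "(\<lambda>x. h (d i x)) \<in> mod_hom A (C (Suc i)) (C (Suc i))"
      using h mod_hom_comp[OF C_maps(1)] unfolding good_def by blast
    have dm: "d i \<in> mod_hom A (C (Suc i)) (C i)" by (rule C_maps)
    have "d i (f (Suc i) x \<ominus>\<^bsub>C (Suc i)\<^esub> h (d i x)) = \<zero>\<^bsub>C i\<^esub>" if x: "x \<in> carrier (C (Suc i))" for x
    proof -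
      have "d i (f (Suc i) x \<ominus>\<^bsub>C (Suc i)\<^esub> h (d i x)) = d i (f (Suc i) x) \<oplus>\<^bsub>C i\<^esub> \<ominus>\<^bsub>C i\<^esub> d i (h (d i x))"
        using mod_hom_closed[OF f(1) x] mod_hom_closed[OF hd x]
        by (simp add: S.M.minus_eq mod_hom_add[OF dm] mod_hom_minus[OF dm C_mod(1) C_mod(1)])
      also have "\<dots> = \<zero>\<^bsub>C i\<^esub>"
        using h x f(3)[OF x] mod_hom_closed[OF f(1) mod_hom_closed[OF dm x]] unfolding good_def by (simp add: Z.M.r_neg)
      finally show ?thesis .
    qed
    then obtain g where g: "g \<in> mod_hom A (C (Suc i)) (C (Suc (Suc i)))"
      "\<forall>x\<in>carrier (C (Suc i)). d (Suc i) (g x) = f (Suc i) x \<ominus>\<^bsub>C (Suc i)\<^esub> h (d i x)"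
      using resolution_lift[OF C M proj mod_hom_diff[OF f(1) hd C_mod(1)]] by auto
    have "d (Suc i) (g (d (Suc i) x)) = f (Suc i) (d (Suc i) x)" if x: "x \<in> carrier (C (Suc (Suc i)))" for x
    proof -
      have dx: "d (Suc i) x \<in> carrier (C (Suc i))" using mod_hom_closed[OF C_maps(1) x] .
      have "d i (d (Suc i) x) = \<zero>\<^bsub>C i\<^esub>" using resolution_complex[OF C M x] by simp
      then have "h (d i (d (Suc i) x)) = \<zero>\<^bsub>C (Suc i)\<^esub>"
        using h mod_hom_zero[OF _ C_mod(1) C_mod(1)] unfolding good_def by auto
      then show ?thesis using g(2) dx mod_hom_closed[OF f(1) dx] by (simp add: S.M.minus_eq)
    qed
    then show ?thesis using g unfolding good_def by blast
  qed
  ultimately obtain h where "\<forall>i. good i (h i) \<and>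
      (\<forall>x\<in>carrier (C (Suc i)). d (Suc i) (h (Suc i) x) = f (Suc i) x \<ominus>\<^bsub>C (Suc i)\<^esub> h i (d i x))"
    using dependent_nat_choice[of good "\<lambda>i h g. \<forall>x\<in>carrier (C (Suc i)).
      d (Suc i) (g x) = f (Suc i) x \<ominus>\<^bsub>C (Suc i)\<^esub> h (d i x)"] by blast
  then show ?thesis using that[of h] unfolding good_def by blast
qed

text \<open>The identity of \<open>C\<close> factors up to homotopy through the shorter resolution \<open>P\<close>, hence is
  null-homotopic wherever \<open>P\<close> vanishes.\<close>

lemma contraction_beyond_short_resolution:
  fixes A :: "'a ring" and M :: "'a univ_module"
  assumes C: "projective_resolution A M C d e" and P: "projective_resolution A M P d' e'" and M: "left_module A M"
    and zero: "carrier (P (Suc n)) = {\<zero>\<^bsub>P (Suc n)\<^esub>}"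
  obtains h h' where "h \<in> mod_hom A (C n) (C (Suc n))" "h' \<in> mod_hom A (C (Suc n)) (C (Suc (Suc n)))"
    "\<And>x. x \<in> carrier (C (Suc n)) \<Longrightarrow> x = d (Suc n) (h' x) \<oplus>\<^bsub>C (Suc n)\<^esub> h (d n x)"
proof -
  note C_mod = resolution_modules[OF C M] and P_mod = resolution_modules[OF P M]
  note C_maps = resolution_maps[OF C M] and P_maps = resolution_maps[OF P M]
  obtain f where f: "\<And>i. f i \<in> mod_hom A (C i) (P i)" "\<And>x. x \<in> carrier (C 0) \<Longrightarrow> e' (f 0 x) = e x"
    "\<And>i x. x \<in> carrier (C (Suc i)) \<Longrightarrow> d' i (f (Suc i) x) = f i (d i x)"
    by (rule comparison_map[OF C P M]) blast
  obtain g where g: "\<And>i. g i \<in> mod_hom A (P i) (C i)" "\<And>x. x \<in> carrier (P 0) \<Longrightarrow> e (g 0 x) = e' x"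
    "\<And>i x. x \<in> carrier (P (Suc i)) \<Longrightarrow> d i (g (Suc i) x) = g i (d' i x)"
    by (rule comparison_map[OF P C M]) blast
  define k where "k i x = x \<ominus>\<^bsub>C i\<^esub> g i (f i x)" for i x
  have gf: "(\<lambda>x. g i (f i x)) \<in> mod_hom A (C i) (C i)" for i using mod_hom_comp f(1) g(1) by blast
  have k: "k i \<in> mod_hom A (C i) (C i)" for i
    unfolding k_def by (rule mod_hom_diff[OF mod_hom_ident gf C_mod(1)])
  have diff: "\<phi> (k i x) = \<phi> x \<ominus>\<^bsub>M'\<^esub> \<phi> (g i (f i x))"
    if "\<phi> \<in> mod_hom A (C i) M'" "left_module A M'" "x \<in> carrier (C i)" for \<phi> and M' :: "'a univ_module" and i x
  proof -
    interpret M': left_module A M' by fact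
    interpret C: left_module A "C i" by (rule C_mod)
    show ?thesis using that mod_hom_closed[OF gf that(3)]
      by (simp add: k_def C.M.minus_eq M'.M.minus_eq mod_hom_add[OF that(1)] mod_hom_minus[OF that(1) C_mod(1)])
  qed
  interpret M: left_module A M by fact
  have e: "e \<in> mod_hom A (C 0) M" using C_maps(2)[of 0] by simp
  have "e (k 0 x) = \<zero>\<^bsub>M\<^esub>" if "x \<in> carrier (C 0)" for x
    using diff[OF e M that] g(2)[OF mod_hom_closed[OF f(1) that]] f(2)[OF that] mod_hom_closed[OF e that]
    by (simp add: M.M.minus_eq M.M.r_neg)
  moreover have "d i (k (Suc i) x) = k i (d i x)" if x: "x \<in> carrier (C (Suc i))" for i x
    using diff[OF C_maps(1) C_mod(1) x] g(3)[OF mod_hom_closed[OF f(1) x]] f(3)[OF x] by (simp add: k_def)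
  ultimately obtain h where h: "\<And>i. h i \<in> mod_hom A (C i) (C (Suc i))"
    "\<And>i x. x \<in> carrier (C (Suc i)) \<Longrightarrow> d (Suc i) (h (Suc i) x) = k (Suc i) x \<ominus>\<^bsub>C (Suc i)\<^esub> h i (d i x)"
    using null_homotopy[OF C M k] by metis
  interpret S: left_module A "C (Suc n)" by (rule C_mod)
  have "x = d (Suc n) (h (Suc n) x) \<oplus>\<^bsub>C (Suc n)\<^esub> h n (d n x)" if x: "x \<in> carrier (C (Suc n))" for x
  proof -
    \<comment> \<open>Where \<open>P\<close> vanishes the composite of \<open>f\<close> and
      \<open>g\<close> is zero, so \<open>k\<close> is the identity there and the homotopy becomes a
      contraction.\<close>
    have "f (Suc n) x = \<zero>\<^bsub>P (Suc n)\<^esub>" using mod_hom_closed[OF f(1) x] zero by blast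
    then have "k (Suc n) x = x" using x mod_hom_zero[OF g(1) P_mod(1) C_mod(1)] by (simp add: k_def S.M.minus_eq)
    then show ?thesis
      using h(2)[OF x] x mod_hom_closed[OF h(1) mod_hom_closed[OF C_maps(1) x]]
      by (simp add: S.M.minus_eq S.M.a_assoc S.M.l_neg)
  qed
  then show ?thesis using that[OF h(1)[of n] h(1)[of "Suc n"]] by blast
qed

section \<open>Free modules on subspaces of tensor powers\<close>

text \<open>A basis \<open>b\<close> of \<open>V\<close> in reduced echelon form, indexed by its set \<open>B\<close> of pivot words: the
  coordinates of \<open>v\<close> in this basis are the values of \<open>v\<close> at the pivots.\<close>

definition pivot_basis ::
    "(nat list \<Rightarrow> 'k::field) set \<Rightarrow> nat list set \<Rightarrow> (nat list \<Rightarrow> nat list \<Rightarrow> 'k) \<Rightarrow> bool" where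
  "pivot_basis V B b \<longleftrightarrow> finite B \<and> (\<forall>p\<in>B. b p \<in> V) \<and>
     (\<forall>p\<in>B. \<forall>q\<in>B. b p q = (if p = q then 1 else 0)) \<and> (\<forall>v\<in>V. v = (\<lambda>u. \<Sum>p\<in>B. v p * b p u))"

lemma linear_subspaceI:
  assumes "U \<subseteq> V" "(\<lambda>_. 0) \<in> U" "\<And>f g. \<lbrakk>f \<in> U; g \<in> U\<rbrakk> \<Longrightarrow> (\<lambda>u. f u + g u) \<in> U"
    "\<And>c f. f \<in> U \<Longrightarrow> (\<lambda>u. c * f u) \<in> U"
  shows "linear_subspace U V"
  unfolding linear_subspace_def by (intro conjI ballI allI assms)

text \<open>Gaussian elimination, one word at a time: the subspace of vectors vanishing at the new
  word \<open>x\<close> has a basis by induction, and if it is proper then one further vector,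
  normalised at \<open>x\<close>, completes it.\<close>

lemma pivot_basis_exists:
  assumes "finite W" "linear_subspace V U" "\<And>v u. \<lbrakk>v \<in> V; v u \<noteq> 0\<rbrakk> \<Longrightarrow> u \<in> W"
  shows "\<exists>B b. pivot_basis V B b"
  using assms
proof (induction W arbitrary: V rule: finite_induct)
  case empty
  then have "v = (\<lambda>_. 0)" if "v \<in> V" for v using that by blast
  then have "pivot_basis V {} (\<lambda>_ _. 0)" unfolding pivot_basis_def by simp
  then show ?case by blast
next
  case (insert x W)
  note V = linear_subspaceD[OF insert.prems(1)]
  define V0 where "V0 = {v \<in> V. v x = 0}"
  have "linear_subspace V0 U" using insert.prems(1) by (auto simp: linear_subspace_def V0_def)
  moreover have "u \<in> W" if "v \<in> V0" "v u \<noteq> 0" for v u using that insert.prems(2)[of v u] by (auto simp: V0_def)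
  ultimately obtain B b where "pivot_basis V0 B b" using insert.IH by blast
  then have B: "finite B" "\<And>p. p \<in> B \<Longrightarrow> b p \<in> V0" "\<And>p q. \<lbrakk>p \<in> B; q \<in> B\<rbrakk> \<Longrightarrow> b p q = (if p = q then 1 else 0)"
    "\<And>v. v \<in> V0 \<Longrightarrow> v = (\<lambda>u. \<Sum>p\<in>B. v p * b p u)" unfolding pivot_basis_def by auto
  show ?case
  proof (cases "V0 = V")
    case True
    then show ?thesis using \<open>pivot_basis V0 B b\<close> by blast
  next
    case False
    then obtain g0 where g0: "g0 \<in> V" "g0 x \<noteq> 0" by (auto simp: V0_def)
    define g1 where "g1 = (\<lambda>u. 1 / g0 x * g0 u)"
    have g1: "g1 \<in> V" "g1 x = 1" unfolding g1_def using V(3)[OF g0(1), of "1 / g0 x"] g0(2) by simp_all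
    \<comment> \<open>Clears the entries of \<open>g1\<close> at the old pivots; the value at
      \<open>x\<close> stays 1 because the old basis vectors vanish at \<open>x\<close>.\<close>
    define g where "g = (\<lambda>u. 1 * g1 u + (- 1) * (\<Sum>p\<in>B. g1 p * b p u))"
    have "(\<lambda>u. \<Sum>p\<in>B. g1 p * b p u) \<in> V"
      by (rule linear_subspace_sum[OF insert.prems(1) B(1)]) (use B(2) V(3) in \<open>auto simp: V0_def\<close>)
    then have gV: "g \<in> V" unfolding g_def by (intro linear_subspace_lin[OF insert.prems(1)] g1(1))
    have b0: "b p x = 0" if "p \<in> B" for p using B(2)[OF that] by (simp add: V0_def)
    have gx: "g x = 1" using g1(2) b0 by (simp add: g_def)
    have gB: "g q = 0" if "q \<in> B" for q
    proof -
      have "(\<Sum>p\<in>B. g1 p * b p q) = (\<Sum>p\<in>B. if p = q then g1 q else 0)"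
        by (rule sum.cong) (auto simp: B(3) that)
      then show ?thesis using B(1) that by (simp add: g_def)
    qed
    have xB: "x \<notin> B" using b0 B(3) by force
    have "pivot_basis V (insert x B) (b(x := g))"
      unfolding pivot_basis_def
    proof (intro conjI ballI)
      fix v assume v: "v \<in> V"
      define v0 where "v0 = (\<lambda>u. 1 * v u + (- v x) * g u)"
      have "v0 \<in> V" unfolding v0_def by (rule linear_subspace_lin[OF insert.prems(1) v gV])
      then have "v0 \<in> V0" using gx by (simp add: v0_def V0_def)
      then have eq: "v0 u = (\<Sum>p\<in>B. v0 p * b p u)" for u using B(4) by metis
      have "v0 p = v p" if "p \<in> B" for p using gB[OF that] by (simp add: v0_def)
      then have eq': "(\<Sum>p\<in>B. v0 p * b p u) = (\<Sum>p\<in>B. v p * b p u)" for u by (intro sum.cong) auto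
      have "v u = (\<Sum>p\<in>B. v p * b p u) + v x * g u" for u
      proof -
        have "v u = v0 u + v x * g u" by (simp add: v0_def)
        also have "v0 u = (\<Sum>p\<in>B. v p * b p u)" using eq[of u] eq'[of u] by (rule trans)
        finally show ?thesis .
      qed
      moreover have "(\<Sum>p\<in>insert x B. v p * (b(x := g)) p u) = (\<Sum>p\<in>B. v p * b p u) + v x * g u" for u
      proof -
        have "(\<Sum>p\<in>B. v p * (b(x := g)) p u) = (\<Sum>p\<in>B. v p * b p u)"
          using xB by (intro sum.cong) auto
        then show ?thesis using B(1) xB by (simp add: add.commute)
      qed
      ultimately show "v = (\<lambda>u. \<Sum>p\<in>insert x B. v p * (b(x := g)) p u)"
        by (intro ext) (rule trans[OF _ sym])
    qed (use B(1,2,3) b0 gx gB gV in \<open>auto simp: V0_def\<close>)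
    then show ?thesis by blast
  qed
qed

lemma pivot_basisD:
  assumes "pivot_basis V B b"
  shows "finite B" "p \<in> B \<Longrightarrow> b p \<in> V" "\<lbrakk>p \<in> B; q \<in> B\<rbrakk> \<Longrightarrow> b p q = (if p = q then 1 else 0)"
    "v \<in> V \<Longrightarrow> v u = (\<Sum>p\<in>B. v p * b p u)"
  using assms unfolding pivot_basis_def by (blast, blast, blast, metis)

lemma word_mult_tensor_left:
  assumes "g \<in> tensor_power s a"
  shows "word_mult g h u = (if a \<le> length u then g (take a u) * h (drop a u) else 0)"
proof -
  have g: "g v = 0" if "length v \<noteq> a" for v using assms that by (auto simp: tensor_power_def words_def)
  have "word_mult g h u = (\<Sum>i\<le>length u. if i = a then g (take a u) * h (drop a u) else 0)"
    unfolding word_mult_def by (rule sum.cong) (auto simp: g min_absorb2)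
  then show ?thesis by simp
qed

lemma word_mult_tensor:
  assumes g: "g \<in> tensor_power s a" and h: "h \<in> tensor_power s b"
  shows "word_mult g h \<in> tensor_power s (a + b)"
  unfolding tensor_power_def mem_Collect_eq
proof (intro allI impI)
  fix u assume "word_mult g h u \<noteq> 0"
  then have nz: "g (take a u) \<noteq> 0" "h (drop a u) \<noteq> 0" "a \<le> length u"
    using word_mult_tensor_left[OF g, of h u] by (auto split: if_splits)
  then have "take a u \<in> words s a" "drop a u \<in> words s b" using g h unfolding tensor_power_def by blast+
  moreover have "set u = set (take a u) \<union> set (drop a u)" by (metis append_take_drop_id set_append)
  ultimately show "u \<in> words s (a + b)" using nz(3) by (auto simp: words_def)
qed

lemma tensor_prod_add:
  assumes "f \<in> tensor_prod U V" "g \<in> tensor_prod U V"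
  shows "(\<lambda>u. f u + g u) \<in> tensor_prod U V"
  using assms(2,1) by (induction rule: tensor_prod.induct) (auto simp: add.assoc[symmetric] intro: tensor_prod.add)

lemma tensor_prod_single:
  "\<lbrakk>g \<in> U; h \<in> V\<rbrakk> \<Longrightarrow> word_mult g h \<in> tensor_prod U V"
  using tensor_prod.add[OF tensor_prod.zero, of g U h V] by simp

lemma tensor_prod_sum:
  assumes "finite S" "\<And>i. i \<in> S \<Longrightarrow> f i \<in> tensor_prod U V"
  shows "(\<lambda>u. \<Sum>i\<in>S. f i u) \<in> tensor_prod U V"
  using assms by (induction S rule: finite_induct) (auto intro: tensor_prod.zero tensor_prod_add)

lemma monomial_tensor: "p \<in> words s n \<Longrightarrow> monomial p c \<in> tensor_power s n"
  by (auto simp: tensor_power_def monomial_def)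

text \<open>Grouping the words of \<open>f\<close> by their first \<open>a\<close> letters writes
  \<open>f\<close> as the sum of all \<open>p\<close> times the contraction of \<open>f\<close> by
  \<open>p\<close>. The next lemma does the same with the last letters.\<close>

lemma tensor_prod_leftI:
  assumes f: "f \<in> tensor_power s (a + n)" and sl: "\<And>p. p \<in> words s a \<Longrightarrow> slice p [] n f \<in> U"
  shows "f \<in> tensor_prod (tensor_power s a) U"
proof -
  have "f = (\<lambda>u. \<Sum>p\<in>words s a. word_mult (monomial p 1) (slice p [] n f) u)"
  proof
    fix u
    have "(\<Sum>p\<in>words s a. word_mult (monomial p 1) (slice p [] n f) u)
        = (\<Sum>p\<in>words s a. if p = take a u then (if length u = a + n then f u else 0) else 0)"
      by (intro sum.cong) (auto simp: word_mult_monomial_left slice_def words_def)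
    also have "\<dots> = (if take a u \<in> words s a \<and> length u = a + n then f u else 0)" by simp
    also have "\<dots> = f u"
      using f set_take_subset[of a u] by (fastforce simp: tensor_power_def words_def)
    finally show "f u = (\<Sum>p\<in>words s a. word_mult (monomial p 1) (slice p [] n f) u)" by simp
  qed
  moreover have "(\<lambda>u. \<Sum>p\<in>words s a. word_mult (monomial p 1) (slice p [] n f) u) \<in> tensor_prod (tensor_power s a) U"
    by (rule tensor_prod_sum) (auto intro!: tensor_prod_single monomial_tensor sl)
  ultimately show ?thesis by simp
qed

lemma tensor_prod_rightI:
  assumes f: "f \<in> tensor_power s (n + b)" and sl: "\<And>q. q \<in> words s b \<Longrightarrow> slice [] q n f \<in> U"
  shows "f \<in> tensor_prod U (tensor_power s b)"
proof -
  have "f = (\<lambda>u. \<Sum>q\<in>words s b. word_mult (slice [] q n f) (monomial q 1) u)"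
  proof
    fix u
    have "(\<Sum>q\<in>words s b. word_mult (slice [] q n f) (monomial q 1) u)
        = (\<Sum>q\<in>words s b. if q = drop n u then (if length u = n + b then f u else 0) else 0)"
    proof (intro sum.cong refl)
      fix q assume "q \<in> words s b"
      then show "word_mult (slice [] q n f) (monomial q 1) u
          = (if q = drop n u then (if length u = n + b then f u else 0) else 0)"
        by (cases "length u = n + b") (auto simp: word_mult_monomial_right slice_def words_def)
    qed
    also have "\<dots> = (if drop n u \<in> words s b \<and> length u = n + b then f u else 0)" by simp
    also have "\<dots> = f u"
      using f set_drop_subset[of n u] by (fastforce simp: tensor_power_def words_def)
    finally show "f u = (\<Sum>q\<in>words s b. word_mult (slice [] q n f) (monomial q 1) u)" by simp
  qed
  moreover have "(\<lambda>u. \<Sum>q\<in>words s b. word_mult (slice [] q n f) (monomial q 1) u) \<in> tensor_prod U (tensor_power s b)"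
    by (rule tensor_prod_sum) (auto intro!: tensor_prod_single monomial_tensor sl)
  ultimately show ?thesis by simp
qed

section \<open>Contractions of tensors in the dual components, and free modules on them\<close>

context homogeneous_relations
begin

lemma relations_tensor: "r \<in> R \<Longrightarrow> r \<in> tensor_power s N"
  using relations by (auto simp: linear_subspace_def)

lemma relation_zero: "r \<in> R \<Longrightarrow> length u \<noteq> N \<Longrightarrow> r u = 0"
  using relations by (auto simp: linear_subspace_def tensor_power_def words_def)

lemma relation_letters: "r \<in> R \<Longrightarrow> r u \<noteq> 0 \<Longrightarrow> u \<in> words s N"
  using relations by (auto simp: linear_subspace_def tensor_power_def)

lemmas relations_lin = linear_subspaceD[OF relations]

lemma linear_subspace_tensor_power:
  "linear_subspace (tensor_power s n) (tensor_power s n :: (nat list \<Rightarrow> 'k) set)"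
proof -
  have add: "(\<lambda>u. f u + g u) \<in> tensor_power s n" if "f \<in> tensor_power s n" "g \<in> tensor_power s n" for f g :: "nat list \<Rightarrow> 'k"
    unfolding tensor_power_def mem_Collect_eq
  proof (intro allI impI)
    fix u assume "f u + g u \<noteq> 0"
    then have "f u \<noteq> 0 \<or> g u \<noteq> 0" by auto
    then show "u \<in> words s n" using that unfolding tensor_power_def by blast
  qed
  have smult: "(\<lambda>u. c * f u) \<in> tensor_power s n" if "f \<in> tensor_power s n" for c and f :: "nat list \<Rightarrow> 'k"
    unfolding tensor_power_def mem_Collect_eq
  proof (intro allI impI)
    fix u assume "c * f u \<noteq> 0"
    then have "f u \<noteq> 0" by auto
    then show "u \<in> words s n" using that unfolding tensor_power_def by blast
  qed
  show ?thesis
    by (intro linear_subspaceI subset_refl add smult) (simp add: tensor_power_def)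
qed

lemma tensor_prod_left:
  assumes "f \<in> tensor_prod (tensor_power s a) R"
  shows "f \<in> tensor_power s (a + N) \<and> (\<forall>p. length p = a \<longrightarrow> slice p [] N f \<in> R)"
  using assms
proof (induction rule: tensor_prod.induct)
  case zero
  then show ?case using relations_lin(1) by (simp add: tensor_power_def slice_def)
next
  case (add f g h)
  have "word_mult g h \<in> tensor_power s (a + N)"
    using add.hyps(2) relations_tensor[OF add.hyps(3)] by (rule word_mult_tensor)
  then have "(\<lambda>u. f u + word_mult g h u) \<in> tensor_power s (a + N)"
    using add.IH linear_subspaceD(2)[OF linear_subspace_tensor_power] by blast
  moreover have "slice p [] N (\<lambda>u. f u + word_mult g h u) \<in> R" if "length p = a" for p
  proof -
    have "slice p [] N (\<lambda>u. f u + word_mult g h u) = (\<lambda>u. slice p [] N f u + g p * h u)"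
      using that add.hyps(3) by (auto simp: slice_def word_mult_tensor_left[OF add.hyps(2)] relation_zero)
    then show ?thesis using add.IH relations_lin(2)[OF _ relations_lin(3)[OF add.hyps(3)]] that by simp
  qed
  ultimately show ?case by blast
qed

lemma tensor_prod_both:
  assumes "f \<in> tensor_prod (tensor_prod (tensor_power s a) R) (tensor_power s b)"
  shows "f \<in> tensor_power s (a + N + b) \<and> (\<forall>p q. length p = a \<and> length q = b \<longrightarrow> slice p q N f \<in> R)"
  using assms
proof (induction rule: tensor_prod.induct)
  case zero
  then show ?case using relations_lin(1) by (simp add: tensor_power_def slice_def)
next
  case (add f g h)
  note g = tensor_prod_left[OF add.hyps(2), THEN conjunct1] tensor_prod_left[OF add.hyps(2), THEN conjunct2, rule_format]
  have "word_mult g h \<in> tensor_power s (a + N + b)"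
    using g(1) add.hyps(3) by (rule word_mult_tensor)
  then have "(\<lambda>u. f u + word_mult g h u) \<in> tensor_power s (a + N + b)"
    using add.IH linear_subspaceD(2)[OF linear_subspace_tensor_power] by blast
  moreover have "slice p q N (\<lambda>u. f u + word_mult g h u) \<in> R" if "length p = a" "length q = b" for p q
  proof -
    have "slice p q N (\<lambda>u. f u + word_mult g h u) = (\<lambda>u. slice p q N f u + h q * slice p [] N g u)"
      using that by (auto simp: slice_def word_mult_tensor_left[OF g(1)])
    then show ?thesis using add.IH relations_lin(2)[OF _ relations_lin(3)[OF g(2)]] that by simp
  qed
  ultimately show ?case by blast
qed

lemma tensor_prod_bothI:
  assumes f: "f \<in> tensor_power s (a + N + b)"
    and sl: "\<And>p q. \<lbrakk>p \<in> words s a; q \<in> words s b\<rbrakk> \<Longrightarrow> slice p q N f \<in> R"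
  shows "f \<in> tensor_prod (tensor_prod (tensor_power s a) R) (tensor_power s b)"
proof (rule tensor_prod_rightI[OF f], rule tensor_prod_leftI)
  fix q assume q: "q \<in> words s b"
  show "slice [] q (a + N) f \<in> tensor_power s (a + N)"
    unfolding tensor_power_def mem_Collect_eq
  proof (intro allI impI)
    fix u assume "slice [] q (a + N) f u \<noteq> 0"
    then have "length u = a + N" "f (u @ q) \<noteq> 0" by (auto simp: slice_def split: if_splits)
    moreover from this have "u @ q \<in> words s (a + N + b)" using f unfolding tensor_power_def by blast
    ultimately show "u \<in> words s (a + N)" by (simp add: words_def)
  qed
  fix p assume p: "p \<in> words s a"
  then have "slice p [] N (slice [] q (a + N) f) = slice p q N f" by (auto simp: slice_def words_def)
  then show "slice p [] N (slice [] q (a + N) f) \<in> R" using sl[OF p q] by simp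
qed

abbreviation V :: "nat \<Rightarrow> (nat list \<Rightarrow> 'k) set" where "V n \<equiv> dual_component s N R n"

text \<open>The working description of the dual components: every window of \<open>N\<close>
  consecutive letters contracts into \<open>R\<close>. For \<open>n < N\<close> no window fits, so
  the case distinction in \<open>dual_component\<close> disappears.\<close>

lemma dual_component_iff:
  "f \<in> V n \<longleftrightarrow> f \<in> tensor_power s n \<and>
     (\<forall>p q. set p \<subseteq> {..s} \<longrightarrow> set q \<subseteq> {..s} \<longrightarrow> length p + N + length q = n \<longrightarrow> slice p q N f \<in> R)"
proof (cases "n < N")
  case True
  then show ?thesis by (auto simp: dual_component_def)
next
  case False
  have "f \<in> V n \<longleftrightarrow> (\<forall>r\<le>n - N. f \<in> tensor_prod (tensor_prod (tensor_power s (n - N - r)) R) (tensor_power s r))"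
    using False by (auto simp: dual_component_def)
  also have "\<dots> \<longleftrightarrow> f \<in> tensor_power s n \<and>
     (\<forall>p q. set p \<subseteq> {..s} \<longrightarrow> set q \<subseteq> {..s} \<longrightarrow> length p + N + length q = n \<longrightarrow> slice p q N f \<in> R)" (is "?l \<longleftrightarrow> ?r")
  proof
    assume l: ?l
    have "n - N - r + N + r = n" if "r \<le> n - N" for r using False that by simp
    then have *: "f \<in> tensor_power s n \<and> (\<forall>p q. length p = n - N - r \<and> length q = r \<longrightarrow> slice p q N f \<in> R)"
      if "r \<le> n - N" for r using l tensor_prod_both that by metis
    have "slice p q N f \<in> R" if "length p + N + length q = n" for p q
    proof -
      have "length q \<le> n - N" "length p = n - N - length q" using that by auto
      then show ?thesis using * by blast
    qed
    then show ?r using *[of 0] by blast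
  next
    assume r: ?r
    show ?l
    proof (intro allI impI tensor_prod_bothI)
      fix k assume "k \<le> n - N"
      then have eq: "n - N - k + N + k = n" using False by simp
      show "f \<in> tensor_power s (n - N - k + N + k)" using r unfolding eq by blast
      show "slice p q N f \<in> R" if "p \<in> words s (n - N - k)" "q \<in> words s k" for p q
        using r that eq by (auto simp: words_def)
    qed
  qed
  finally show ?thesis .
qed

lemma dual_component_supp: "f \<in> V n \<Longrightarrow> f u \<noteq> 0 \<Longrightarrow> u \<in> words s n"
  unfolding dual_component_iff tensor_power_def by blast

lemma linear_subspace_dual: "linear_subspace (V n) (tensor_power s n)"
proof -
  have "slice p q N (\<lambda>u. f u + g u) = (\<lambda>u. slice p q N f u + slice p q N g u)"
    "slice p q N (\<lambda>u. c * f u) = (\<lambda>u. c * slice p q N f u)" "slice p q N (\<lambda>_. 0) = (\<lambda>_. 0)"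
    for p q f g and c :: 'k by (auto simp: slice_def)
  note slices = this
  note E = linear_subspaceD[OF linear_subspace_tensor_power]
  have "(\<lambda>_. 0) \<in> V n" using E(1) relations_lin(1) by (simp add: dual_component_iff slices)
  moreover have "(\<lambda>u. f u + g u) \<in> V n" if "f \<in> V n" "g \<in> V n" for f g
    using that unfolding dual_component_iff slices by (intro conjI allI impI E(2) relations_lin(2)) simp_all
  moreover have "(\<lambda>u. c * f u) \<in> V n" if "f \<in> V n" for f c
    using that unfolding dual_component_iff slices by (intro conjI allI impI E(3) relations_lin(3)) simp_all
  moreover have "V n \<subseteq> tensor_power s n" unfolding dual_component_iff subset_iff by blast
  ultimately show ?thesis by (intro linear_subspaceI)
qed

lemmas dual_lin = linear_subspaceD[OF linear_subspace_dual]

lemma slice_slice: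
  "length p + n + length q = n' \<Longrightarrow> slice p q n (slice p' q' n' f) = slice (p' @ p) (q @ q') n f"
  by (auto simp: slice_def)

text \<open>Each window of a contraction of \<open>f\<close> is already a window of
  \<open>f\<close>.\<close>

lemma dual_component_slice:
  assumes "f \<in> V n" "set p \<subseteq> {..s}" "set q \<subseteq> {..s}" "length p + k + length q = n"
  shows "slice p q k f \<in> V k"
  unfolding dual_component_iff
proof (intro conjI allI impI)
  show "slice p q k f \<in> tensor_power s k"
    using dual_component_supp[OF assms(1)] by (force simp: tensor_power_def slice_def words_def)
  fix p' q' assume "set p' \<subseteq> {..s}" "set q' \<subseteq> {..s}" "length p' + N + length q' = k"
  then show "slice p' q' N (slice p q k f) \<in> R"
    using assms unfolding dual_component_iff by (simp add: slice_slice)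
qed

lemma dual_pivots: obtains B b where "pivot_basis (V n) B b"
proof -
  have "\<exists>B b. pivot_basis (V n) B b"
    by (rule pivot_basis_exists[OF finite_words linear_subspace_dual]) (rule dual_component_supp)
  then show ?thesis using that by blast
qed

text \<open>The module \<open>A \<otimes> U\<close>. Its elements are functions from words to
  classes, so it lies directly in the type \<open>univ_module\<close> from which the modules of a
  resolution are taken.\<close>

definition free_module :: "(nat list \<Rightarrow> 'k) set \<Rightarrow> (nat list \<Rightarrow> 'k) set univ_module" where
  "free_module U = \<lparr>carrier = algebra_tensor s R U, monoid.mult = undefined, one = undefined,
     zero = (\<lambda>_. \<zero>\<^bsub>A\<^esub>), add = (\<lambda>F G u. F u \<oplus>\<^bsub>A\<^esub> G u), smult = (\<lambda>a F u. a \<star> F u)\<rparr>"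

text \<open>The tensor \<open>1 \<otimes> v\<close> in coordinates.\<close>

definition \<iota> :: "(nat list \<Rightarrow> 'k) \<Rightarrow> nat list \<Rightarrow> (nat list \<Rightarrow> 'k) set" where
  "\<iota> v = (\<lambda>u. sc (v u))"

lemma free_module_simps:
  "carrier (free_module U) = algebra_tensor s R U" "\<zero>\<^bsub>free_module U\<^esub> = (\<lambda>_. \<zero>\<^bsub>A\<^esub>)"
  "F \<oplus>\<^bsub>free_module U\<^esub> G = (\<lambda>u. F u \<oplus>\<^bsub>A\<^esub> G u)" "a \<odot>\<^bsub>free_module U\<^esub> F = (\<lambda>u. a \<star> F u)"
  by (simp_all add: free_module_def)

lemma algebra_tensor_closed: "F \<in> algebra_tensor s R U \<Longrightarrow> F u \<in> carrier A"
  by (induction rule: algebra_tensor.induct) simp_all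

text \<open>The linear equations that recover a vector of \<open>U\<close> from its values at the
  pivots carry over to coefficients in \<open>A\<close>; hence the values \<open>F p\<close> at the
  pivots are free coordinates on \<open>A \<otimes> U\<close>.\<close>

lemma algebra_tensor_iff:
  assumes "pivot_basis U B b"
  shows "F \<in> algebra_tensor s R U \<longleftrightarrow>
    (\<forall>u. F u \<in> carrier A) \<and> (\<forall>u. F u = (\<Oplus>\<^bsub>A\<^esub>p\<in>B. F p \<star> sc (b p u)))"
proof
  assume F: "F \<in> algebra_tensor s R U"
  note B = pivot_basisD[OF assms]
  from F have "\<forall>u. F u = (\<Oplus>\<^bsub>A\<^esub>p\<in>B. F p \<star> sc (b p u))"
  proof (induction rule: algebra_tensor.induct)
    case zero
    then show ?case by simp
  next
    case (add F a v)
    have "(\<Oplus>\<^bsub>A\<^esub>p\<in>B. (F p \<oplus>\<^bsub>A\<^esub> a \<star> sc (v p)) \<star> sc (b p u)) = F u \<oplus>\<^bsub>A\<^esub> a \<star> sc (v u)" for u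
    proof -
      have F: "F p \<in> carrier A" for p using algebra_tensor_closed add.hyps by blast
      have "(\<Oplus>\<^bsub>A\<^esub>p\<in>B. (F p \<oplus>\<^bsub>A\<^esub> a \<star> sc (v p)) \<star> sc (b p u))
          = (\<Oplus>\<^bsub>A\<^esub>p\<in>B. F p \<star> sc (b p u) \<oplus>\<^bsub>A\<^esub> a \<star> sc (v p * b p u))"
        by (rule A.finsum_cong') (use F add.hyps in \<open>auto simp: A.l_distr A.m_assoc sc_mult\<close>)
      also have "\<dots> = (\<Oplus>\<^bsub>A\<^esub>p\<in>B. F p \<star> sc (b p u)) \<oplus>\<^bsub>A\<^esub> (\<Oplus>\<^bsub>A\<^esub>p\<in>B. a \<star> sc (v p * b p u))"
        by (rule A.finsum_addf) (use F add.hyps in auto)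
      also have "(\<Oplus>\<^bsub>A\<^esub>p\<in>B. a \<star> sc (v p * b p u)) = a \<star> (\<Oplus>\<^bsub>A\<^esub>p\<in>B. sc (v p * b p u))"
        by (rule A.finsum_rdistr[symmetric]) (use add.hyps B(1) in auto)
      also have "(\<Oplus>\<^bsub>A\<^esub>p\<in>B. sc (v p * b p u)) = sc (v u)"
        using B(4)[OF add.hyps(3), of u] by (simp add: sc_sum[OF B(1), symmetric])
      finally show ?thesis using add.IH by metis
    qed
    then show ?case by simp
  qed
  then show "(\<forall>u. F u \<in> carrier A) \<and> (\<forall>u. F u = (\<Oplus>\<^bsub>A\<^esub>p\<in>B. F p \<star> sc (b p u)))"
    using algebra_tensor_closed[OF F] by blast
next
  assume F: "(\<forall>u. F u \<in> carrier A) \<and> (\<forall>u. F u = (\<Oplus>\<^bsub>A\<^esub>p\<in>B. F p \<star> sc (b p u)))"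
  then have Fc: "F u \<in> carrier A" for u by blast
  note B = pivot_basisD[OF assms]
  have "(\<lambda>u. \<Oplus>\<^bsub>A\<^esub>p\<in>S. F p \<star> sc (b p u)) \<in> algebra_tensor s R U" if "finite S" "S \<subseteq> B" for S
    using that
  proof (induction S rule: finite_induct)
    case empty
    then show ?case by (simp add: algebra_tensor.zero)
  next
    case (insert p S)
    then have "(\<lambda>p. F p \<star> sc (b p u)) \<in> S \<rightarrow> carrier A" for u using Fc by auto
    then have "(\<lambda>u. \<Oplus>\<^bsub>A\<^esub>p\<in>insert p S. F p \<star> sc (b p u))
        = (\<lambda>u. (\<Oplus>\<^bsub>A\<^esub>p\<in>S. F p \<star> sc (b p u)) \<oplus>\<^bsub>A\<^esub> F p \<star> sc (b p u))"
      using insert Fc by (simp add: A.a_comm)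
    then show ?case using insert Fc B(2) by (simp add: algebra_tensor.add)
  qed
  from this[OF B(1)] have "(\<lambda>u. \<Oplus>\<^bsub>A\<^esub>p\<in>B. F p \<star> sc (b p u)) \<in> algebra_tensor s R U" by blast
  moreover have "F = (\<lambda>u. \<Oplus>\<^bsub>A\<^esub>p\<in>B. F p \<star> sc (b p u))" using F by blast
  ultimately show "F \<in> algebra_tensor s R U" by metis
qed

lemma \<iota>_in: "v \<in> U \<Longrightarrow> \<iota> v \<in> algebra_tensor s R U"
  using algebra_tensor.add[OF algebra_tensor.zero A.one_closed, of v U] by (simp add: \<iota>_def)

context
  fixes U :: "(nat list \<Rightarrow> 'k) set" and B b assumes pivots: "pivot_basis U B b"
begin

lemmas mem_iff = algebra_tensor_iff[OF pivots]

lemma free_module_closed: "F \<in> carrier (free_module U) \<Longrightarrow> F u \<in> carrier A"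
  using algebra_tensor_closed by (simp add: free_module_simps)

lemma basis_closed: "p \<in> B \<Longrightarrow> \<iota> (b p) \<in> carrier (free_module U)"
  using pivot_basisD(2)[OF pivots] by (simp add: \<iota>_in free_module_simps)

lemma finite_pivots: "finite B" using pivots by (simp add: pivot_basis_def)

lemma left_module_free: "left_module A (free_module U)"
proof -
  have closed: "F u \<in> carrier A" if "F \<in> algebra_tensor s R U" for F u by (rule algebra_tensor_closed[OF that])
  have add: "(\<lambda>u. F u \<oplus>\<^bsub>A\<^esub> G u) \<in> algebra_tensor s R U"
    if "F \<in> algebra_tensor s R U" "G \<in> algebra_tensor s R U" for F G
  proof -
    have F: "F u \<in> carrier A" "F u = (\<Oplus>\<^bsub>A\<^esub>p\<in>B. F p \<star> sc (b p u))" for u using that(1) mem_iff by blast+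
    have G: "G u \<in> carrier A" "G u = (\<Oplus>\<^bsub>A\<^esub>p\<in>B. G p \<star> sc (b p u))" for u using that(2) mem_iff by blast+
    have "(\<Oplus>\<^bsub>A\<^esub>p\<in>B. (F p \<oplus>\<^bsub>A\<^esub> G p) \<star> sc (b p u)) = F u \<oplus>\<^bsub>A\<^esub> G u" for u
      by (subst F(2), subst G(2), subst A.finsum_addf[symmetric])
        (use F(1) G(1) in \<open>auto simp: A.l_distr intro!: A.finsum_cong'\<close>)
    then show ?thesis using F(1) G(1) mem_iff by simp
  qed
  have smult: "(\<lambda>u. a \<star> F u) \<in> algebra_tensor s R U"
    if "F \<in> algebra_tensor s R U" "a \<in> carrier A" for a F
  proof -
    have F: "F u \<in> carrier A" "F u = (\<Oplus>\<^bsub>A\<^esub>p\<in>B. F p \<star> sc (b p u))" for u using that(1) mem_iff by blast+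
    have "(\<Oplus>\<^bsub>A\<^esub>p\<in>B. (a \<star> F p) \<star> sc (b p u)) = a \<star> F u" for u
      by (subst F(2), subst A.finsum_rdistr)
        (use F(1) that(2) finite_pivots in \<open>auto simp: A.m_assoc intro!: A.finsum_cong'\<close>)
    then show ?thesis using F(1) that(2) mem_iff by simp
  qed
  have "abelian_group (free_module U)"
  proof (rule abelian_groupI, goal_cases)
    case (6 F)
    then have "(\<lambda>u. \<ominus>\<^bsub>A\<^esub> \<one>\<^bsub>A\<^esub> \<star> F u) \<in> algebra_tensor s R U" by (simp add: smult free_module_simps)
    moreover have "\<ominus>\<^bsub>A\<^esub> \<one>\<^bsub>A\<^esub> \<star> F u \<oplus>\<^bsub>A\<^esub> F u = \<zero>\<^bsub>A\<^esub>" for u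
      using 6 by (simp add: A.l_minus A.l_neg closed free_module_simps)
    ultimately show ?case
      by (intro bexI[of _ "\<lambda>u. \<ominus>\<^bsub>A\<^esub> \<one>\<^bsub>A\<^esub> \<star> F u"]) (simp_all add: free_module_simps)
  qed (auto simp: free_module_simps add algebra_tensor.zero closed A.a_ac intro!: ext)
  then show ?thesis
    unfolding left_module_def left_module_axioms_def
    by (auto simp: A.ring_axioms free_module_simps smult closed A.l_distr A.r_distr A.m_assoc)
qed

interpretation F: left_module A "free_module U" by (rule left_module_free)

lemma free_module_finsum:
  assumes "finite S" "\<And>i. i \<in> S \<Longrightarrow> G i \<in> carrier (free_module U)"
  shows "(\<Oplus>\<^bsub>free_module U\<^esub>i\<in>S. G i) u = (\<Oplus>\<^bsub>A\<^esub>i\<in>S. G i u)"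
  using assms
proof (induction S rule: finite_induct)
  case empty
  then show ?case by (simp add: free_module_simps)
next
  case (insert i S)
  then have "G \<in> S \<rightarrow> carrier (free_module U)" "(\<lambda>i. G i u) \<in> S \<rightarrow> carrier A" "G i u \<in> carrier A"
    by (auto intro: free_module_closed)
  moreover have "(\<Oplus>\<^bsub>free_module U\<^esub>j\<in>insert i S. G j) = G i \<oplus>\<^bsub>free_module U\<^esub> (\<Oplus>\<^bsub>free_module U\<^esub>j\<in>S. G j)"
    using insert calculation by simp
  ultimately show ?case using insert by (simp add: free_module_simps)
qed

lemma free_module_expand:
  assumes "F \<in> carrier (free_module U)"
  shows "F = (\<Oplus>\<^bsub>free_module U\<^esub>p\<in>B. F p \<odot>\<^bsub>free_module U\<^esub> \<iota> (b p))"
proof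
  fix u
  have "(\<Oplus>\<^bsub>free_module U\<^esub>p\<in>B. F p \<odot>\<^bsub>free_module U\<^esub> \<iota> (b p)) u = (\<Oplus>\<^bsub>A\<^esub>p\<in>B. (F p \<odot>\<^bsub>free_module U\<^esub> \<iota> (b p)) u)"
    by (rule free_module_finsum[OF finite_pivots])
      (use assms in \<open>auto intro!: F.smult_closed free_module_closed basis_closed\<close>)
  also have "\<dots> = (\<Oplus>\<^bsub>A\<^esub>p\<in>B. F p \<star> sc (b p u))" by (simp add: free_module_simps \<iota>_def)
  also have "\<dots> = F u"
  proof (rule sym)
    show "F u = (\<Oplus>\<^bsub>A\<^esub>p\<in>B. F p \<star> sc (b p u))"
      using assms mem_iff[of F] unfolding free_module_simps by blast
  qed
  finally show "F u = (\<Oplus>\<^bsub>free_module U\<^esub>p\<in>B. F p \<odot>\<^bsub>free_module U\<^esub> \<iota> (b p)) u" by simp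
qed

lemma hom_expand:
  assumes "left_module A M" "f \<in> mod_hom A (free_module U) M" "F \<in> carrier (free_module U)"
  shows "f F = (\<Oplus>\<^bsub>M\<^esub>p\<in>B. F p \<odot>\<^bsub>M\<^esub> f (\<iota> (b p)))"
proof -
  interpret M: left_module A M by fact
  have i: "\<iota> (b p) \<in> carrier (free_module U)" "F p \<in> carrier A" if "p \<in> B" for p
    using that assms(3) by (auto intro: free_module_closed basis_closed)
  have "f F = f (\<Oplus>\<^bsub>free_module U\<^esub>p\<in>B. F p \<odot>\<^bsub>free_module U\<^esub> \<iota> (b p))"
    using free_module_expand[OF assms(3)] by simp
  also have "\<dots> = (\<Oplus>\<^bsub>M\<^esub>p\<in>B. f (F p \<odot>\<^bsub>free_module U\<^esub> \<iota> (b p)))"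
    by (rule mod_hom_finsum[OF assms(2) left_module_free assms(1) finite_pivots]) (use i in \<open>auto intro: F.smult_closed\<close>)
  also have "\<dots> = (\<Oplus>\<^bsub>M\<^esub>p\<in>B. F p \<odot>\<^bsub>M\<^esub> f (\<iota> (b p)))"
    by (rule M.M.finsum_cong')
      (use i mod_hom_closed[OF assms(2)] in \<open>auto simp: mod_hom_smult[OF assms(2)] intro!: M.smult_closed\<close>)
  finally show ?thesis .
qed

text \<open>Freeness: \<open>\<iota> (b q)\<close> has the value 1 at the pivot \<open>q\<close> and
  0 at the other pivots, so the basis may be sent to arbitrary elements \<open>m p\<close>.\<close>

lemma hom_extend:
  assumes "left_module A M" "\<And>p. p \<in> B \<Longrightarrow> m p \<in> carrier M"
  shows "(\<lambda>F. \<Oplus>\<^bsub>M\<^esub>p\<in>B. F p \<odot>\<^bsub>M\<^esub> m p) \<in> mod_hom A (free_module U) M"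
    and "q \<in> B \<Longrightarrow> (\<Oplus>\<^bsub>M\<^esub>p\<in>B. \<iota> (b q) p \<odot>\<^bsub>M\<^esub> m p) = m q"
proof -
  interpret M: left_module A M by fact
  have closed: "F p \<odot>\<^bsub>M\<^esub> m p \<in> carrier M" if "F \<in> carrier (free_module U)" "p \<in> B" for F p
    using that assms(2) by (auto intro!: M.smult_closed free_module_closed)
  show "(\<lambda>F. \<Oplus>\<^bsub>M\<^esub>p\<in>B. F p \<odot>\<^bsub>M\<^esub> m p) \<in> mod_hom A (free_module U) M"
  proof (rule mod_homI)
    fix F G assume FG: "F \<in> carrier (free_module U)" "G \<in> carrier (free_module U)"
    have "(\<Oplus>\<^bsub>M\<^esub>p\<in>B. (F \<oplus>\<^bsub>free_module U\<^esub> G) p \<odot>\<^bsub>M\<^esub> m p) = (\<Oplus>\<^bsub>M\<^esub>p\<in>B. F p \<odot>\<^bsub>M\<^esub> m p \<oplus>\<^bsub>M\<^esub> G p \<odot>\<^bsub>M\<^esub> m p)"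
      by (rule M.M.finsum_cong')
        (use FG closed assms(2) in \<open>auto simp: free_module_simps(3) free_module_closed M.smult_l_distr\<close>)
    also have "\<dots> = (\<Oplus>\<^bsub>M\<^esub>p\<in>B. F p \<odot>\<^bsub>M\<^esub> m p) \<oplus>\<^bsub>M\<^esub> (\<Oplus>\<^bsub>M\<^esub>p\<in>B. G p \<odot>\<^bsub>M\<^esub> m p)"
      by (rule M.M.finsum_addf) (use FG closed in auto)
    finally show "(\<Oplus>\<^bsub>M\<^esub>p\<in>B. (F \<oplus>\<^bsub>free_module U\<^esub> G) p \<odot>\<^bsub>M\<^esub> m p)
        = (\<Oplus>\<^bsub>M\<^esub>p\<in>B. F p \<odot>\<^bsub>M\<^esub> m p) \<oplus>\<^bsub>M\<^esub> (\<Oplus>\<^bsub>M\<^esub>p\<in>B. G p \<odot>\<^bsub>M\<^esub> m p)" .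
  next
    fix a F assume aF: "a \<in> carrier A" "F \<in> carrier (free_module U)"
    have "(\<Oplus>\<^bsub>M\<^esub>p\<in>B. (a \<odot>\<^bsub>free_module U\<^esub> F) p \<odot>\<^bsub>M\<^esub> m p) = (\<Oplus>\<^bsub>M\<^esub>p\<in>B. a \<odot>\<^bsub>M\<^esub> (F p \<odot>\<^bsub>M\<^esub> m p))"
      by (rule M.M.finsum_cong')
        (use aF closed assms(2) in \<open>auto simp: free_module_simps(4) free_module_closed M.smult_assoc intro!: M.smult_closed\<close>)
    also have "\<dots> = a \<odot>\<^bsub>M\<^esub> (\<Oplus>\<^bsub>M\<^esub>p\<in>B. F p \<odot>\<^bsub>M\<^esub> m p)"
      by (rule M.smult_finsum[symmetric]) (use aF closed finite_pivots in auto)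
    finally show "(\<Oplus>\<^bsub>M\<^esub>p\<in>B. (a \<odot>\<^bsub>free_module U\<^esub> F) p \<odot>\<^bsub>M\<^esub> m p) = a \<odot>\<^bsub>M\<^esub> (\<Oplus>\<^bsub>M\<^esub>p\<in>B. F p \<odot>\<^bsub>M\<^esub> m p)" .
  qed (use closed in auto)
  show "(\<Oplus>\<^bsub>M\<^esub>p\<in>B. \<iota> (b q) p \<odot>\<^bsub>M\<^esub> m p) = m q" if q: "q \<in> B"
  proof -
    have "(\<Oplus>\<^bsub>M\<^esub>p\<in>B. \<iota> (b q) p \<odot>\<^bsub>M\<^esub> m p) = (\<Oplus>\<^bsub>M\<^esub>p\<in>B. if q = p then m p else \<zero>\<^bsub>M\<^esub>)"
      by (rule M.M.finsum_cong')
        (use q assms(2) pivot_basisD(3)[OF pivots] in \<open>auto simp: \<iota>_def sc_one sc_zero M.smult_one M.smult_l_null\<close>)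
    also have "\<dots> = m q" using M.M.finsum_singleton[OF q finite_pivots, of m] assms(2) by auto
    finally show ?thesis .
  qed
qed

lemma projective_free: "projective A (free_module U)"
  unfolding projective_def
proof (intro conjI allI impI left_module_free)
  fix M M' :: "(nat list \<Rightarrow> 'k) set univ_module" and g h
  assume "left_module A M \<and> left_module A M' \<and> g \<in> mod_hom A M M' \<and> g ` carrier M = carrier M' \<and>
    h \<in> mod_hom A (free_module U) M'"
  then have M: "left_module A M" "left_module A M'" and g: "g \<in> mod_hom A M M'" "g ` carrier M = carrier M'"
    and h: "h \<in> mod_hom A (free_module U) M'" by auto
  interpret M: left_module A M by fact
  interpret M': left_module A M' by fact
  have i: "\<iota> (b p) \<in> carrier (free_module U)" if "p \<in> B" for p
    using that by (rule basis_closed)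
  have "\<exists>m. \<forall>p\<in>B. m p \<in> carrier M \<and> g (m p) = h (\<iota> (b p))"
  proof (intro bchoice ballI)
    fix p assume "p \<in> B"
    then have "h (\<iota> (b p)) \<in> g ` carrier M" using mod_hom_closed[OF h i] g(2) by simp
    then show "\<exists>x. x \<in> carrier M \<and> g x = h (\<iota> (b p))" by auto
  qed
  then obtain m where m: "\<And>p. p \<in> B \<Longrightarrow> m p \<in> carrier M" "\<And>p. p \<in> B \<Longrightarrow> g (m p) = h (\<iota> (b p))" by blast
  define l where "l F = (\<Oplus>\<^bsub>M\<^esub>p\<in>B. F p \<odot>\<^bsub>M\<^esub> m p)" for F
  have l: "l \<in> mod_hom A (free_module U) M" "\<And>p. p \<in> B \<Longrightarrow> l (\<iota> (b p)) = m p"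
    using hom_extend[OF M(1) m(1)] unfolding l_def by auto
  have "g (l F) = h F" if F: "F \<in> carrier (free_module U)" for F
  proof -
    have "g (l F) = (\<Oplus>\<^bsub>M'\<^esub>p\<in>B. F p \<odot>\<^bsub>M'\<^esub> g (l (\<iota> (b p))))"
      by (rule hom_expand[OF M(2) mod_hom_comp[OF l(1) g(1)] F])
    also have "\<dots> = (\<Oplus>\<^bsub>M'\<^esub>p\<in>B. F p \<odot>\<^bsub>M'\<^esub> h (\<iota> (b p)))"
      by (rule M'.M.finsum_cong')
        (use F l m mod_hom_closed[OF h i] in \<open>auto simp: free_module_closed intro!: M'.smult_closed\<close>)
    also have "\<dots> = h F" by (rule hom_expand[OF M(2) h F, symmetric])
    finally show ?thesis .
  qed
  then show "\<exists>l\<in>mod_hom A (free_module U) M. \<forall>x\<in>carrier (free_module U). g (l x) = h x" using l by blast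
qed

end

end

section \<open>The Koszul complex as a resolution\<close>

lemma words_Suc: "words s (Suc k) = (\<Union>l\<in>{..s}. (\<lambda>t. t @ [l]) ` words s k)"
proof (intro equalityI subsetI)
  fix u assume "u \<in> words s (Suc k)"
  then show "u \<in> (\<Union>l\<in>{..s}. (\<lambda>t. t @ [l]) ` words s k)"
    by (cases u rule: rev_cases) (auto simp: words_def)
qed (auto simp: words_def)

lemma words_0 [simp]: "words s 0 = {[]}"
  by (auto simp: words_def)

lemma words_1: "words s (Suc 0) = (\<lambda>l. [l]) ` {..s}"
  by (auto simp: words_Suc)

lemma monomial_other: "u \<noteq> v \<Longrightarrow> monomial v c u = 0"
  by (simp add: monomial_def)

context homogeneous_relations
begin

text \<open>The outermost application takes the letter next to \<open>u\<close> and multiplies by it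
  on the right, so the consumed prefix \<open>t\<close> is multiplied up in reading order. This is
  why \<open>words_Suc\<close> splits off the last letter.\<close>

lemma koszul_d_power:
  assumes "\<And>u. F u \<in> carrier A"
  shows "(koszul_d s R ^^ k) F u = (\<Oplus>\<^bsub>A\<^esub>t\<in>words s k. F (t @ u) \<star> X t)"
proof (induction k arbitrary: u)
  case 0
  have "(\<Oplus>\<^bsub>A\<^esub>t\<in>{[]}. F (t @ u) \<star> X t) = F u" using assms by (simp add: cls_one)
  then show ?case by simp
next
  case (Suc k)
  have closed: "F w \<star> X t \<in> carrier A" if "set t \<subseteq> {..s}" for w t using assms that by simp
  have "(\<Oplus>\<^bsub>A\<^esub>t\<in>words s (Suc k). F (t @ u) \<star> X t)
      = (\<Oplus>\<^bsub>A\<^esub>l\<in>{..s}. \<Oplus>\<^bsub>A\<^esub>t\<in>(\<lambda>t. t @ [l]) ` words s k. F (t @ u) \<star> X t)"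
    unfolding words_Suc
    by (rule A.add.finprod_UN_disjoint) (auto simp: pairwise_def disjnt_def intro!: closed, auto simp: words_def)
  also have "\<dots> = (\<Oplus>\<^bsub>A\<^esub>l\<in>{..s}. (koszul_d s R ^^ k) F (l # u) \<star> X [l])"
  proof (rule A.finsum_cong')
    fix l assume l: "l \<in> {..s}"
    have "(\<Oplus>\<^bsub>A\<^esub>t\<in>(\<lambda>t. t @ [l]) ` words s k. F (t @ u) \<star> X t)
        = (\<Oplus>\<^bsub>A\<^esub>t\<in>words s k. F ((t @ [l]) @ u) \<star> X (t @ [l]))"
      using l by (intro A.finsum_reindex) (auto simp: inj_on_def intro!: closed, auto simp: words_def)
    also have "\<dots> = (\<Oplus>\<^bsub>A\<^esub>t\<in>words s k. (F (t @ l # u) \<star> X t) \<star> X [l])"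
      using l assms by (intro A.finsum_cong') (auto simp: words_def X_append A.m_assoc)
    also have "\<dots> = (\<Oplus>\<^bsub>A\<^esub>t\<in>words s k. F (t @ l # u) \<star> X t) \<star> X [l]"
      using l by (intro A.finsum_ldistr[symmetric]) (auto intro!: closed, auto simp: words_def)
    finally show "(\<Oplus>\<^bsub>A\<^esub>t\<in>(\<lambda>t. t @ [l]) ` words s k. F (t @ u) \<star> X t)
        = (koszul_d s R ^^ k) F (l # u) \<star> X [l]" by (simp add: Suc)
  next
    show "(\<lambda>l. (koszul_d s R ^^ k) F (l # u) \<star> X [l]) \<in> {..s} \<rightarrow> carrier A"
      unfolding Suc by (auto simp: words_def intro!: A.finsum_closed A.m_closed closed)
  qed simp
  also have "\<dots> = (koszul_d s R ^^ Suc k) F u" by (simp add: koszul_d_def)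
  finally show ?case by simp
qed

abbreviation KV :: "nat \<Rightarrow> (nat list \<Rightarrow> 'k) set univ_module" where "KV n \<equiv> free_module (V n)"

lemma left_module_KV: "left_module A (KV n)"
  using dual_pivots left_module_free by metis

lemma KV_closed: "F \<in> carrier (KV n) \<Longrightarrow> F u \<in> carrier A"
  by (simp add: free_module_simps algebra_tensor_closed)

lemma \<iota>_KV: "v \<in> V n \<Longrightarrow> \<iota> v \<in> carrier (KV n)"
  by (simp add: free_module_simps \<iota>_in)

lemma KV_finsum:
  assumes "finite S" "\<And>i. i \<in> S \<Longrightarrow> G i \<in> carrier (KV n)"
  shows "(\<Oplus>\<^bsub>KV n\<^esub>i\<in>S. G i) u = (\<Oplus>\<^bsub>A\<^esub>i\<in>S. G i u)"
proof -
  obtain B b where "pivot_basis (V n) B b" by (rule dual_pivots)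
  then show ?thesis using assms by (rule free_module_finsum)
qed

lemma KV_smult: "\<lbrakk>a \<in> carrier A; F \<in> carrier (KV n)\<rbrakk> \<Longrightarrow> a \<odot>\<^bsub>KV n\<^esub> F \<in> carrier (KV n)"
  using left_module.smult_closed[OF left_module_KV] .

lemma slice_left: "\<lbrakk>v \<in> V (n + k); t \<in> words s k\<rbrakk> \<Longrightarrow> slice t [] n v u = v (t @ u)"
  using dual_component_supp[of v "n + k" "t @ u"] by (auto simp: slice_def words_def)

lemma slice_left_dual: "\<lbrakk>v \<in> V (n + k); t \<in> words s k\<rbrakk> \<Longrightarrow> slice t [] n v \<in> V n"
  by (rule dual_component_slice[where n = "n + k"]) (auto simp: words_def)

text \<open>Scalars commute with \<open>X t\<close>, so the powers of the differential on
  \<open>1 \<otimes> v\<close> become left combinations of the contractions of \<open>v\<close>. In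
  this form a homomorphism can be applied term by term.\<close>

lemma koszul_d_power_\<iota>:
  assumes "v \<in> V (n + k)"
  shows "(koszul_d s R ^^ k) (\<iota> v) = (\<Oplus>\<^bsub>KV n\<^esub>t\<in>words s k. X t \<odot>\<^bsub>KV n\<^esub> \<iota> (slice t [] n v))"
proof
  fix u
  have "(\<Oplus>\<^bsub>KV n\<^esub>t\<in>words s k. X t \<odot>\<^bsub>KV n\<^esub> \<iota> (slice t [] n v)) u
      = (\<Oplus>\<^bsub>A\<^esub>t\<in>words s k. (X t \<odot>\<^bsub>KV n\<^esub> \<iota> (slice t [] n v)) u)"
    using assms by (intro KV_finsum) (auto intro!: KV_smult \<iota>_KV slice_left_dual)
  also have "\<dots> = (\<Oplus>\<^bsub>A\<^esub>t\<in>words s k. \<iota> v (t @ u) \<star> X t)"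
    using assms by (intro A.finsum_cong') (auto simp: free_module_simps \<iota>_def slice_left sc_comm)
  also have "\<dots> = (koszul_d s R ^^ k) (\<iota> v) u"
    by (rule koszul_d_power[symmetric]) (simp add: \<iota>_def)
  finally show "(koszul_d s R ^^ k) (\<iota> v) u = (\<Oplus>\<^bsub>KV n\<^esub>t\<in>words s k. X t \<odot>\<^bsub>KV n\<^esub> \<iota> (slice t [] n v)) u" by simp
qed

text \<open>Beyond linearity, the point is that the values lie in \<open>A \<otimes> V n\<close>:
  left contractions of a tensor in \<open>V (n + k)\<close> stay in the dual components.\<close>

lemma koszul_d_power_hom: "koszul_d s R ^^ k \<in> mod_hom A (KV (n + k)) (KV n)"
proof -
  interpret K: left_module A "KV n" by (rule left_module_KV)
  have closed: "F w \<star> X t \<in> carrier A" if "t \<in> words s k" "\<And>u. F u \<in> carrier A" for F w t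
    using that by simp
  have additive: "(koszul_d s R ^^ k) (\<lambda>u. F u \<oplus>\<^bsub>A\<^esub> G u) = (\<lambda>u. (koszul_d s R ^^ k) F u \<oplus>\<^bsub>A\<^esub> (koszul_d s R ^^ k) G u)"
    if F: "\<And>u. F u \<in> carrier A" and G: "\<And>u. G u \<in> carrier A" for F G
  proof
    fix u
    have "(koszul_d s R ^^ k) (\<lambda>u. F u \<oplus>\<^bsub>A\<^esub> G u) u
        = (\<Oplus>\<^bsub>A\<^esub>t\<in>words s k. F (t @ u) \<star> X t \<oplus>\<^bsub>A\<^esub> G (t @ u) \<star> X t)"
      using F G by (simp add: koszul_d_power A.l_distr cong: A.finsum_cong)
    also have "\<dots> = (koszul_d s R ^^ k) F u \<oplus>\<^bsub>A\<^esub> (koszul_d s R ^^ k) G u"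
      unfolding koszul_d_power[OF F] koszul_d_power[OF G]
      by (rule A.finsum_addf) (use F G in \<open>auto intro!: closed\<close>)
    finally show "(koszul_d s R ^^ k) (\<lambda>u. F u \<oplus>\<^bsub>A\<^esub> G u) u
        = (koszul_d s R ^^ k) F u \<oplus>\<^bsub>A\<^esub> (koszul_d s R ^^ k) G u" .
  qed
  have smult: "(koszul_d s R ^^ k) (\<lambda>u. a \<star> F u) = (\<lambda>u. a \<star> (koszul_d s R ^^ k) F u)"
    if F: "\<And>u. F u \<in> carrier A" and a: "a \<in> carrier A" for a F
  proof
    fix u
    have "(koszul_d s R ^^ k) (\<lambda>u. a \<star> F u) u = (\<Oplus>\<^bsub>A\<^esub>t\<in>words s k. a \<star> (F (t @ u) \<star> X t))"
      using F a by (simp add: koszul_d_power A.m_assoc cong: A.finsum_cong)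
    also have "\<dots> = a \<star> (koszul_d s R ^^ k) F u"
      unfolding koszul_d_power[OF F]
      by (rule A.finsum_rdistr[symmetric]) (use F a in \<open>auto intro!: closed\<close>)
    finally show "(koszul_d s R ^^ k) (\<lambda>u. a \<star> F u) u = a \<star> (koszul_d s R ^^ k) F u" .
  qed
  have "(koszul_d s R ^^ k) F \<in> carrier (KV n)" if "F \<in> algebra_tensor s R (V (n + k))" for F
    using that
  proof (induction rule: algebra_tensor.induct)
    case zero
    have "(koszul_d s R ^^ k) (\<lambda>_. \<zero>\<^bsub>A\<^esub>) = \<zero>\<^bsub>KV n\<^esub>"
    proof
      fix u
      have "(\<Oplus>\<^bsub>A\<^esub>t\<in>words s k. \<zero>\<^bsub>A\<^esub> \<star> X t) = (\<Oplus>\<^bsub>A\<^esub>t\<in>words s k. \<zero>\<^bsub>A\<^esub>)"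
        by (intro A.finsum_cong') auto
      then show "(koszul_d s R ^^ k) (\<lambda>_. \<zero>\<^bsub>A\<^esub>) u = \<zero>\<^bsub>KV n\<^esub> u"
        by (simp add: koszul_d_power free_module_simps)
    qed
    then show ?case by simp
  next
    case (add F a v)
    have v: "\<iota> v u \<in> carrier A" for u by (simp add: \<iota>_def)
    have "(koszul_d s R ^^ k) (\<lambda>u. F u \<oplus>\<^bsub>A\<^esub> a \<star> \<iota> v u)
        = (koszul_d s R ^^ k) F \<oplus>\<^bsub>KV n\<^esub> a \<odot>\<^bsub>KV n\<^esub> (koszul_d s R ^^ k) (\<iota> v)"
      using add.hyps algebra_tensor_closed[OF add.hyps(1)] v by (simp add: additive smult free_module_simps)
    moreover have "(koszul_d s R ^^ k) (\<iota> v) \<in> carrier (KV n)"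
      unfolding koszul_d_power_\<iota>[OF add.hyps(3)]
      by (intro K.M.finsum_closed) (auto intro!: KV_smult \<iota>_KV slice_left_dual add.hyps)
    ultimately show ?case using add by (simp add: \<iota>_def K.smult_closed)
  qed
  then show ?thesis
    by (intro mod_homI) (auto simp: free_module_simps algebra_tensor_closed additive smult)
qed

lemma hom_koszul_d_power_\<iota>:
  assumes "left_module A M" "f \<in> mod_hom A (KV n) M" "v \<in> V (n + k)"
  shows "f ((koszul_d s R ^^ k) (\<iota> v)) = (\<Oplus>\<^bsub>M\<^esub>t\<in>words s k. X t \<odot>\<^bsub>M\<^esub> f (\<iota> (slice t [] n v)))"
proof -
  interpret M: left_module A M by fact
  have "f ((koszul_d s R ^^ k) (\<iota> v)) = (\<Oplus>\<^bsub>M\<^esub>t\<in>words s k. f (X t \<odot>\<^bsub>KV n\<^esub> \<iota> (slice t [] n v)))"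
    unfolding koszul_d_power_\<iota>[OF assms(3)]
    by (rule mod_hom_finsum[OF assms(2) left_module_KV assms(1)])
      (use assms(3) in \<open>auto intro!: KV_smult \<iota>_KV slice_left_dual\<close>)
  also have "\<dots> = (\<Oplus>\<^bsub>M\<^esub>t\<in>words s k. X t \<odot>\<^bsub>M\<^esub> f (\<iota> (slice t [] n v)))"
    using assms(3) mod_hom_closed[OF assms(2) \<iota>_KV] slice_left_dual
    by (intro M.M.finsum_cong') (auto simp: mod_hom_smult[OF assms(2)] \<iota>_KV intro!: M.smult_closed)
  finally show ?thesis .
qed

text \<open>\<open>deg i\<close> is the tensor degree of the term \<open>i\<close> of the Koszul
  complex, and \<open>gap i\<close> the number of letters consumed by the differential that leaves
  the term \<open>Suc i\<close>; hence the parity opposite to \<open>koszul_diff\<close>.\<close>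

definition deg :: "nat \<Rightarrow> nat" where "deg i = N * (i div 2) + i mod 2"
definition gap :: "nat \<Rightarrow> nat" where "gap i = (if even i then 1 else N - 1)"

lemma deg_Suc: "deg (Suc i) = deg i + gap i"
proof (cases "even i")
  case True
  then show ?thesis by (auto simp: deg_def gap_def)
next
  case False
  then obtain j where "i = 2 * j + 1" by (rule oddE)
  then show ?thesis using two_le_N by (simp add: deg_def gap_def)
qed

lemma deg_0 [simp]: "deg 0 = 0" and deg_1: "deg (Suc 0) = 1" and gap_0: "gap 0 = 1"
  by (simp_all add: deg_def gap_def)

lemma gap_pos: "0 < gap i" using two_le_N by (simp add: gap_def)

abbreviation K :: "nat \<Rightarrow> (nat list \<Rightarrow> 'k) set univ_module" where "K i \<equiv> KV (deg i)"
text \<open>Shifted to the indexing of \<open>projective_resolution\<close>, where the map with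
  index \<open>i\<close> ends in the term \<open>i\<close>.\<close>

abbreviation \<Delta> where "\<Delta> i \<equiv> koszul_diff s N R (Suc i)"

lemma koszul_diff_power: "\<Delta> i = koszul_d s R ^^ gap i"
  by (simp add: koszul_diff_def gap_def)

lemma carrier_K: "carrier (K i) = koszul_module s N R i"
  by (simp add: free_module_simps koszul_module_def deg_def)

lemma koszul_diff_hom: "\<Delta> i \<in> mod_hom A (K (Suc i)) (K i)"
  unfolding koszul_diff_power deg_Suc by (rule koszul_d_power_hom)

lemma hom_koszul_diff_\<iota>:
  assumes "left_module A M" "f \<in> mod_hom A (K i) M" "v \<in> V (deg (Suc i))"
  shows "f (\<Delta> i (\<iota> v)) = (\<Oplus>\<^bsub>M\<^esub>t\<in>words s (gap i). X t \<odot>\<^bsub>M\<^esub> f (\<iota> (slice t [] (deg i) v)))"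
  using hom_koszul_d_power_\<iota>[OF assms(1,2)] assms(3) by (simp add: koszul_diff_power deg_Suc)

lemma coef_X_Nil: "t \<in> words s k \<Longrightarrow> 0 < k \<Longrightarrow> coef (X t) [] = 0"
  by (subst coef_X) (auto simp: words_def)

text \<open>Minimality of the Koszul complex: each summand of the differential has a factor
  \<open>X t\<close> with \<open>t\<close> nonempty, as \<open>gap i\<close> is positive.\<close>

lemma eps_koszul_diff:
  assumes "F \<in> carrier (K (Suc i))"
  shows "coef (\<Delta> i F u) [] = 0"
proof -
  have F: "F u \<in> carrier A" for u using KV_closed[OF assms] .
  have "coef (\<Delta> i F u) [] = (\<Sum>t\<in>words s (gap i). coef (F (t @ u) \<star> X t) [])"
    unfolding koszul_diff_power koszul_d_power[OF F] by (rule coef_finsum) (use F in auto)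
  also have "\<dots> = 0" using F coef_X_Nil[OF _ gap_pos] by (intro sum.neutral) (auto simp: eps_mult)
  finally show ?thesis .
qed

text \<open>The factors \<open>X t\<close> pass through \<open>f\<close> by linearity, so minimality
  survives composition with any homomorphism, homogeneous or not.\<close>

lemma eps_hom_koszul_diff:
  assumes "f \<in> mod_hom A (K i) (KV n)" "v \<in> V (deg (Suc i))"
  shows "coef (f (\<Delta> i (\<iota> v)) u) [] = 0"
proof -
  let ?f = "\<lambda>t. f (\<iota> (slice t [] (deg i) v))"
  have f: "?f t \<in> carrier (KV n)" if "t \<in> words s (gap i)" for t
    using mod_hom_closed[OF assms(1)] \<iota>_KV slice_left_dual assms(2) that unfolding deg_Suc by blast
  have "f (\<Delta> i (\<iota> v)) u = (\<Oplus>\<^bsub>A\<^esub>t\<in>words s (gap i). (X t \<odot>\<^bsub>KV n\<^esub> ?f t) u)"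
    unfolding hom_koszul_diff_\<iota>[OF left_module_KV assms] using f by (intro KV_finsum KV_smult) auto
  then have "coef (f (\<Delta> i (\<iota> v)) u) [] = (\<Sum>t\<in>words s (gap i). coef ((X t \<odot>\<^bsub>KV n\<^esub> ?f t) u) [])"
    using KV_closed[OF KV_smult[OF _ f]] by (simp add: coef_finsum)
  also have "\<dots> = 0" using KV_closed[OF f] coef_X_Nil[OF _ gap_pos]
    by (intro sum.neutral) (auto simp: eps_mult free_module_simps)
  finally show ?thesis .
qed

lemma trivial_module_simps:
  "carrier (trivial_module A) = UNIV" "\<zero>\<^bsub>trivial_module A\<^esub> = 0"
  "x \<oplus>\<^bsub>trivial_module A\<^esub> y = x + y" "a \<odot>\<^bsub>trivial_module A\<^esub> x = coef a [] * x"
  by (simp_all add: trivial_module_def coef_def)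

lemma coef_one: "coef \<one>\<^bsub>A\<^esub> [] = 1"
  using coef_sc[of 1] by (simp add: sc_one)

definition augmentation :: "(nat list \<Rightarrow> (nat list \<Rightarrow> 'k) set) \<Rightarrow> 'k" where
  "augmentation F = coef (F []) []"

lemma augmentation_hom: "augmentation \<in> mod_hom A (K 0) (trivial_module A)"
  by (intro mod_homI)
    (simp_all add: augmentation_def trivial_module_simps free_module_simps(3,4) KV_closed coef_add eps_mult)

lemma left_module_trivial: "left_module A (trivial_module A)"
proof -
  have "abelian_group (trivial_module A)"
    by (rule abelian_groupI) (auto simp: trivial_module_simps intro: exI[of _ "- x" for x])
  then show ?thesis
    unfolding left_module_def left_module_axioms_def
    by (simp add: A.ring_axioms trivial_module_simps coef_add eps_mult coef_one algebra_simps)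
qed

lemma monomial_dual: "l \<le> s \<Longrightarrow> monomial [l] 1 \<in> V 1"
  using two_le_N by (auto simp: dual_component_iff tensor_power_def monomial_def words_def)

lemma V_0: "monomial [] c \<in> V 0"
  using two_le_N by (auto simp: dual_component_iff tensor_power_def monomial_def words_def)

text \<open>\<open>koszul\<close> asserts exactness in positive degrees only. At the term 0 it is
  automatic, because the elements with zero constant term form the left ideal generated by the
  letters.\<close>

lemma augmentation_kernel: "\<Delta> 0 ` carrier (K 1) = {F \<in> carrier (K 0). augmentation F = 0}"
proof (intro equalityI subsetI)
  fix F assume "F \<in> \<Delta> 0 ` carrier (K 1)"
  then obtain G where G: "G \<in> carrier (K (Suc 0))" "F = \<Delta> 0 G" by auto
  then show "F \<in> {F \<in> carrier (K 0). augmentation F = 0}"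
    using eps_koszul_diff[OF G(1)] mod_hom_closed[OF koszul_diff_hom G(1)] by (simp add: augmentation_def)
next
  fix F assume "F \<in> {F \<in> carrier (K 0). augmentation F = 0}"
  then have F: "F \<in> algebra_tensor s R (V 0)" and F0: "coef (F []) [] = 0"
    by (auto simp: free_module_simps augmentation_def)
  \<comment> \<open>Elements of \<open>A \<otimes> V 0\<close> are supported at the empty word, so
    \<open>F\<close> amounts to the single element \<open>F []\<close>.\<close>
  have supp: "F u = \<zero>\<^bsub>A\<^esub>" if "u \<noteq> []" for u
    using F
  proof (induction rule: algebra_tensor.induct)
    case (add F a v)
    have "v u = 0" using dual_component_supp[OF add.hyps(3), of u] that by (auto simp: words_def)
    then show ?case using add.hyps add.IH by (simp add: sc_zero)
  qed simp
  obtain b where b: "\<And>l. b l \<in> carrier A" "F [] = (\<Oplus>\<^bsub>A\<^esub>l\<in>{..s}. b l \<star> X [l])"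
    using augmentation_ideal[OF algebra_tensor_closed[OF F] F0] by blast
  let ?m = "\<lambda>l. \<iota> (monomial [l] 1)"
  let ?G = "\<Oplus>\<^bsub>KV 1\<^esub>l\<in>{..s}. b l \<odot>\<^bsub>KV 1\<^esub> ?m l"
  have m: "?m l \<in> carrier (KV 1)" if "l \<in> {..s}" for l using that by (intro \<iota>_KV monomial_dual) simp
  interpret K1: left_module A "KV 1" by (rule left_module_KV)
  have G: "?G \<in> carrier (KV 1)" by (intro K1.M.finsum_closed) (auto simp del: One_nat_def intro!: KV_smult m b)
  have hom: "koszul_d s R ^^ 1 \<in> mod_hom A (KV 1) (KV 0)" using koszul_d_power_hom[of 1 0] by simp
  have dm: "(koszul_d s R ^^ 1) (?m l) u = (if u = [] then X [l] else \<zero>\<^bsub>A\<^esub>)" if "l \<in> {..s}" for l u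
  proof -
    have "(koszul_d s R ^^ 1) (?m l) u = (\<Oplus>\<^bsub>A\<^esub>t\<in>words s 1. ?m l (t @ u) \<star> X t)"
      by (rule koszul_d_power) (simp add: \<iota>_def)
    also have "\<dots> = (\<Oplus>\<^bsub>A\<^esub>t\<in>words s 1. if [l] = t then (if u = [] then X t else \<zero>\<^bsub>A\<^esub>) else \<zero>\<^bsub>A\<^esub>)"
    proof (rule A.finsum_cong')
      fix t assume "t \<in> words s 1"
      then obtain k where t: "t = [k]" "k \<le> s" by (auto simp: words_1)
      have "?m l w = (if w = [l] then \<one>\<^bsub>A\<^esub> else \<zero>\<^bsub>A\<^esub>)" for w
        using monomial_self[of "[l]" "1 :: 'k"] by (simp add: \<iota>_def sc_one sc_zero monomial_other)
      then show "?m l (t @ u) \<star> X t = (if [l] = t then (if u = [] then X t else \<zero>\<^bsub>A\<^esub>) else \<zero>\<^bsub>A\<^esub>)"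
        using t by auto
    qed (auto simp: words_1)
    also have "\<dots> = (if u = [] then X [l] else \<zero>\<^bsub>A\<^esub>)"
      by (rule A.finsum_singleton) (use that in \<open>auto simp: words_1\<close>)
    finally show ?thesis .
  qed
  have "\<Delta> 0 ?G = F"
  proof
    fix u
    have "(koszul_d s R ^^ 1) ?G = (\<Oplus>\<^bsub>KV 0\<^esub>l\<in>{..s}. (koszul_d s R ^^ 1) (b l \<odot>\<^bsub>KV 1\<^esub> ?m l))"
      by (rule mod_hom_finsum[OF hom left_module_KV left_module_KV]) (auto simp del: One_nat_def intro!: KV_smult m b)
    then have "(koszul_d s R ^^ 1) ?G u = (\<Oplus>\<^bsub>A\<^esub>l\<in>{..s}. (koszul_d s R ^^ 1) (b l \<odot>\<^bsub>KV 1\<^esub> ?m l) u)"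
      by (simp only:) (rule KV_finsum, auto simp del: One_nat_def intro!: mod_hom_closed[OF hom] KV_smult m b)
    also have "\<dots> = (\<Oplus>\<^bsub>A\<^esub>l\<in>{..s}. b l \<star> (if u = [] then X [l] else \<zero>\<^bsub>A\<^esub>))"
    proof (rule A.finsum_cong')
      fix l assume l: "l \<in> {..s}"
      show "(koszul_d s R ^^ 1) (b l \<odot>\<^bsub>KV 1\<^esub> ?m l) u = b l \<star> (if u = [] then X [l] else \<zero>\<^bsub>A\<^esub>)"
        unfolding mod_hom_smult[OF hom b(1) m[OF l]] by (simp only: free_module_simps(4) dm[OF l])
    qed (auto simp: b)
    also have "\<dots> = F u" using b supp by (cases "u = []") auto
    finally show "\<Delta> 0 ?G u = F u" by (simp add: koszul_diff_power gap_0)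
  qed
  then show "F \<in> \<Delta> 0 ` carrier (K 1)" using G by (auto simp: deg_1)
qed

text \<open>Formulated for any \<open>M\<close> isomorphic to the trivial module, because it serves
  twice: for the trivial module itself in the Gorenstein condition and for its copy among the
  modules seen by the global dimension.\<close>

lemma koszul_resolution:
  assumes "koszul s N R" and M: "left_module A M"
    and f: "f \<in> mod_hom A (trivial_module A) M" "bij_betw f UNIV (carrier M)"
  shows "projective_resolution A M K \<Delta> (\<lambda>F. f (augmentation F))"
  unfolding projective_resolution_def
proof (intro conjI allI)
  fix i
  show "projective A (K i)" using dual_pivots projective_free by metis
  show "\<Delta> i \<in> mod_hom A (K (Suc i)) (K i)" by (rule koszul_diff_hom)
  show "\<Delta> (Suc i) ` carrier (K (Suc (Suc i))) = {x \<in> carrier (K (Suc i)). \<Delta> i x = \<zero>\<^bsub>K i\<^esub>}"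
    using assms(1) unfolding koszul_def carrier_K free_module_simps(2) by simp
next
  show "(\<lambda>F. f (augmentation F)) \<in> mod_hom A (K 0) M"
    by (rule mod_hom_comp[OF augmentation_hom f(1)])
  have "augmentation (\<iota> (monomial [] c)) = c" for c by (simp add: augmentation_def \<iota>_def)
  then have "augmentation ` carrier (K 0) = UNIV" using \<iota>_KV[OF V_0] by (metis UNIV_eq_I deg_0 imageI)
  then show "(\<lambda>F. f (augmentation F)) ` carrier (K 0) = carrier M"
    using f(2) by (auto simp: bij_betw_def image_image[symmetric])
  have "f 0 = \<zero>\<^bsub>M\<^esub>" using mod_hom_zero[OF f(1) left_module_trivial M] by (simp add: trivial_module_simps)
  then have "f c = \<zero>\<^bsub>M\<^esub> \<longleftrightarrow> c = 0" for c
    using f(2) unfolding bij_betw_def by (metis UNIV_I inj_onD)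
  then show "\<Delta> 0 ` carrier (K 1) = {x \<in> carrier (K 0). f (augmentation x) = \<zero>\<^bsub>M\<^esub>}"
    unfolding augmentation_kernel by auto
qed

text \<open>The global dimension only sees modules on \<open>nat list \<Rightarrow> 'a\<close>, so the trivial module is copied there.\<close>

lemma trivial_module_copy:
  obtains M :: "(nat list \<Rightarrow> 'k) set univ_module" and f
  where "left_module A M" "f \<in> mod_hom A (trivial_module A) M" "bij_betw f UNIV (carrier M)"
proof -
  define f where "f = (\<lambda>c (u :: nat list). sc c)"
  define k where "k x = coef (x []) []" for x :: "nat list \<Rightarrow> (nat list \<Rightarrow> 'k) set"
  define M :: "(nat list \<Rightarrow> 'k) set univ_module" where "M = \<lparr>carrier = range f, monoid.mult = undefined, one = undefined,
     zero = f 0, add = (\<lambda>x y. f (k x + k y)), smult = (\<lambda>a x. f (coef a [] * k x))\<rparr>"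
  have k: "k (f c) = c" for c by (simp add: f_def k_def)
  have M_simps: "carrier M = range f" "\<zero>\<^bsub>M\<^esub> = f 0" "x \<oplus>\<^bsub>M\<^esub> y = f (k x + k y)" "a \<odot>\<^bsub>M\<^esub> x = f (coef a [] * k x)" for a x y
    by (simp_all add: M_def)
  have "abelian_group M"
  proof (rule abelian_groupI, goal_cases)
    case (6 x)
    then show ?case by (intro bexI[of _ "f (- k x)"]) (auto simp: M_simps k)
  qed (auto simp: M_simps k algebra_simps)
  then have "left_module A M"
    unfolding left_module_def left_module_axioms_def
    by (auto simp: A.ring_axioms M_simps k coef_add eps_mult coef_one algebra_simps)
  moreover have "f \<in> mod_hom A (trivial_module A) M"
    by (intro mod_homI) (auto simp: M_simps trivial_module_simps k)
  moreover have "bij_betw f UNIV (carrier M)" using k by (auto simp: bij_betw_def M_simps intro: injI) (metis k injI)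
  ultimately show ?thesis by (rule that)
qed

text \<open>A resolution of length at most \<open>D\<close> makes the identity of the term
  \<open>Suc D\<close> a sum of two maps, one followed by a differential and one preceded by a
  differential. By minimality both have zero constant terms on \<open>1 \<otimes> v\<close>, while
  the constant terms of \<open>1 \<otimes> v\<close> are the entries of \<open>v\<close>.\<close>

lemma dual_component_vanishes:
  assumes koszul: "koszul s N R" and gldim: "global_dimension A = enat D" and v: "v \<in> V (deg (Suc D))"
  shows "v u = 0"
proof -
  obtain M :: "(nat list \<Rightarrow> 'k) set univ_module" and f where M: "left_module A M"
    and f: "f \<in> mod_hom A (trivial_module A) M" "bij_betw f UNIV (carrier M)" by (rule trivial_module_copy)
  define L where "L = {n. \<exists>P d e. projective_resolution A M P d e \<and> (\<forall>i>n. carrier (P i) = {\<zero>\<^bsub>P i\<^esub>})}"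
  have "projective_dimension A M \<le> enat D"
    unfolding gldim[symmetric] global_dimension_def using M by (intro SUP_upper) simp
  then have le: "Inf (enat ` L) \<le> enat D" by (simp add: projective_dimension_def L_def)
  then have "L \<noteq> {}" by (auto simp: Inf_enat_def)
  \<comment> \<open>The infimum defining the projective dimension is attained, so the bound on it
    yields an actual resolution of some length \<open>n \<le> D\<close>.\<close>
  moreover have "Inf S \<in> S" if "S \<noteq> {}" for S :: "enat set"
    using that unfolding Inf_enat_def by (auto intro: LeastI)
  ultimately have "Inf (enat ` L) \<in> enat ` L" by simp
  then obtain n where "n \<in> L" "Inf (enat ` L) = enat n" by (rule imageE)
  then have "n \<in> L" "n \<le> D" using le by simp_all
  then obtain P d e where P: "projective_resolution A M P d e" "carrier (P (Suc D)) = {\<zero>\<^bsub>P (Suc D)\<^esub>}"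
    unfolding L_def by (auto simp: le_imp_less_Suc)
  obtain h h' where h: "h \<in> mod_hom A (K D) (K (Suc D))" "h' \<in> mod_hom A (K (Suc D)) (K (Suc (Suc D)))"
    "\<And>x. x \<in> carrier (K (Suc D)) \<Longrightarrow> x = \<Delta> (Suc D) (h' x) \<oplus>\<^bsub>K (Suc D)\<^esub> h (\<Delta> D x)"
    using contraction_beyond_short_resolution[OF koszul_resolution[OF koszul M f] P(1) M P(2)] by blast
  have iv: "\<iota> v \<in> carrier (K (Suc D))" by (rule \<iota>_KV[OF v])
  have h1: "h' (\<iota> v) \<in> carrier (K (Suc (Suc D)))" using mod_hom_closed[OF h(2) iv] .
  have c1: "\<Delta> (Suc D) (h' (\<iota> v)) u \<in> carrier A" by (rule KV_closed[OF mod_hom_closed[OF koszul_diff_hom h1]])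
  have c2: "h (\<Delta> D (\<iota> v)) u \<in> carrier A"
    by (rule KV_closed[OF mod_hom_closed[OF h(1) mod_hom_closed[OF koszul_diff_hom iv]]])
  have "sc (v u) = \<Delta> (Suc D) (h' (\<iota> v)) u \<oplus>\<^bsub>A\<^esub> h (\<Delta> D (\<iota> v)) u"
    using fun_cong[OF h(3)[OF iv], of u] by (simp add: \<iota>_def free_module_simps(3))
  then have "v u = coef (\<Delta> (Suc D) (h' (\<iota> v)) u \<oplus>\<^bsub>A\<^esub> h (\<Delta> D (\<iota> v)) u) []" by (metis coef_sc)
  also have "\<dots> = 0"
    using coef_add[OF c1 c2] eps_koszul_diff[OF h1] eps_hom_koszul_diff[OF h(1) v] by simp
  finally show ?thesis .
qed

end

section \<open>Consequences of the Gorenstein property\<close>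

lemma regular_module_simps:
  "carrier (regular_module A) = carrier A" "\<zero>\<^bsub>regular_module A\<^esub> = \<zero>\<^bsub>A\<^esub>"
  "x \<oplus>\<^bsub>regular_module A\<^esub> y = x \<oplus>\<^bsub>A\<^esub> y" "a \<odot>\<^bsub>regular_module A\<^esub> x = a \<otimes>\<^bsub>A\<^esub> x"
  by (simp_all add: regular_module_def)

lemma finsum_regular_module: "finsum (regular_module A) f S = finsum A f S"
  by (simp add: finsum_def finprod_def regular_module_def)

lemma dual_module_simps:
  "f \<in> carrier (dual_module A P) \<longleftrightarrow> f \<in> mod_hom A P (regular_module A) \<and> f \<in> extensional (carrier P)"
  "\<zero>\<^bsub>dual_module A P\<^esub> = (\<lambda>x\<in>carrier P. \<zero>\<^bsub>A\<^esub>)"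
  "f \<oplus>\<^bsub>dual_module A P\<^esub> g = (\<lambda>x\<in>carrier P. f x \<oplus>\<^bsub>A\<^esub> g x)"
  "a \<odot>\<^bsub>dual_module A P\<^esub> f = (\<lambda>x\<in>carrier P. f x \<otimes>\<^bsub>A\<^esub> a)"
  by (simp_all add: dual_module_def)

lemma left_module_regular: "ring A \<Longrightarrow> left_module A (regular_module A)"
proof -
  assume "ring A"
  then interpret A: ring A .
  have "abelian_group (regular_module A)"
  proof (rule abelian_groupI, goal_cases)
    case (6 x)
    then show ?case by (auto simp: regular_module_simps A.l_neg intro!: bexI[of _ "\<ominus>\<^bsub>A\<^esub> x"])
  qed (simp_all add: regular_module_simps A.a_ac)
  then show ?thesis
    unfolding left_module_def left_module_axioms_def
    by (simp add: A.ring_axioms regular_module_simps A.l_distr A.r_distr A.m_assoc)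
qed

context left_module
begin

abbreviation "L \<equiv> dual_module A M"

lemma restrict_dual:
  assumes "f \<in> mod_hom A M (regular_module A)"
  shows "(\<lambda>x\<in>carrier M. f x) \<in> carrier L"
proof -
  have "(\<lambda>x\<in>carrier M. f x) \<in> mod_hom A M (regular_module A)"
    by (rule mod_homI)
      (use mod_hom_closed[OF assms] in \<open>simp_all add: smult_closed mod_hom_add[OF assms] mod_hom_smult[OF assms]\<close>)
  then show ?thesis by (simp add: dual_module_simps)
qed

lemma dual_closed: "f \<in> carrier L \<Longrightarrow> x \<in> carrier M \<Longrightarrow> f x \<in> carrier A"
  using mod_hom_closed by (fastforce simp: dual_module_simps regular_module_simps)

lemma dual_ext: "\<lbrakk>f \<in> carrier L; g \<in> carrier L; \<And>x. x \<in> carrier M \<Longrightarrow> f x = g x\<rbrakk> \<Longrightarrow> f = g"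
  by (auto simp: dual_module_simps intro: extensionalityI)

lemma dual_zero_closed: "\<zero>\<^bsub>L\<^esub> \<in> carrier L"
  unfolding dual_module_simps(2) by (rule restrict_dual) (auto intro!: mod_homI simp: regular_module_simps)

lemma dual_add_closed:
  assumes "f \<in> carrier L" "g \<in> carrier L" shows "f \<oplus>\<^bsub>L\<^esub> g \<in> carrier L"
  unfolding dual_module_simps(3)
proof (rule restrict_dual, rule mod_homI)
  have f: "f \<in> mod_hom A M (regular_module A)" and g: "g \<in> mod_hom A M (regular_module A)"
    using assms by (simp_all add: dual_module_simps)
  show "f (x \<oplus>\<^bsub>M\<^esub> y) \<oplus> g (x \<oplus>\<^bsub>M\<^esub> y) = f x \<oplus> g x \<oplus>\<^bsub>regular_module A\<^esub> (f y \<oplus> g y)"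
    if "x \<in> carrier M" "y \<in> carrier M" for x y
    using that mod_hom_add[OF f that] mod_hom_add[OF g that] assms dual_closed
    by (simp add: regular_module_simps A.a_ac)
  show "f (a \<odot>\<^bsub>M\<^esub> x) \<oplus> g (a \<odot>\<^bsub>M\<^esub> x) = a \<odot>\<^bsub>regular_module A\<^esub> (f x \<oplus> g x)"
    if "a \<in> carrier A" "x \<in> carrier M" for a x
    using that mod_hom_smult[OF f that] mod_hom_smult[OF g that] assms dual_closed
    by (simp add: regular_module_simps A.r_distr)
qed (use assms dual_closed in \<open>simp add: regular_module_simps\<close>)

lemma dual_smult_closed:
  assumes "f \<in> carrier L" "b \<in> carrier A" shows "b \<odot>\<^bsub>L\<^esub> f \<in> carrier L"
  unfolding dual_module_simps(4)
proof (rule restrict_dual, rule mod_homI)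
  have f: "f \<in> mod_hom A M (regular_module A)" using assms by (simp add: dual_module_simps)
  show "f (x \<oplus>\<^bsub>M\<^esub> y) \<otimes> b = f x \<otimes> b \<oplus>\<^bsub>regular_module A\<^esub> f y \<otimes> b"
    if "x \<in> carrier M" "y \<in> carrier M" for x y
    using that mod_hom_add[OF f that] assms dual_closed by (simp add: regular_module_simps A.l_distr)
  show "f (a \<odot>\<^bsub>M\<^esub> x) \<otimes> b = a \<odot>\<^bsub>regular_module A\<^esub> (f x \<otimes> b)"
    if "a \<in> carrier A" "x \<in> carrier M" for a x
    using that mod_hom_smult[OF f that] assms dual_closed by (simp add: regular_module_simps A.m_assoc)
qed (use assms dual_closed in \<open>simp add: regular_module_simps\<close>)

lemma dual_minus:
  assumes "f \<in> carrier L"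
  shows "(\<ominus> \<one>) \<odot>\<^bsub>L\<^esub> f \<oplus>\<^bsub>L\<^esub> f = \<zero>\<^bsub>L\<^esub>"
  using dual_closed[OF assms] by (auto simp: dual_module_simps A.r_minus A.l_neg intro!: restrict_ext)

lemma abelian_group_dual: "abelian_group L"
proof (rule abelian_groupI)
  fix f assume f: "f \<in> carrier L"
  show "\<exists>g\<in>carrier L. g \<oplus>\<^bsub>L\<^esub> f = \<zero>\<^bsub>L\<^esub>"
    using dual_minus[OF f] dual_smult_closed[OF f] A.one_closed by blast
  show "\<zero>\<^bsub>L\<^esub> \<oplus>\<^bsub>L\<^esub> f = f"
    by (rule dual_ext[OF dual_add_closed[OF dual_zero_closed f] f]) (use dual_closed[OF f] in \<open>simp add: dual_module_simps\<close>)
next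
  fix f g h assume fgh: "f \<in> carrier L" "g \<in> carrier L" "h \<in> carrier L"
  note c = dual_closed[OF fgh(1)] dual_closed[OF fgh(2)] dual_closed[OF fgh(3)]
  show "f \<oplus>\<^bsub>L\<^esub> g \<oplus>\<^bsub>L\<^esub> h = f \<oplus>\<^bsub>L\<^esub> (g \<oplus>\<^bsub>L\<^esub> h)"
    unfolding dual_module_simps(3) by (rule restrict_ext) (simp add: c A.a_assoc)
next
  fix f g assume fg: "f \<in> carrier L" "g \<in> carrier L"
  show "f \<oplus>\<^bsub>L\<^esub> g = g \<oplus>\<^bsub>L\<^esub> f"
    unfolding dual_module_simps(3)
    by (rule restrict_ext) (simp add: dual_closed[OF fg(1)] dual_closed[OF fg(2)] A.a_comm)
qed (auto intro: dual_zero_closed dual_add_closed)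

lemma dual_smult_add:
  assumes "f \<in> carrier L" "g \<in> carrier L" "b \<in> carrier A"
  shows "b \<odot>\<^bsub>L\<^esub> (f \<oplus>\<^bsub>L\<^esub> g) = b \<odot>\<^bsub>L\<^esub> f \<oplus>\<^bsub>L\<^esub> b \<odot>\<^bsub>L\<^esub> g"
  unfolding dual_module_simps(3,4)
  by (rule restrict_ext) (simp add: dual_closed[OF assms(1)] dual_closed[OF assms(2)] assms(3) A.l_distr)

definition dual_submodule :: "('m \<Rightarrow> 'a) set \<Rightarrow> bool" where
  "dual_submodule B \<longleftrightarrow> B \<subseteq> carrier L \<and> \<zero>\<^bsub>L\<^esub> \<in> B \<and> (\<forall>f\<in>B. \<forall>g\<in>B. f \<oplus>\<^bsub>L\<^esub> g \<in> B) \<and>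
     (\<forall>a\<in>carrier A. \<forall>f\<in>B. a \<odot>\<^bsub>L\<^esub> f \<in> B)"

context
  fixes B assumes submodule: "dual_submodule B"
begin

lemma dual_submoduleD: "B \<subseteq> carrier L" "\<zero>\<^bsub>L\<^esub> \<in> B" "\<lbrakk>f \<in> B; g \<in> B\<rbrakk> \<Longrightarrow> f \<oplus>\<^bsub>L\<^esub> g \<in> B"
    "\<lbrakk>a \<in> carrier A; f \<in> B\<rbrakk> \<Longrightarrow> a \<odot>\<^bsub>L\<^esub> f \<in> B"
  using submodule by (auto simp: dual_submodule_def)

interpretation L: abelian_group L by (rule abelian_group_dual)

lemma submodule_abelian_subgroup: "abelian_subgroup B L"
proof (rule abelian_subgroupI3[OF _ abelian_group_dual], rule additive_subgroup.intro, rule L.add.subgroupI)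
  fix f assume f: "f \<in> B"
  then have "\<ominus>\<^bsub>L\<^esub> f = (\<ominus> \<one>) \<odot>\<^bsub>L\<^esub> f"
    using dual_submoduleD(1,4) dual_minus dual_smult_closed by (intro L.minus_equality) auto
  then show "\<ominus>\<^bsub>L\<^esub> f \<in> B" using dual_submoduleD(4) f by simp
qed (use dual_submoduleD in auto)

interpretation B: abelian_subgroup B L by (rule submodule_abelian_subgroup)

lemma coset_self: "z \<in> carrier L \<Longrightarrow> z \<in> B +>\<^bsub>L\<^esub> z"
  by (rule B.a_rcos_self)

lemma coset_eq_iff: "z \<in> carrier L \<Longrightarrow> B +>\<^bsub>L\<^esub> z = B \<longleftrightarrow> z \<in> B"
  using coset_self B.a_rcos_const by metis

lemma coset_add:
  "\<lbrakk>z \<in> carrier L; z' \<in> carrier L\<rbrakk> \<Longrightarrow> (B +>\<^bsub>L\<^esub> z) <+>\<^bsub>L\<^esub> (B +>\<^bsub>L\<^esub> z') = B +>\<^bsub>L\<^esub> (z \<oplus>\<^bsub>L\<^esub> z')"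
  by (rule B.a_rcos_sum)

text \<open>The image of a coset under scaling need not fill a coset; adding \<open>B\<close>, as in
  \<open>subquotient\<close>, does.\<close>

lemma coset_smult:
  assumes z: "z \<in> carrier L" and a: "a \<in> carrier A"
  shows "B <+>\<^bsub>L\<^esub> ((\<lambda>x. a \<odot>\<^bsub>L\<^esub> x) ` (B +>\<^bsub>L\<^esub> z)) = B +>\<^bsub>L\<^esub> (a \<odot>\<^bsub>L\<^esub> z)"
proof (intro equalityI subsetI)
  fix x assume "x \<in> B <+>\<^bsub>L\<^esub> ((\<lambda>x. a \<odot>\<^bsub>L\<^esub> x) ` (B +>\<^bsub>L\<^esub> z))"
  then obtain b b' where b: "b \<in> B" "b' \<in> B" "x = b \<oplus>\<^bsub>L\<^esub> a \<odot>\<^bsub>L\<^esub> (b' \<oplus>\<^bsub>L\<^esub> z)"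
    by (auto simp: set_add_def set_mult_def a_r_coset_def r_coset_def)
  then have "x = (b \<oplus>\<^bsub>L\<^esub> a \<odot>\<^bsub>L\<^esub> b') \<oplus>\<^bsub>L\<^esub> a \<odot>\<^bsub>L\<^esub> z"
    using dual_submoduleD(1) z a by (simp add: dual_smult_add L.a_assoc dual_smult_closed subsetD)
  moreover have "b \<oplus>\<^bsub>L\<^esub> a \<odot>\<^bsub>L\<^esub> b' \<in> B" using b dual_submoduleD(3,4) a by simp
  ultimately show "x \<in> B +>\<^bsub>L\<^esub> (a \<odot>\<^bsub>L\<^esub> z)" by (auto simp: a_r_coset_def r_coset_def)
next
  fix x assume "x \<in> B +>\<^bsub>L\<^esub> (a \<odot>\<^bsub>L\<^esub> z)"
  then obtain b where b: "b \<in> B" "x = b \<oplus>\<^bsub>L\<^esub> a \<odot>\<^bsub>L\<^esub> z" by (auto simp: a_r_coset_def r_coset_def)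
  then show "x \<in> B <+>\<^bsub>L\<^esub> ((\<lambda>x. a \<odot>\<^bsub>L\<^esub> x) ` (B +>\<^bsub>L\<^esub> z))"
    using coset_self[OF z] by (auto simp: set_add_def set_mult_def)
qed

end

end

section \<open>Ext of the Koszul complex with values in the algebra\<close>

context homogeneous_relations
begin

abbreviation "reg \<equiv> regular_module A"
abbreviation "H i \<equiv> mod_hom A (K i) reg"
abbreviation "KD i \<equiv> dual_module A (K i)"

lemma left_module_reg: "left_module A reg" by (rule left_module_regular[OF A.ring_axioms])

lemma H_closed: "g \<in> H i \<Longrightarrow> F \<in> carrier (K i) \<Longrightarrow> g F \<in> carrier A"
  using mod_hom_closed by (fastforce simp: regular_module_simps)

lemma H_koszul_diff:
  assumes "g \<in> H i" "v \<in> V (deg (Suc i))"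
  shows "g (\<Delta> i (\<iota> v)) = (\<Oplus>\<^bsub>A\<^esub>t\<in>words s (gap i). X t \<star> g (\<iota> (slice t [] (deg i) v)))"
    and "t \<in> words s (gap i) \<Longrightarrow> g (\<iota> (slice t [] (deg i) v)) \<in> carrier A"
proof -
  show "g (\<Delta> i (\<iota> v)) = (\<Oplus>\<^bsub>A\<^esub>t\<in>words s (gap i). X t \<star> g (\<iota> (slice t [] (deg i) v)))"
    using hom_koszul_diff_\<iota>[OF left_module_reg assms] by (simp add: finsum_regular_module regular_module_simps)
  show "t \<in> words s (gap i) \<Longrightarrow> g (\<iota> (slice t [] (deg i) v)) \<in> carrier A"
    using H_closed[OF assms(1) \<iota>_KV] slice_left_dual assms(2) unfolding deg_Suc by blast
qed

text \<open>Only the summand whose factor \<open>X t\<close> is the prefix of \<open>u\<close>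
  contributes. If \<open>u\<close> is shorter than \<open>gap i\<close> there is none; if it has
  exactly that length, what remains is the constant term of \<open>g\<close> at the contraction of
  \<open>v\<close> by \<open>u\<close>.\<close>

lemma coef_H_koszul_diff:
  assumes "g \<in> H i" "v \<in> V (deg (Suc i))" "length u < N"
  shows "coef (g (\<Delta> i (\<iota> v))) u = (\<Sum>t\<in>words s (gap i). if take (gap i) u = t
           then coef (g (\<iota> (slice t [] (deg i) v))) (drop (gap i) u) else 0)"
proof -
  note c = H_koszul_diff(2)[OF assms(1,2)]
  have "coef (g (\<Delta> i (\<iota> v))) u
      = (\<Sum>t\<in>words s (gap i). coef (X t \<star> g (\<iota> (slice t [] (deg i) v))) u)"
    unfolding H_koszul_diff(1)[OF assms(1,2)] by (rule coef_finsum) (use c assms(3) in auto)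
  also have "\<dots> = (\<Sum>t\<in>words s (gap i). if take (gap i) u = t
           then coef (g (\<iota> (slice t [] (deg i) v))) (drop (gap i) u) else 0)"
    using c assms(3) by (intro sum.cong) (auto simp: coef_X_mult words_def)
  finally show ?thesis .
qed

lemma eps_H_koszul_diff: "\<lbrakk>g \<in> H i; v \<in> V (deg (Suc i))\<rbrakk> \<Longrightarrow> coef (g (\<Delta> i (\<iota> v))) [] = 0"
  using gap_pos[of i] by (subst coef_H_koszul_diff) (auto simp: words_def intro!: sum.neutral)

text \<open>When Ext is zero, the coset of every cocycle is the set \<open>B\<close> of
  coboundaries, and a cocycle belongs to its own coset. The restriction \<open>z\<close> replaces
  \<open>f\<close> because members of \<open>dual_module\<close> are extensional.\<close>

lemma Ext_vanishing:
  assumes "carrier (Ext_module A K \<Delta> (Suc j)) = {\<zero>\<^bsub>Ext_module A K \<Delta> (Suc j)\<^esub>}"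
    and f: "f \<in> H (Suc j)" "\<And>x. x \<in> carrier (K (Suc (Suc j))) \<Longrightarrow> f (\<Delta> (Suc j) x) = \<zero>\<^bsub>A\<^esub>"
  obtains g where "g \<in> H j" "\<And>x. x \<in> carrier (K (Suc j)) \<Longrightarrow> f x = g (\<Delta> j x)"
proof -
  interpret K: left_module A "K (Suc j)" by (rule left_module_KV)
  define B where "B = dual_coboundaries A K \<Delta> (Suc j)"
  define z where "z = (\<lambda>x\<in>carrier (K (Suc j)). f x)"
  have z: "z \<in> dual_cocycles A K \<Delta> (Suc j)"
    using K.restrict_dual[OF f(1)] f(2) mod_hom_closed[OF koszul_diff_hom]
    by (simp add: dual_cocycles_def z_def)
  then have "B +>\<^bsub>K.L\<^esub> z = B"
    using assms(1) by (auto simp: Ext_module_def subquotient_def B_def)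
  moreover have "\<zero>\<^bsub>K.L\<^esub> \<in> B"
  proof -
    interpret K': left_module A "K j" by (rule left_module_KV)
    have "\<zero>\<^bsub>K.L\<^esub> = (\<lambda>x\<in>carrier (K (Suc j)). \<zero>\<^bsub>K'.L\<^esub> (\<Delta> j x))"
      using mod_hom_closed[OF koszul_diff_hom, of _ j] by (auto simp: dual_module_simps intro!: restrict_ext)
    then show ?thesis using K'.dual_zero_closed by (auto simp: B_def dual_coboundaries_def)
  qed
  moreover have "\<zero>\<^bsub>K.L\<^esub> \<oplus>\<^bsub>K.L\<^esub> z = z"
    using H_closed[OF f(1)] by (auto simp: dual_module_simps z_def intro!: restrict_ext)
  ultimately have "z \<in> B" unfolding a_r_coset_def r_coset_def by force
  then obtain g where "g \<in> H j" "z = (\<lambda>x\<in>carrier (K (Suc j)). g (\<Delta> j x))"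
    by (auto simp: B_def dual_coboundaries_def dual_module_simps)
  moreover have "f x = z x" if "x \<in> carrier (K (Suc j))" for x using that by (simp add: z_def)
  ultimately show ?thesis using that[of g] by simp
qed

text \<open>Precomposition with the differential, here \<open>\<delta>\<close>, is a homomorphism of
  right modules, and \<open>B\<close> is its image.\<close>

lemma coboundaries_submodule:
  "left_module.dual_submodule A (K (Suc j)) (dual_coboundaries A K \<Delta> (Suc j))"
proof -
  interpret K: left_module A "K (Suc j)" by (rule left_module_KV)
  define B where "B = dual_coboundaries A K \<Delta> (Suc j)"
  interpret K': left_module A "K j" by (rule left_module_KV)
  define \<delta> where "\<delta> g = (\<lambda>x\<in>carrier (K (Suc j)). g (\<Delta> j x))" for g :: "(nat list \<Rightarrow> (nat list \<Rightarrow> 'k) set) \<Rightarrow> (nat list \<Rightarrow> 'k) set"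
  have B: "B = \<delta> ` carrier K'.L" by (simp add: B_def dual_coboundaries_def \<delta>_def)
  have d: "\<Delta> j x \<in> carrier (K j)" if "x \<in> carrier (K (Suc j))" for x
    by (rule mod_hom_closed[OF koszul_diff_hom that])
  have "\<delta> g \<in> carrier K.L" if "g \<in> carrier K'.L" for g
  proof -
    have "g \<in> H j" using that by (simp add: dual_module_simps)
    then show ?thesis unfolding \<delta>_def by (intro K.restrict_dual mod_hom_comp[OF koszul_diff_hom])
  qed
  then have 1: "B \<subseteq> carrier K.L" unfolding B by blast
  have "\<zero>\<^bsub>K.L\<^esub> = \<delta> \<zero>\<^bsub>K'.L\<^esub>" using d by (auto simp: dual_module_simps \<delta>_def intro!: restrict_ext)
  then have 2: "\<zero>\<^bsub>K.L\<^esub> \<in> B" unfolding B using K'.dual_zero_closed by blast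
  have "\<delta> f \<oplus>\<^bsub>K.L\<^esub> \<delta> g = \<delta> (f \<oplus>\<^bsub>K'.L\<^esub> g)" for f g
    using d by (auto simp: dual_module_simps \<delta>_def intro!: restrict_ext)
  then have 3: "\<forall>f\<in>B. \<forall>g\<in>B. f \<oplus>\<^bsub>K.L\<^esub> g \<in> B" unfolding B using K'.dual_add_closed by force
  have "a \<odot>\<^bsub>K.L\<^esub> \<delta> f = \<delta> (a \<odot>\<^bsub>K'.L\<^esub> f)" for a f
    using d by (auto simp: dual_module_simps \<delta>_def intro!: restrict_ext)
  then have "\<forall>a\<in>carrier A. \<forall>f\<in>B. a \<odot>\<^bsub>K.L\<^esub> f \<in> B" unfolding B using K'.dual_smult_closed by force
  with 1 2 3 show ?thesis unfolding K.dual_submodule_def B_def by blast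
qed

text \<open>The isomorphism \<open>Ext\<^sup>D(K, A) \<cong> K\<close> as a functional on the cochains of top degree.\<close>

lemma Ext_top_functional:
  assumes top: "\<forall>v\<in>V (deg (Suc (Suc j))). \<forall>u. v u = 0"
    and iso: "mod_isomorphic A (Ext_module A K \<Delta> (Suc j)) (trivial_module A)"
  obtains \<tau> where
    "\<And>z z'. \<lbrakk>z \<in> carrier (KD (Suc j)); z' \<in> carrier (KD (Suc j))\<rbrakk>
       \<Longrightarrow> \<tau> (z \<oplus>\<^bsub>KD (Suc j)\<^esub> z') = \<tau> z + \<tau> z'"
    "\<And>a z. \<lbrakk>a \<in> carrier A; z \<in> carrier (KD (Suc j))\<rbrakk>
       \<Longrightarrow> \<tau> (a \<odot>\<^bsub>KD (Suc j)\<^esub> z) = coef a [] * \<tau> z"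
    "\<And>z. z \<in> carrier (KD (Suc j)) \<Longrightarrow> \<tau> z = 0 \<longleftrightarrow> z \<in> dual_coboundaries A K \<Delta> (Suc j)"
    "\<exists>z \<in> carrier (KD (Suc j)). \<tau> z = 1"
proof -
  interpret K: left_module A "K (Suc j)" by (rule left_module_KV)
  interpret K2: left_module A "K (Suc (Suc j))" by (rule left_module_KV)
  define B where "B = dual_coboundaries A K \<Delta> (Suc j)"
  note submod = coboundaries_submodule[where j = j, folded B_def]
  note B = K.dual_submoduleD[OF submod]
  note coset = K.coset_eq_iff[OF submod] K.coset_add[OF submod] K.coset_smult[OF submod]
  have zero: "F = \<zero>\<^bsub>K (Suc (Suc j))\<^esub>" if F: "F \<in> carrier (K (Suc (Suc j)))" for F
  proof
    fix u
    have "F \<in> algebra_tensor s R (V (deg (Suc (Suc j))))" using F by (simp add: free_module_simps)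
    then have "F u = \<zero>\<^bsub>A\<^esub>"
      by (induction rule: algebra_tensor.induct) (simp_all add: top sc_zero)
    then show "F u = \<zero>\<^bsub>K (Suc (Suc j))\<^esub> u" by (simp add: free_module_simps)
  qed
  \<comment> \<open>The term after \<open>Suc j\<close> is zero by \<open>top\<close>, so every
    cochain of top degree is a cocycle and Ext is a quotient of the whole dual module.\<close>
  have Z: "dual_cocycles A K \<Delta> (Suc j) = carrier K.L"
  proof -
    have "f (\<Delta> (Suc j) x) = \<zero>\<^bsub>A\<^esub>" if f: "f \<in> carrier K.L" and x: "x \<in> carrier (K (Suc (Suc j)))" for f x
    proof -
      have "f \<in> H (Suc j)" using f by (simp add: dual_module_simps)
      then show ?thesis
        using zero[OF x] mod_hom_zero[OF koszul_diff_hom K2.left_module_axioms K.left_module_axioms]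
          mod_hom_zero[OF _ K.left_module_axioms left_module_reg, of f] by (simp add: regular_module_simps)
    qed
    then show ?thesis by (auto simp: dual_cocycles_def)
  qed
  let ?E = "Ext_module A K \<Delta> (Suc j)"
  have E: "carrier ?E = (\<lambda>z. B +>\<^bsub>K.L\<^esub> z) ` carrier K.L" "P \<oplus>\<^bsub>?E\<^esub> Q = P <+>\<^bsub>K.L\<^esub> Q"
    "a \<odot>\<^bsub>?E\<^esub> P = B <+>\<^bsub>K.L\<^esub> ((\<lambda>x. a \<odot>\<^bsub>K.L\<^esub> x) ` P)" for P Q a
    unfolding Ext_module_def subquotient_def Z B_def by simp_all
  obtain \<theta> where \<theta>: "\<theta> \<in> mod_hom A ?E (trivial_module A)" "bij_betw \<theta> (carrier ?E) UNIV"
    using iso by (auto simp: mod_isomorphic_def trivial_module_simps)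
  define \<tau> where "\<tau> z = \<theta> (B +>\<^bsub>K.L\<^esub> z)" for z
  have mem: "B +>\<^bsub>K.L\<^esub> z \<in> carrier ?E" if "z \<in> carrier K.L" for z using that by (simp add: E)
  have add: "\<tau> (z \<oplus>\<^bsub>K.L\<^esub> z') = \<tau> z + \<tau> z'" if "z \<in> carrier K.L" "z' \<in> carrier K.L" for z z'
    using mod_hom_add[OF \<theta>(1) mem[OF that(1)] mem[OF that(2)]] coset(2)[OF that]
    by (simp add: \<tau>_def E(2) trivial_module_simps)
  have smult: "\<tau> (a \<odot>\<^bsub>K.L\<^esub> z) = coef a [] * \<tau> z" if "a \<in> carrier A" "z \<in> carrier K.L" for a z
    using mod_hom_smult[OF \<theta>(1) that(1) mem[OF that(2)]] coset(3)[OF that(2,1)]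
    by (simp add: \<tau>_def E(3) trivial_module_simps)
  have "\<tau> \<zero>\<^bsub>K.L\<^esub> = 0"
  proof -
    have "\<zero>\<^bsub>K.L\<^esub> \<oplus>\<^bsub>K.L\<^esub> \<zero>\<^bsub>K.L\<^esub> = \<zero>\<^bsub>K.L\<^esub>"
        by (auto simp: dual_module_simps intro!: restrict_ext)
    then show ?thesis using add[OF K.dual_zero_closed K.dual_zero_closed] by (metis add_cancel_left_left)
  qed
  then have "\<tau> z = 0 \<longleftrightarrow> z \<in> B" if z: "z \<in> carrier K.L" for z
  proof -
    have B0: "B +>\<^bsub>K.L\<^esub> \<zero>\<^bsub>K.L\<^esub> = B" using coset(1)[OF K.dual_zero_closed] B(2) by simp
    have "\<tau> z = 0 \<longleftrightarrow> \<theta> (B +>\<^bsub>K.L\<^esub> z) = \<theta> (B +>\<^bsub>K.L\<^esub> \<zero>\<^bsub>K.L\<^esub>)" using \<open>\<tau> \<zero>\<^bsub>K.L\<^esub> = 0\<close> by (simp add: \<tau>_def)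
    also have "\<dots> \<longleftrightarrow> B +>\<^bsub>K.L\<^esub> z = B +>\<^bsub>K.L\<^esub> \<zero>\<^bsub>K.L\<^esub>"
      using \<theta>(2) mem[OF z] mem[OF K.dual_zero_closed] by (auto simp: bij_betw_def inj_on_def)
    also have "\<dots> \<longleftrightarrow> z \<in> B" unfolding B0 by (rule coset(1)[OF z])
    finally show ?thesis .
  qed
  moreover have "\<exists>z\<in>carrier K.L. \<tau> z = 1"
  proof -
    have "(1 :: 'k) \<in> \<theta> ` carrier ?E" using \<theta>(2) by (simp add: bij_betw_def)
    then show ?thesis unfolding E(1) \<tau>_def by force
  qed
  ultimately show ?thesis using that[of \<tau>] add smult unfolding B_def by blast
qed

text \<open>By minimality coboundaries take values with zero constant term, so the coordinate
  functionals \<open>e p\<close> are linearly independent modulo coboundaries; as the quotient is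
  one-dimensional, there is exactly one pivot. Since \<open>\<tau>\<close> sees a scalar
  \<open>a\<close> only through its constant term, it kills \<open>a\<close> times
  \<open>e p\<close> whenever that term is zero, and the coboundary so obtained is the required
  preimage of \<open>a\<close>.\<close>

lemma Ext_top:
  assumes top: "\<forall>v\<in>V (deg (Suc (Suc j))). \<forall>u. v u = 0"
    and iso: "mod_isomorphic A (Ext_module A K \<Delta> (Suc j)) (trivial_module A)"
  obtains w where "w \<in> V (deg (Suc j))" "\<And>v. v \<in> V (deg (Suc j)) \<Longrightarrow> \<exists>c. v = (\<lambda>u. c * w u)"
    "\<And>a. \<lbrakk>a \<in> carrier A; coef a [] = 0\<rbrakk> \<Longrightarrow> \<exists>g\<in>H j. g (\<Delta> j (\<iota> w)) = a"
    "\<And>F. F \<in> carrier (K (Suc j)) \<Longrightarrow> \<exists>a\<in>carrier A. F = a \<odot>\<^bsub>K (Suc j)\<^esub> \<iota> w"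
proof -
  interpret K: left_module A "K (Suc j)" by (rule left_module_KV)
  obtain B b where pivots: "pivot_basis (V (deg (Suc j))) B b" by (rule dual_pivots)
  note B = pivot_basisD[OF pivots]
  obtain \<tau> where \<tau>: "\<And>z z'. \<lbrakk>z \<in> carrier K.L; z' \<in> carrier K.L\<rbrakk> \<Longrightarrow> \<tau> (z \<oplus>\<^bsub>K.L\<^esub> z') = \<tau> z + \<tau> z'"
    "\<And>a z. \<lbrakk>a \<in> carrier A; z \<in> carrier K.L\<rbrakk> \<Longrightarrow> \<tau> (a \<odot>\<^bsub>K.L\<^esub> z) = coef a [] * \<tau> z"
    "\<And>z. z \<in> carrier K.L \<Longrightarrow> \<tau> z = 0 \<longleftrightarrow> z \<in> dual_coboundaries A K \<Delta> (Suc j)"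
    "\<exists>z \<in> carrier K.L. \<tau> z = 1"
    by (rule Ext_top_functional[OF top iso]) blast+
  have cobound: "\<exists>g\<in>H j. \<forall>v\<in>V (deg (Suc j)). z (\<iota> v) = g (\<Delta> j (\<iota> v))" if "z \<in> carrier K.L" "\<tau> z = 0" for z
  proof -
    have "z \<in> dual_coboundaries A K \<Delta> (Suc j)" using \<tau>(3) that by blast
    then obtain g where "g \<in> H j" "z = (\<lambda>x\<in>carrier (K (Suc j)). g (\<Delta> j x))"
      by (auto simp: dual_coboundaries_def dual_module_simps)
    then show ?thesis using \<iota>_KV by (intro bexI[of _ g]) auto
  qed
  have cobound_eps: "coef (z (\<iota> v)) [] = 0" if "z \<in> carrier K.L" "\<tau> z = 0" "v \<in> V (deg (Suc j))" for z v
    using cobound[OF that(1,2)] that(3) eps_H_koszul_diff by metis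
  define e where "e p = (\<lambda>F\<in>carrier (K (Suc j)). F p)" for p :: "nat list"
  have e: "e p \<in> carrier K.L" for p
    unfolding e_def
    by (rule K.restrict_dual, rule mod_homI) (auto simp: regular_module_simps KV_closed free_module_simps(3,4))
  have e_basis: "(a \<odot>\<^bsub>K.L\<^esub> e p) (\<iota> (b q)) = (if p = q then a else \<zero>\<^bsub>A\<^esub>)"
    if "p \<in> B" "q \<in> B" "a \<in> carrier A" for a p q
    using that B(2,3) \<iota>_KV by (auto simp: dual_module_simps e_def \<iota>_def sc_one sc_zero)
  have "B \<noteq> {}"
  proof
    assume "B = {}"
    then have zero: "F = \<zero>\<^bsub>K (Suc j)\<^esub>" if "F \<in> carrier (K (Suc j))" for F
      using free_module_expand[OF pivots that] by simp
    have "z = \<zero>\<^bsub>K.L\<^esub>" if z: "z \<in> carrier K.L" for z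
    proof (rule K.dual_ext[OF z K.dual_zero_closed])
      fix F assume F: "F \<in> carrier (K (Suc j))"
      have "z \<in> H (Suc j)" using z by (simp add: dual_module_simps)
      then show "z F = \<zero>\<^bsub>K.L\<^esub> F"
        using zero[OF F] mod_hom_zero[OF _ K.left_module_axioms left_module_reg, of z] F
        by (simp add: dual_module_simps regular_module_simps)
    qed
    moreover have "\<tau> \<zero>\<^bsub>K.L\<^esub> = 0"
    proof -
      have "\<zero>\<^bsub>K.L\<^esub> \<oplus>\<^bsub>K.L\<^esub> \<zero>\<^bsub>K.L\<^esub> = \<zero>\<^bsub>K.L\<^esub>"
        by (auto simp: dual_module_simps intro!: restrict_ext)
      then show ?thesis using \<tau>(1)[OF K.dual_zero_closed K.dual_zero_closed] by (metis add_cancel_left_left)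
    qed
    ultimately show False using \<tau>(4) by auto
  qed
  moreover have "p = q" if pq: "p \<in> B" "q \<in> B" for p q
  proof (rule ccontr)
    assume ne: "p \<noteq> q"
    \<comment> \<open>Otherwise \<open>e p\<close> would be a coboundary, although it takes the
      value 1 at the basis vector \<open>b p\<close>.\<close>
    have nz: "\<tau> (e p) \<noteq> 0" if "p \<in> B" for p
    proof
      assume "\<tau> (e p) = 0"
      then have "\<tau> (\<one>\<^bsub>A\<^esub> \<odot>\<^bsub>K.L\<^esub> e p) = 0" using \<tau>(2)[OF A.one_closed e] by simp
      then have "coef ((\<one>\<^bsub>A\<^esub> \<odot>\<^bsub>K.L\<^esub> e p) (\<iota> (b p))) [] = 0"
        using cobound_eps K.dual_smult_closed[OF e A.one_closed] B(2)[OF that] by blast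
      then show False using e_basis[OF that that A.one_closed] by (simp add: coef_one)
    qed
    \<comment> \<open>This combination is annihilated by \<open>\<tau>\<close>, hence a coboundary,
      yet its constant term at \<open>b p\<close> is \<open>\<tau> (e q)\<close>, which is
      nonzero.\<close>
    let ?z1 = "sc (\<tau> (e q)) \<odot>\<^bsub>K.L\<^esub> e p" and ?z2 = "sc (- \<tau> (e p)) \<odot>\<^bsub>K.L\<^esub> e q"
    have z: "?z1 \<in> carrier K.L" "?z2 \<in> carrier K.L" using K.dual_smult_closed e by simp_all
    have "\<tau> (?z1 \<oplus>\<^bsub>K.L\<^esub> ?z2) = 0" using \<tau>(1)[OF z] \<tau>(2)[OF _ e] by simp
    then have "coef ((?z1 \<oplus>\<^bsub>K.L\<^esub> ?z2) (\<iota> (b p))) [] = 0"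
      using cobound_eps K.dual_add_closed[OF z] B(2)[OF pq(1)] by blast
    moreover have "(?z1 \<oplus>\<^bsub>K.L\<^esub> ?z2) (\<iota> (b p)) = ?z1 (\<iota> (b p)) \<oplus>\<^bsub>A\<^esub> ?z2 (\<iota> (b p))"
      using \<iota>_KV[OF B(2)[OF pq(1)]] by (simp add: dual_module_simps)
    ultimately have "\<tau> (e q) = 0"
      using e_basis[OF pq(1) pq(1)] e_basis[OF pq(2) pq(1)] ne by simp
    then show False using nz[OF pq(2)] by simp
  qed
  ultimately obtain p where p: "B = {p}" by blast
  show ?thesis
  proof (rule that[of "b p"])
    show "b p \<in> V (deg (Suc j))" using B(2) p by simp
    show "\<exists>c. v = (\<lambda>u. c * b p u)" if "v \<in> V (deg (Suc j))" for v
    proof (intro exI[of _ "v p"] ext)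
      show "v u = v p * b p u" for u using B(4)[OF that, of u] unfolding p by (simp only: sum.insert finite.emptyI) simp
    qed
    show "\<exists>g\<in>H j. g (\<Delta> j (\<iota> (b p))) = a" if a: "a \<in> carrier A" "coef a [] = 0" for a
    proof -
      have "\<tau> (a \<odot>\<^bsub>K.L\<^esub> e p) = 0" using \<tau>(2)[OF a(1) e] a(2) by simp
      then obtain g where "g \<in> H j" "\<forall>v\<in>V (deg (Suc j)). (a \<odot>\<^bsub>K.L\<^esub> e p) (\<iota> v) = g (\<Delta> j (\<iota> v))"
        using cobound[OF K.dual_smult_closed[OF e a(1)]] by blast
      then show ?thesis using e_basis[of p p a] a(1) B(2) p by auto
    qed
    show "\<exists>a\<in>carrier A. F = a \<odot>\<^bsub>K (Suc j)\<^esub> \<iota> (b p)" if F: "F \<in> carrier (K (Suc j))" for F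
    proof (rule bexI)
      have "F p \<odot>\<^bsub>K (Suc j)\<^esub> \<iota> (b p) \<in> carrier (K (Suc j))"
        using KV_smult KV_closed[OF F] \<iota>_KV B(2) p by simp
      then show "F = F p \<odot>\<^bsub>K (Suc j)\<^esub> \<iota> (b p)" using free_module_expand[OF pivots F] p by simp
      show "F p \<in> carrier A" by (rule KV_closed[OF F])
    qed
  qed
qed

end

section \<open>Linear functionals on the dual components\<close>

context homogeneous_relations
begin

lemma \<iota>_add: "\<iota> (\<lambda>u. v u + v' u) = \<iota> v \<oplus>\<^bsub>KV n\<^esub> \<iota> v'"
  by (simp add: \<iota>_def free_module_simps sc_add)

lemma \<iota>_smult: "\<iota> (\<lambda>u. c * v u) = sc c \<odot>\<^bsub>KV n\<^esub> \<iota> v"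
  by (simp add: \<iota>_def free_module_simps sc_mult)

text \<open>Linearity is demanded on \<open>V n\<close> only: the functionals of interest have the
  form \<open>coef (g (\<iota> v)) []\<close>, and a homomorphism \<open>g\<close> is controlled
  only on the carrier of its module.\<close>

definition functional :: "nat \<Rightarrow> ((nat list \<Rightarrow> 'k) \<Rightarrow> 'k) \<Rightarrow> bool" where
  "functional n \<psi> \<longleftrightarrow> (\<forall>f\<in>V n. \<forall>g\<in>V n. \<psi> (\<lambda>u. f u + g u) = \<psi> f + \<psi> g) \<and>
     (\<forall>c. \<forall>f\<in>V n. \<psi> (\<lambda>u. c * f u) = c * \<psi> f)"

lemma functional_add:
  "\<lbrakk>functional n \<psi>; f \<in> V n; g \<in> V n\<rbrakk> \<Longrightarrow> \<psi> (\<lambda>u. f u + g u) = \<psi> f + \<psi> g"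
  by (simp add: functional_def)

lemma functional_sum:
  assumes "functional n \<psi>" "finite S" "\<And>i. i \<in> S \<Longrightarrow> v i \<in> V n"
  shows "\<psi> (\<lambda>u. \<Sum>i\<in>S. c i * v i u) = (\<Sum>i\<in>S. c i * \<psi> (v i))"
  using assms(2,3)
proof (induction S rule: finite_induct)
  case empty
  have "\<psi> (\<lambda>u. c * f u) = c * \<psi> f" if "f \<in> V n" for c f
    using assms(1) that unfolding functional_def by blast
  from this[OF dual_lin(1), of 0] show ?case by simp
next
  case (insert i S)
  have 1: "(\<lambda>u. \<Sum>i\<in>S. c i * v i u) \<in> V n"
    by (rule linear_subspace_sum[OF linear_subspace_dual insert.hyps(1)]) (use insert.prems dual_lin(3) in auto)
  have 2: "(\<lambda>u. c i * v i u) \<in> V n" using insert.prems dual_lin(3) by simp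
  note functional_add[OF assms(1) 2 1]
  moreover have "\<psi> (\<lambda>u. c i * v i u) = c i * \<psi> (v i)"
    using assms(1) insert.prems unfolding functional_def by simp
  ultimately show ?case using insert by simp
qed

lemma functional_lin:
  assumes "functional n \<psi>" "functional n \<phi>"
  shows "functional n (\<lambda>v. a * \<psi> v + b * \<phi> v)"
  using assms unfolding functional_def by (simp add: algebra_simps)

lemma functional_eval: "functional n (\<lambda>v. v u)"
  by (simp add: functional_def)

lemma functional_lin_sum:
  assumes "finite S" "\<And>i. i \<in> S \<Longrightarrow> functional n (\<phi> i)"
  shows "functional n (\<lambda>v. \<Sum>i\<in>S. \<phi> i v * c i)"
  using assms unfolding functional_def
  by (auto simp: sum.distrib[symmetric] sum_distrib_left algebra_simps intro!: sum.cong)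

lemma functional_expand:
  assumes "functional n \<psi>" "pivot_basis (V n) B b" "v \<in> V n"
  shows "\<psi> v = (\<Sum>p\<in>B. v p * \<psi> (b p))"
proof -
  note B = pivot_basisD[OF assms(2)]
  have "v = (\<lambda>u. \<Sum>p\<in>B. v p * b p u)" using B(4)[OF assms(3)] by (rule ext)
  then have "\<psi> v = \<psi> (\<lambda>u. \<Sum>p\<in>B. v p * b p u)" by (rule arg_cong)
  also have "\<dots> = (\<Sum>p\<in>B. v p * \<psi> (b p))" by (rule functional_sum[OF assms(1) B(1,2)])
  finally show ?thesis .
qed

lemma eps_functional:
  assumes "g \<in> H i" shows "functional (deg i) (\<lambda>v. coef (g (\<iota> v)) [])"
  unfolding functional_def
proof (intro conjI ballI allI)
  fix v v' assume v: "v \<in> V (deg i)" "v' \<in> V (deg i)"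
  have "g (\<iota> (\<lambda>u. v u + v' u)) = g (\<iota> v) \<oplus>\<^bsub>A\<^esub> g (\<iota> v')"
    using mod_hom_add[OF assms \<iota>_KV[OF v(1)] \<iota>_KV[OF v(2)]] 
    by (simp add: \<iota>_add[of v v' "deg i"] regular_module_simps)
  then show "coef (g (\<iota> (\<lambda>u. v u + v' u))) [] = coef (g (\<iota> v)) [] + coef (g (\<iota> v')) []"
    using H_closed[OF assms \<iota>_KV] v by (simp add: coef_add)
next
  fix c v assume v: "v \<in> V (deg i)"
  have "g (\<iota> (\<lambda>u. c * v u)) = sc c \<star> g (\<iota> v)"
    using mod_hom_smult[OF assms sc_closed \<iota>_KV[OF v]] 
    by (simp add: \<iota>_smult[of c v "deg i"] regular_module_simps)
  then show "coef (g (\<iota> (\<lambda>u. c * v u))) [] = c * coef (g (\<iota> v)) []"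
    using H_closed[OF assms \<iota>_KV[OF v]] by (simp add: eps_mult)
qed

text \<open>As the module is free, values at the basis may be prescribed at will. The values at all
  other \<open>v\<close> are then the desired ones because the representatives
  \<open>\<Psi> v\<close> depend linearly on \<open>v\<close>, coefficient by coefficient.\<close>

lemma hom_of_functionals:
  assumes "\<And>u. functional (deg i) (\<lambda>v. \<Psi> v u)" "\<And>v. \<Psi> v \<in> carrier T"
  obtains f where "f \<in> H i" "\<And>v. v \<in> V (deg i) \<Longrightarrow> f (\<iota> v) = cls (\<Psi> v)"
proof -
  obtain B b where pivots: "pivot_basis (V (deg i)) B b" by (rule dual_pivots)
  define f where "f F = (\<Oplus>\<^bsub>A\<^esub>p\<in>B. F p \<star> cls (\<Psi> (b p)))" for F
  have "f \<in> H i"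
    using hom_extend(1)[OF pivots left_module_reg, of "\<lambda>p. cls (\<Psi> (b p))"] assms(2)
    by (simp add: f_def[abs_def] finsum_regular_module regular_module_simps)
  moreover have "f (\<iota> v) = cls (\<Psi> v)" if v: "v \<in> V (deg i)" for v
  proof -
    have "f (\<iota> v) = (\<Oplus>\<^bsub>A\<^esub>p\<in>B. cls (\<lambda>u. v p * \<Psi> (b p) u))"
      unfolding f_def using assms(2) smult_closed_free[OF assms(2)]
      by (intro A.finsum_cong') (auto simp: \<iota>_def sc_cls)
    also have "\<dots> = cls (\<lambda>u. \<Sum>p\<in>B. v p * \<Psi> (b p) u)"
      using cls_sum[OF pivot_basisD(1)[OF pivots]] smult_closed_free[OF assms(2)] by simp
    also have "(\<lambda>u. \<Sum>p\<in>B. v p * \<Psi> (b p) u) = \<Psi> v"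
      by (rule ext) (rule functional_expand[OF assms(1) pivots v, symmetric])
    finally show ?thesis .
  qed
  ultimately show ?thesis by (rule that)
qed

section \<open>The last terms of the Koszul complex of a Gorenstein algebra\<close>

context
  fixes D :: nat
  assumes s_pos: "1 \<le> s" and koszul: "koszul s N R" and gldim: "global_dimension A = enat D"
    and gorenstein: "gorenstein A D"
begin

lemma gorenstein_koszul_complex:
  "i \<noteq> D \<Longrightarrow> carrier (Ext_module A K \<Delta> i) = {\<zero>\<^bsub>Ext_module A K \<Delta> i\<^esub>}"
  "mod_isomorphic A (Ext_module A K \<Delta> D) (trivial_module A)"
proof -
  have "projective_resolution A (trivial_module A) K \<Delta> (\<lambda>F. (\<lambda>c. c) (augmentation F))"
    by (rule koszul_resolution[OF koszul left_module_trivial mod_hom_ident]) (simp add: trivial_module_simps bij_betw_def)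
  then show "i \<noteq> D \<Longrightarrow> carrier (Ext_module A K \<Delta> i) = {\<zero>\<^bsub>Ext_module A K \<Delta> i\<^esub>}"
    "mod_isomorphic A (Ext_module A K \<Delta> D) (trivial_module A)"
    using gorenstein unfolding gorenstein_def by blast+
qed

text \<open>Inside the proof \<open>j\<close> is \<open>D - 1\<close> and \<open>i\<close> is
  \<open>D - 2\<close>. The top Ext supplies preimages of all elements with zero constant term; the
  vanishing of the Ext below it turns every homomorphism on the term \<open>j\<close> that kills
  \<open>\<Delta> j (\<iota> w)\<close> into a coboundary.\<close>

lemma koszul_gorenstein_tensor:
  obtains i w \<phi> where "D = Suc (Suc i)" "gap (Suc i) = 1" "w \<in> V (deg D)"
    "\<And>v. v \<in> V (deg D) \<Longrightarrow> \<exists>c. v = (\<lambda>u. c * w u)"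
    "\<And>\<mu> \<nu>. \<lbrakk>\<mu> \<le> s; \<nu> \<le> s\<rbrakk> \<Longrightarrow> \<phi> \<mu> (slice [\<nu>] [] (deg (Suc i)) w) = (if \<mu> = \<nu> then 1 else 0)"
    "\<And>\<mu>. \<mu> \<le> s \<Longrightarrow> functional (deg (Suc i)) (\<phi> \<mu>)"
    "\<And>v u. v \<in> V (deg (Suc i)) \<Longrightarrow> v u = (\<Sum>\<nu>\<le>s. \<phi> \<nu> v * w (\<nu> # u))"
    "\<And>r. r \<in> R \<Longrightarrow> \<exists>\<gamma>. \<forall>u\<in>words s N. r u = (\<Sum>q\<in>words s (deg i). w (u @ q) * \<gamma> q)"
proof -
  note vanish = dual_component_vanishes[OF koszul gldim]
  have mono_V1: "monomial [l] (1 :: 'k) \<in> V (deg (Suc 0))" if "l \<le> s" for l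
    using monomial_dual[OF that] by (simp add: deg_1)
  \<comment> \<open>For \<open>D = 0\<close> the term in degree 1 would vanish, but it contains the
    generators.\<close>
  obtain j where j: "D = Suc j"
  proof (cases D)
    case 0
    then have "monomial [0] (1 :: 'k) [0] = 0" using vanish[OF mono_V1[of 0, folded 0]] by blast
    then show ?thesis by simp
  qed blast
  obtain w where w: "w \<in> V (deg (Suc j))" and one_dim: "\<And>v. v \<in> V (deg (Suc j)) \<Longrightarrow> \<exists>c. v = (\<lambda>u. c * w u)"
    and lift: "\<And>a. \<lbrakk>a \<in> carrier A; coef a [] = 0\<rbrakk> \<Longrightarrow> \<exists>g\<in>H j. g (\<Delta> j (\<iota> w)) = a"
    and top: "\<And>F. F \<in> carrier (K (Suc j)) \<Longrightarrow> \<exists>a\<in>carrier A. F = a \<odot>\<^bsub>K (Suc j)\<^esub> \<iota> w"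
  proof (rule Ext_top[of j])
    show "\<forall>v\<in>V (deg (Suc (Suc j))). \<forall>u. v u = 0" using vanish unfolding j by blast
    show "mod_isomorphic A (Ext_module A K \<Delta> (Suc j)) (trivial_module A)"
      using gorenstein_koszul_complex(2) unfolding j .
  qed blast
  \<comment> \<open>For \<open>D = 1\<close> the space of generators would be a line, contrary to
    \<open>1 \<le> s\<close>.\<close>
  obtain i where i: "j = Suc i"
  proof (cases j)
    case 0
    obtain c c' where c: "monomial [0] 1 = (\<lambda>u. c * w u)" "monomial [1] 1 = (\<lambda>u. c' * w u)"
      using one_dim mono_V1[of 0] mono_V1[of 1] s_pos unfolding 0 by blast
    have "c * w [0] = 1" "c * w [1] = 0" "c' * w [1] = 1"
      using fun_cong[OF c(1), of "[0]"] fun_cong[OF c(1), of "[1]"] fun_cong[OF c(2), of "[1]"]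
      by (simp_all add: monomial_def)
    then show ?thesis by (metis mult_eq_0_iff zero_neq_one)
  qed blast
  have coef_X1: "coef (X [\<mu>]) [\<nu>] = (if \<nu> = \<mu> then 1 else 0)" "coef (X [\<mu>]) [] = 0" if "\<mu> \<le> s" for \<mu> \<nu>
    using that two_le_N by (simp_all add: coef_X)
  \<comment> \<open>If the last differential consumed two or more letters, the values of its dual
    would have no linear part, and the generator \<open>X [0]\<close> would not be among
    them.\<close>
  have gap: "gap j = 1"
  proof (rule ccontr)
    assume "gap j \<noteq> 1"
    then have g2: "2 \<le> gap j" using gap_pos[of j] by simp
    obtain g where g: "g \<in> H j" "g (\<Delta> j (\<iota> w)) = X [0]"
      using lift[of "X [0]"] coef_X1[of 0] by auto
    have "coef (g (\<Delta> j (\<iota> w))) [0] = 0"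
      using two_le_N g2 by (subst coef_H_koszul_diff[OF g(1) w]) (auto simp: words_def intro!: sum.neutral)
    then show False using coef_X1(1)[of 0 0] by (simp add: g(2))
  qed
  have "\<exists>g. \<forall>\<mu>\<in>{..s}. g \<mu> \<in> H j \<and> g \<mu> (\<Delta> j (\<iota> w)) = X [\<mu>]"
    using lift coef_X1(2) by (intro bchoice) (simp add: Bex_def)
  then obtain g where g: "\<And>\<mu>. \<mu> \<le> s \<Longrightarrow> g \<mu> \<in> H j" "\<And>\<mu>. \<mu> \<le> s \<Longrightarrow> g \<mu> (\<Delta> j (\<iota> w)) = X [\<mu>]" by auto
  \<comment> \<open>The dual basis: comparing the coefficients at \<open>[\<nu>]\<close> in
    \<open>g \<mu> (\<Delta> j (\<iota> w)) = X [\<mu>]\<close> shows that these constant terms are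
    dual to the left contractions \<open>w1 \<nu>\<close>.\<close>
  define \<phi> where "\<phi> \<mu> v = coef (g \<mu> (\<iota> v)) []" for \<mu> v
  have \<phi>: "functional (deg j) (\<phi> \<mu>)" if "\<mu> \<le> s" for \<mu>
    using eps_functional[OF g(1)[OF that]] by (simp add: \<phi>_def[abs_def])
  define w1 where "w1 \<nu> = slice [\<nu>] [] (deg j) w" for \<nu>
  have w': "w \<in> V (deg j + 1)" using w by (simp add: deg_Suc gap)
  have word1: "[\<nu>] \<in> words s 1" if "\<nu> \<le> s" for \<nu> using that by (simp add: words_1)
  have w1: "w1 \<nu> \<in> V (deg j)" "w1 \<nu> u = w (\<nu> # u)" if "\<nu> \<le> s" for \<nu> u
    unfolding w1_def using slice_left_dual[OF w' word1[OF that]] slice_left[OF w' word1[OF that]] by simp_all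
  have dual: "\<phi> \<mu> (w1 \<nu>) = (if \<mu> = \<nu> then 1 else 0)" if "\<mu> \<le> s" "\<nu> \<le> s" for \<mu> \<nu>
  proof -
    have "coef (X [\<mu>]) [\<nu>] = (\<Sum>t\<in>words s 1. if [\<nu>] = t then coef (g \<mu> (\<iota> (slice t [] (deg j) w))) [] else 0)"
      using coef_H_koszul_diff[OF g(1)[OF that(1)] w, of "[\<nu>]"] two_le_N by (simp add: g(2)[OF that(1)] gap)
    also have "\<dots> = \<phi> \<mu> (w1 \<nu>)" using word1[OF that(2)] by (simp add: \<phi>_def w1_def)
    finally show ?thesis using coef_X1(1)[OF that(1), of \<nu>] by auto
  qed
  have diff_w: "f (\<Delta> j (\<iota> w)) = (\<Oplus>\<^bsub>A\<^esub>l\<in>{..s}. X [l] \<star> f (\<iota> (w1 l)))" if f: "f \<in> H j" for f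
  proof -
    have "f (\<Delta> j (\<iota> w)) = (\<Oplus>\<^bsub>A\<^esub>t\<in>(\<lambda>l. [l]) ` {..s}. X t \<star> f (\<iota> (slice t [] (deg j) w)))"
      using H_koszul_diff(1)[OF f w] by (simp add: gap words_1)
    also have "\<dots> = (\<Oplus>\<^bsub>A\<^esub>l\<in>{..s}. X [l] \<star> f (\<iota> (slice [l] [] (deg j) w)))"
      using H_closed[OF f \<iota>_KV] w1(1) unfolding w1_def by (intro A.finsum_reindex) (auto simp: inj_on_def)
    finally show ?thesis by (simp add: w1_def)
  qed
  have exact: "\<exists>h\<in>H i. \<forall>v\<in>V (deg j). f (\<iota> v) = h (\<Delta> i (\<iota> v))" if f: "f \<in> H j" "f (\<Delta> j (\<iota> w)) = \<zero>\<^bsub>A\<^esub>" for f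
  proof -
    \<comment> \<open>The top term is generated by \<open>\<iota> w\<close>, so the cocycle
      condition has to be checked on that element only.\<close>
    have "f (\<Delta> j x) = \<zero>\<^bsub>A\<^esub>" if x: "x \<in> carrier (K (Suc j))" for x
    proof -
      have fd: "(\<lambda>x. f (\<Delta> j x)) \<in> H (Suc j)" by (rule mod_hom_comp[OF koszul_diff_hom f(1)])
      obtain a where "a \<in> carrier A" "x = a \<odot>\<^bsub>K (Suc j)\<^esub> \<iota> w" using top[OF x] by blast
      then show ?thesis
        using mod_hom_smult[OF fd _ \<iota>_KV[OF w], of a] f(2) by (simp add: regular_module_simps)
    qed
    then obtain h where "h \<in> H i" "\<And>x. x \<in> carrier (K (Suc i)) \<Longrightarrow> f x = h (\<Delta> i x)"
      using Ext_vanishing[of i f] gorenstein_koszul_complex(1)[of "Suc i"] f(1) j unfolding i by auto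
    then show ?thesis using \<iota>_KV unfolding i by blast
  qed
  have span: "v u = (\<Sum>\<nu>\<le>s. \<phi> \<nu> v * w (\<nu> # u))" if v: "v \<in> V (deg j)" for v u
  proof -
    \<comment> \<open>The error at \<open>u\<close> of expanding \<open>v\<close> in the
      \<open>w1 \<nu>\<close>. It vanishes on every \<open>w1 \<mu>\<close>, so the homomorphism
      with scalar values \<open>\<psi>\<close> kills \<open>\<Delta> j (\<iota> w)\<close> and is a
      coboundary; minimality then makes the scalar itself zero.\<close>
    define \<psi> where "\<psi> v = 1 * v u + (- 1) * (\<Sum>\<nu>\<le>s. \<phi> \<nu> v * w (\<nu> # u))" for v
    have \<psi>: "functional (deg j) \<psi>"
      unfolding \<psi>_def[abs_def] by (intro functional_lin functional_eval functional_lin_sum) (use \<phi> in auto)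
    have "\<psi> (w1 \<mu>) = 0" if \<mu>: "\<mu> \<le> s" for \<mu>
    proof -
      have "(\<Sum>\<nu>\<le>s. \<phi> \<nu> (w1 \<mu>) * w (\<nu> # u)) = (\<Sum>\<nu>\<le>s. if \<nu> = \<mu> then w (\<nu> # u) else 0)"
        using \<mu> by (intro sum.cong) (auto simp: dual)
      then show ?thesis using \<mu> by (simp add: \<psi>_def w1(2))
    qed
    moreover obtain f where f: "f \<in> H j" and f': "\<And>v. v \<in> V (deg j) \<Longrightarrow> f (\<iota> v) = sc (\<psi> v)"
      by (rule hom_of_functionals[of j "\<lambda>v. monomial [] (\<psi> v)"])
        (use \<psi> in \<open>auto simp: monomial_def functional_def\<close>, simp add: monomial_def[symmetric])
    ultimately have "f (\<Delta> j (\<iota> w)) = \<zero>\<^bsub>A\<^esub>"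
      unfolding diff_w[OF f] using w1(1) by (simp add: f' sc_zero cong: A.finsum_cong)
    then obtain h where "h \<in> H i" "f (\<iota> v) = h (\<Delta> i (\<iota> v))" using exact[OF f] v by blast
    then have "coef (sc (\<psi> v)) [] = 0" using f'[OF v] eps_H_koszul_diff[of h i v] v i by simp
    then show ?thesis by (simp add: \<psi>_def)
  qed
  \<comment> \<open>The gaps 1 and \<open>N - 1\<close> alternate; for \<open>N = 2\<close> they
    coincide and nothing is lost.\<close>
  have gap_i: "gap i = N - 1" using gap two_le_N unfolding i by (auto simp: gap_def split: if_splits)
  have deg_j: "deg j = deg i + (N - 1)" unfolding i deg_Suc gap_i ..
  have relation: "\<exists>\<gamma>. \<forall>u\<in>words s N. r u = (\<Sum>q\<in>words s (deg i). w (u @ q) * \<gamma> q)" if r: "r \<in> R" for r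
  proof -
    define r1 where "r1 \<nu> = (\<lambda>u. r (\<nu> # u))" for \<nu>
    have r1: "r1 \<nu> \<in> carrier T" for \<nu>
    proof -
      have "r1 \<nu> \<in> tensor_power s (N - 1)"
        unfolding tensor_power_def mem_Collect_eq
      proof (intro allI impI)
        fix u assume "r1 \<nu> u \<noteq> 0"
        then have "\<nu> # u \<in> words s N" using relation_letters[OF r, of "\<nu> # u"] by (simp add: r1_def)
        then show "u \<in> words s (N - 1)" by (auto simp: words_def)
      qed
      then show ?thesis using tensor_power_subset_free by blast
    qed
    \<comment> \<open>The functionals \<open>\<phi> \<nu>\<close> extend the assignment of
      \<open>r1 \<nu>\<close> to \<open>w1 \<nu>\<close> linearly to the whole of
      \<open>V (deg j)\<close>.\<close>
    obtain f where f: "f \<in> H j" "\<And>v. v \<in> V (deg j) \<Longrightarrow> f (\<iota> v) = cls (\<lambda>u. \<Sum>\<nu>\<le>s. \<phi> \<nu> v * r1 \<nu> u)"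
    proof (rule hom_of_functionals[of j "\<lambda>v u. \<Sum>\<nu>\<le>s. \<phi> \<nu> v * r1 \<nu> u"])
      show "(\<lambda>u. \<Sum>\<nu>\<le>s. \<phi> \<nu> v * r1 \<nu> u) \<in> carrier T" for v
        by (rule cls_sum[THEN conjunct2]) (use r1 smult_closed_free in auto)
      show "functional (deg j) (\<lambda>v. \<Sum>\<nu>\<le>s. \<phi> \<nu> v * r1 \<nu> u)" for u
        by (rule functional_lin_sum) (use \<phi> in auto)
    qed blast
    have fw: "f (\<iota> (w1 \<nu>)) = cls (r1 \<nu>)" if \<nu>: "\<nu> \<le> s" for \<nu>
    proof -
      have "(\<Sum>\<mu>\<le>s. \<phi> \<mu> (w1 \<nu>) * r1 \<mu> u) = (\<Sum>\<mu>\<le>s. if \<mu> = \<nu> then r1 \<mu> u else 0)" for u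
        using \<nu> by (intro sum.cong) (auto simp: dual)
      then show ?thesis using f(2)[OF w1(1)[OF \<nu>]] \<nu> by simp
    qed
    have "r = (\<lambda>u. \<Sum>\<nu>\<le>s. word_mult (monomial [\<nu>] 1) (r1 \<nu>) u)"
    proof
      fix u
      show "r u = (\<Sum>\<nu>\<le>s. word_mult (monomial [\<nu>] 1) (r1 \<nu>) u)"
      proof (cases u)
        case Nil
        then show ?thesis using relation_zero[OF r, of "[]"] by (simp add: word_mult_monomial_left)
      next
        case (Cons k v)
        have "(\<Sum>\<nu>\<le>s. word_mult (monomial [\<nu>] 1) (r1 \<nu>) u) = (\<Sum>\<nu>\<le>s. if \<nu> = k then r u else 0)"
          by (intro sum.cong) (auto simp: word_mult_monomial_left Cons r1_def)
        also have "\<dots> = (if k \<le> s then r u else 0)" by simp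
        also have "\<dots> = r u" using relation_letters[OF r, of u] Cons by (auto simp: words_def)
        finally show ?thesis by simp
      qed
    qed
    \<comment> \<open>The value of \<open>f\<close> on \<open>\<Delta> j (\<iota> w)\<close> is the
      sum of the \<open>X [\<nu>]\<close> times the classes of the \<open>r1 \<nu>\<close>, which is
      the class of \<open>r\<close> and therefore zero.\<close>
    then have "cls r = cls (\<lambda>u. \<Sum>\<nu>\<le>s. word_mult (monomial [\<nu>] 1) (r1 \<nu>) u)" by (rule arg_cong)
    also have "\<dots> = (\<Oplus>\<^bsub>A\<^esub>\<nu>\<in>{..s}. cls (word_mult (monomial [\<nu>] 1) (r1 \<nu>)))"
      by (rule cls_sum[THEN conjunct1]) (use r1 in \<open>auto intro: word_mult_closed\<close>)
    also have "\<dots> = f (\<Delta> j (\<iota> w))"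
      unfolding diff_w[OF f(1)] using r1 fw by (intro A.finsum_cong') (auto simp: cls_mult)
    finally have "f (\<Delta> j (\<iota> w)) = \<zero>\<^bsub>A\<^esub>" using cls_relation[OF r] by simp
    then obtain h where h: "h \<in> H i" "\<And>v. v \<in> V (deg j) \<Longrightarrow> f (\<iota> v) = h (\<Delta> i (\<iota> v))"
      using exact[OF f(1)] by blast
    obtain B b where pivots: "pivot_basis (V (deg i)) B b" by (rule dual_pivots)
    note B = pivot_basisD[OF pivots]
    define \<gamma>0 where "\<gamma>0 v = coef (h (\<iota> v)) []" for v
    have \<gamma>0: "functional (deg i) \<gamma>0" using eps_functional[OF h(1)] by (simp add: \<gamma>0_def[abs_def])
    \<comment> \<open>Evaluations at the pivots span the functionals on \<open>V (deg i)\<close>, so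
      \<open>\<gamma>0\<close> is given by its values at the pivot basis. Padded by zero, they form
      the tensor by which \<open>w\<close> is contracted on the right.\<close>
    define \<gamma> where "\<gamma> q = (if q \<in> B then \<gamma>0 (b q) else 0)" for q
    have B_words: "B \<subseteq> words s (deg i)"
      using B(2,3) dual_component_supp by fastforce
    have "r u = (\<Sum>q\<in>words s (deg i). w (u @ q) * \<gamma> q)" if u: "u \<in> words s N" for u
    proof -
      obtain \<nu> u' where u': "u = \<nu> # u'" "\<nu> \<le> s" "u' \<in> words s (N - 1)"
        using u two_le_N by (cases u) (auto simp: words_def)
      have lu: "length u' = N - 1" "length u' < N" using u'(3) two_le_N by (auto simp: words_def)
      have wj: "w1 \<nu> \<in> V (deg (Suc i))" using w1(1)[OF u'(2)] by (simp add: i)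
      have wj': "w1 \<nu> \<in> V (deg i + (N - 1))" using w1(1)[OF u'(2)] by (simp add: deg_j)
      define v where "v = slice u' [] (deg i) (w1 \<nu>)"
      have v: "v \<in> V (deg i)" "v q = w (u @ q)" for q
        unfolding v_def using slice_left_dual[OF wj' u'(3)] slice_left[OF wj' u'(3)] w1(2)[OF u'(2)] u'(1) by simp_all
      \<comment> \<open>Length \<open>N - 1\<close> is still below the relations, so
        \<open>r1 \<nu>\<close> can be read off its class. In the coboundary, that coefficient is
        the constant term of \<open>h\<close> at the contraction of \<open>w\<close> by all of
        \<open>u\<close>.\<close>
      have "r u = coef (cls (r1 \<nu>)) u'" using coef_cls[OF r1 lu(2), of \<nu>] by (simp add: r1_def u'(1))
      also have "\<dots> = coef (h (\<Delta> i (\<iota> (w1 \<nu>)))) u'"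
        using h(2)[OF w1(1)[OF u'(2)]] fw[OF u'(2)] by simp
      also have "\<dots> = (\<Sum>t\<in>words s (N - 1). if u' = t then coef (h (\<iota> (slice t [] (deg i) (w1 \<nu>)))) [] else 0)"
        using coef_H_koszul_diff[OF h(1) wj lu(2)] lu(1) by (simp add: gap_i)
      also have "\<dots> = \<gamma>0 v" using u'(3) by (simp add: \<gamma>0_def v_def)
      also have "\<dots> = (\<Sum>p\<in>B. v p * \<gamma>0 (b p))" by (rule functional_expand[OF \<gamma>0 pivots v(1)])
      also have "\<dots> = (\<Sum>q\<in>words s (deg i). w (u @ q) * \<gamma> q)"
        by (rule sum.mono_neutral_cong_left) (use B_words in \<open>auto simp: \<gamma>_def v(2)\<close>)
      finally show ?thesis .
    qed
    then show ?thesis by blast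
  qed
  show ?thesis
  proof (rule that[of i w \<phi>])
    show "D = Suc (Suc i)" using j i by simp
    show "gap (Suc i) = 1" using gap i by simp
    show "w \<in> V (deg D)" using w j by simp
    show "\<exists>c. v = (\<lambda>u. c * w u)" if "v \<in> V (deg D)" for v using one_dim that j by simp
    show "\<phi> \<mu> (slice [\<nu>] [] (deg (Suc i)) w) = (if \<mu> = \<nu> then 1 else 0)" if "\<mu> \<le> s" "\<nu> \<le> s" for \<mu> \<nu>
      using dual[OF that] by (simp add: w1_def i)
    show "functional (deg (Suc i)) (\<phi> \<mu>)" if "\<mu> \<le> s" for \<mu> using \<phi>[OF that] i by simp
    show "v u = (\<Sum>\<nu>\<le>s. \<phi> \<nu> v * w (\<nu> # u))" if "v \<in> V (deg (Suc i))" for v u using span that i by simp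
    show "\<exists>\<gamma>. \<forall>u\<in>words s N. r u = (\<Sum>q\<in>words s (deg i). w (u @ q) * \<gamma> q)" if "r \<in> R" for r
      using relation that by blast
  qed
qed

end

end

section \<open>Multilinear forms and their components\<close>

primrec tensor_form :: "nat \<Rightarrow> (nat list \<Rightarrow> 'k::field) \<Rightarrow> 'k vec list \<Rightarrow> 'k" where
  "tensor_form s W [] = W []"
| "tensor_form s W (x # Xs) = (\<Sum>l\<le>s. x $ l * tensor_form s (\<lambda>u. W (l # u)) Xs)"

lemma tensor_form_cong:
  assumes "\<And>u. u \<in> words s (length Xs) \<Longrightarrow> W u = W' u"
  shows "tensor_form s W Xs = tensor_form s W' Xs"
  using assms
proof (induction Xs arbitrary: W W')
  case (Cons x Xs)
  have "tensor_form s (\<lambda>u. W (l # u)) Xs = tensor_form s (\<lambda>u. W' (l # u)) Xs" if "l \<le> s" for l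
    by (rule Cons.IH) (use Cons.prems that in \<open>auto simp: words_def\<close>)
  then show ?case by simp
qed (simp add: words_def)

lemma tensor_form_sum:
  "tensor_form s (\<lambda>u. \<Sum>i\<in>S. c i * W i u) Xs = (\<Sum>i\<in>S. c i * tensor_form s (W i) Xs)"
proof (induction Xs arbitrary: W)
  case (Cons x Xs)
  have "tensor_form s (\<lambda>u. \<Sum>i\<in>S. c i * W i u) (x # Xs)
      = (\<Sum>l\<le>s. \<Sum>i\<in>S. x $ l * (c i * tensor_form s (\<lambda>u. W i (l # u)) Xs))"
    using Cons.IH[of "\<lambda>i u. W i (_ # u)"] by (simp add: sum_distrib_left)
  also have "\<dots> = (\<Sum>i\<in>S. \<Sum>l\<le>s. x $ l * (c i * tensor_form s (\<lambda>u. W i (l # u)) Xs))" by (rule sum.swap)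
  also have "\<dots> = (\<Sum>i\<in>S. c i * tensor_form s (W i) (x # Xs))"
    by (simp add: sum_distrib_left mult.left_commute)
  finally show ?case .
qed simp

lemma tensor_form_smult: "tensor_form s (\<lambda>u. c * W u) Xs = c * tensor_form s W Xs"
  using tensor_form_sum[of s "\<lambda>_. c" "\<lambda>_. W" "{()}"] by simp

text \<open>The recursion of \<open>tensor_form\<close> peels off the first slot, whereas twisted
  cyclicity compares it with the last one.\<close>

lemma tensor_form_snoc:
  "tensor_form s W (Xs @ [x]) = (\<Sum>l\<le>s. x $ l * tensor_form s (\<lambda>u. W (u @ [l])) Xs)"
proof (induction Xs arbitrary: W)
  case (Cons y Xs)
  have "tensor_form s W ((y # Xs) @ [x])
      = (\<Sum>k\<le>s. \<Sum>l\<le>s. y $ k * (x $ l * tensor_form s (\<lambda>u. W (k # u @ [l])) Xs))"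
    by (simp add: Cons.IH sum_distrib_left)
  also have "\<dots> = (\<Sum>l\<le>s. \<Sum>k\<le>s. y $ k * (x $ l * tensor_form s (\<lambda>u. W (k # u @ [l])) Xs))" by (rule sum.swap)
  also have "\<dots> = (\<Sum>l\<le>s. x $ l * tensor_form s (\<lambda>u. W (u @ [l])) (y # Xs))"
    by (simp add: sum_distrib_left mult.left_commute)
  finally show ?case .
qed simp

lemma tensor_form_unit: "set u \<subseteq> {..s} \<Longrightarrow> tensor_form s W (map (unit_vec (Suc s)) u) = W u"
proof (induction u arbitrary: W)
  case (Cons k u)
  have "tensor_form s W (map (unit_vec (Suc s)) (k # u)) = (\<Sum>l\<le>s. if l = k then W (k # u) else 0)"
    unfolding list.map tensor_form.simps by (intro sum.cong) (use Cons in auto)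
  then show ?case using Cons.prems by simp
qed simp

lemma tensor_form_update:
  assumes "i < length Xs" "x \<in> carrier_vec (Suc s)" "y \<in> carrier_vec (Suc s)"
  shows "tensor_form s W (Xs[i := x + y]) = tensor_form s W (Xs[i := x]) + tensor_form s W (Xs[i := y])"
    and "tensor_form s W (Xs[i := c \<cdot>\<^sub>v x]) = c * tensor_form s W (Xs[i := x])"
  using assms(1)
proof (induction Xs arbitrary: i W)
  case (Cons z Xs)
  {
    case 1
    show ?case
    proof (cases i)
      case 0
      then show ?thesis using assms(2,3) by (simp add: distrib_right sum.distrib)
    next
      case (Suc j)
      then show ?thesis using Cons.IH(1)[of j] 1 by (simp add: distrib_left sum.distrib)
    qed
  next
    case 2
    show ?case
    proof (cases i)
      case 0
      then show ?thesis using assms(2) by (simp add: sum_distrib_left mult.assoc)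
    next
      case (Suc j)
      then show ?thesis using Cons.IH(2)[of j] 2 by (simp add: sum_distrib_left mult.left_commute)
    qed
  }
qed simp_all

lemma multilinear_tensor_form: "multilinear_form (Suc s) m (tensor_form s W)"
  unfolding multilinear_form_def vec_lists_def using tensor_form_update by blast

lemma multilinear_form_expand:
  assumes w: "multilinear_form (Suc s) m w" and Xs: "Xs \<in> vec_lists (Suc s) m" "i < m" and x: "x \<in> carrier_vec (Suc s)"
  shows "w (Xs[i := x]) = (\<Sum>l\<le>s. x $ l * w (Xs[i := unit_vec (Suc s) l]))"
proof -
  \<comment> \<open>Truncations of \<open>x\<close>: multilinearity is stated for binary sums, so
    the coordinates are added one at a time.\<close>
  define t where "t k = vec (Suc s) (\<lambda>l. if l < k then x $ l else 0)" for k
  have t: "t k \<in> carrier_vec (Suc s)" for k by (simp add: t_def)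
  have add: "w (Xs[i := y + z]) = w (Xs[i := y]) + w (Xs[i := z])"
    and smult: "w (Xs[i := c \<cdot>\<^sub>v y]) = c * w (Xs[i := y])"
    if "y \<in> carrier_vec (Suc s)" "z \<in> carrier_vec (Suc s)" for y z c
    using w Xs that unfolding multilinear_form_def by blast+
  have "w (Xs[i := t k]) = (\<Sum>l<k. x $ l * w (Xs[i := unit_vec (Suc s) l]))" if "k \<le> Suc s" for k
    using that
  proof (induction k)
    case 0
    have "t 0 = 0 \<cdot>\<^sub>v t 0" by (auto simp: t_def)
    then have "w (Xs[i := t 0]) = 0 * w (Xs[i := t 0])" using smult[OF t t] by metis
    then show ?case by simp
  next
    case (Suc k)
    have "t (Suc k) = t k + x $ k \<cdot>\<^sub>v unit_vec (Suc s) k"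
    proof (rule eq_vecI)
      fix i assume "i < dim_vec (t k + x $ k \<cdot>\<^sub>v unit_vec (Suc s) k)"
      then show "t (Suc k) $ i = (t k + x $ k \<cdot>\<^sub>v unit_vec (Suc s) k) $ i"
        using Suc.prems by (cases "i < k"; cases "i = k") (auto simp: t_def)
    qed (simp add: t_def)
    then show ?case using Suc add[OF t[of k], of "x $ k \<cdot>\<^sub>v unit_vec (Suc s) k"] smult[OF unit_vec_carrier unit_vec_carrier] by simp
  qed
  from this[of "Suc s"] have "w (Xs[i := t (Suc s)]) = (\<Sum>l\<le>s. x $ l * w (Xs[i := unit_vec (Suc s) l]))"
    by (simp add: lessThan_Suc_atMost)
  moreover have "t (Suc s) = x" by (rule eq_vecI) (use x in \<open>auto simp: t_def\<close>)
  ultimately show ?thesis by simp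
qed

lemma multilinear_form_components:
  assumes w: "multilinear_form (Suc s) m w" and "Xs \<in> vec_lists (Suc s) m"
  shows "w Xs = tensor_form s (form_component (Suc s) w) Xs"
proof -
  \<comment> \<open>Generalised for the induction: the word \<open>v\<close> records the arguments
    already replaced by basis vectors.\<close>
  have "w (map (unit_vec (Suc s)) v @ Ys) = tensor_form s (\<lambda>u. form_component (Suc s) w (v @ u)) Ys"
    if "length v + length Ys = m" "set Ys \<subseteq> carrier_vec (Suc s)" for v Ys
    using that
  proof (induction Ys arbitrary: v)
    case (Cons x Ys)
    have mem: "map (unit_vec (Suc s)) v @ x # Ys \<in> vec_lists (Suc s) m" using Cons.prems by (auto simp: vec_lists_def)
    have "w (map (unit_vec (Suc s)) v @ x # Ys)
        = (\<Sum>l\<le>s. x $ l * w (map (unit_vec (Suc s)) (v @ [l]) @ Ys))"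
      using multilinear_form_expand[OF w mem, of "length v" x] Cons.prems by (simp add: list_update_append)
    also have "\<dots> = (\<Sum>l\<le>s. x $ l * tensor_form s (\<lambda>u. form_component (Suc s) w ((v @ [l]) @ u)) Ys)"
      using Cons.IH[of "v @ [_]"] Cons.prems by (intro sum.cong) simp_all
    finally show ?case by simp
  qed (simp add: form_component_def)
  from this[of "[]" Xs] show ?thesis using assms(2) by (simp add: vec_lists_def)
qed

lemma invertible_mat_if_injective:
  fixes Q :: "'k::field mat"
  assumes Q: "Q \<in> carrier_mat n n" and inj: "\<And>v. \<lbrakk>v \<in> carrier_vec n; Q *\<^sub>v v = 0\<^sub>v n\<rbrakk> \<Longrightarrow> v = 0\<^sub>v n"
  shows "invertible_mat Q"
proof -
  have "det Q \<noteq> 0" using det_0_iff_vec_prod_zero_field[OF Q] inj by blast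
  then have "Q \<in> Units (ring_mat TYPE('k) n ())" by (rule det_non_zero_imp_unit[OF Q])
  then obtain P where "P \<in> carrier_mat n n" "P * Q = 1\<^sub>m n" "Q * P = 1\<^sub>m n"
    unfolding Units_def ring_mat_def by auto
  then show ?thesis using Q unfolding invertible_mat_def inverts_mat_def by auto
qed

text \<open>Under twisted cyclicity, a degenerate vector in the last slot can be moved to the first.\<close>

lemma twisted_cyclic_injective:
  fixes w :: "'k::field vec list \<Rightarrow> 'k"
  assumes w: "multilinear_form n m w" and m: "0 < m" and Q: "Q \<in> carrier_mat n n"
    and nondeg: "\<And>X. \<lbrakk>X \<in> carrier_vec n; \<forall>Xs\<in>vec_lists n (m - 1). w (X # Xs) = 0\<rbrakk> \<Longrightarrow> X = 0\<^sub>v n"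
    and cyc: "\<And>Xs X. \<lbrakk>Xs \<in> vec_lists n (m - 1); X \<in> carrier_vec n\<rbrakk> \<Longrightarrow> w (Xs @ [X]) = w ((Q *\<^sub>v X) # Xs)"
    and v: "v \<in> carrier_vec n" "Q *\<^sub>v v = 0\<^sub>v n"
  shows "v = 0\<^sub>v n"
proof -
  have zero: "w (0\<^sub>v n # Xs) = 0" if "Xs \<in> vec_lists n (m - 1)" for Xs
  proof -
    have "0\<^sub>v n # Xs \<in> vec_lists n m" using that m by (auto simp: vec_lists_def)
    then have "w ((0\<^sub>v n # Xs)[0 := 0 \<cdot>\<^sub>v 0\<^sub>v n]) = 0 * w ((0\<^sub>v n # Xs)[0 := 0\<^sub>v n])"
      using w m zero_carrier_vec unfolding multilinear_form_def by blast
    moreover have "0 \<cdot>\<^sub>v 0\<^sub>v n = (0\<^sub>v n :: 'k vec)" by auto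
    ultimately show ?thesis by simp
  qed
  \<comment> \<open>Here \<open>v\<close> stands \<open>k\<close> places before the end. Each
    rotation of the last argument to the front, at the price of \<open>Q\<close>, moves
    \<open>v\<close> one place to the right, until it is last itself and the next rotation turns it
    into \<open>Q *\<^sub>v v\<close>, which is zero.\<close>
  have moved: "w Xs = 0" if "k < m" "Xs \<in> vec_lists n m" "Xs ! (m - Suc k) = v" for k Xs
    using that
  proof (induction k arbitrary: Xs)
    case 0
    have len: "length Xs = m" using 0 by (simp add: vec_lists_def)
    then obtain Ys y where Xs: "Xs = Ys @ [y]" using m by (cases Xs rule: rev_cases) auto
    then have y: "y = v" "Ys \<in> vec_lists n (m - 1)" using 0 len by (auto simp: vec_lists_def nth_append)
    show ?case using cyc[OF y(2) v(1)] zero[OF y(2)] by (simp add: Xs y(1) v(2))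
  next
    case (Suc k)
    have len: "length Xs = m" using Suc by (simp add: vec_lists_def)
    then obtain Ys y where Xs: "Xs = Ys @ [y]" using m by (cases Xs rule: rev_cases) auto
    then have y: "y \<in> carrier_vec n" "Ys \<in> vec_lists n (m - 1)" using Suc len by (auto simp: vec_lists_def)
    have "((Q *\<^sub>v y) # Ys) ! (m - Suc k) = Ys ! (m - Suc (Suc k))"
      using Suc.prems(1) by (simp add: nth_Cons' Suc_diff_Suc)
    also have "\<dots> = v"
    proof -
      have "m - Suc (Suc k) < length Ys" using Suc.prems(1) Xs len by simp
      then show ?thesis using Suc.prems(3) Xs by (simp add: nth_append)
    qed
    finally have "w ((Q *\<^sub>v y) # Ys) = 0"
      using Suc y Q m by (intro Suc.IH) (auto simp: vec_lists_def)
    then show ?case using cyc[OF y(2,1)] by (simp add: Xs)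
  qed
  have "w (v # Xs) = 0" if "Xs \<in> vec_lists n (m - 1)" for Xs
    using moved[of "m - 1" "v # Xs"] that m v(1) by (auto simp: vec_lists_def)
  then show ?thesis using nondeg v(1) by blast
qed

text \<open>Unlike \<open>slice\<close>, it tests the letters as well as the length. This is the
  shape of \<open>form_relations\<close>, and the components of a \<open>tensor_form\<close> are
  known only at words over \<open>{..s}\<close>.\<close>

definition word_slice :: "nat \<Rightarrow> nat \<Rightarrow> (nat list \<Rightarrow> 'k::zero) \<Rightarrow> nat list \<Rightarrow> nat list \<Rightarrow> nat list \<Rightarrow> 'k" where
  "word_slice s n W p q = (\<lambda>u. if u \<in> words s n then W (p @ u @ q) else 0)"

lemma form_relations_word_slice:
  "form_relations s N m w = (\<lambda>v. word_slice s N (form_component (Suc s) w) v []) ` words s (m - N)"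
  by (simp add: form_relations_def word_slice_def cong: if_cong)

text \<open>Twisted cyclicity moves the letters to the right of a slice to its left.\<close>

lemma cyclic_word_slice:
  fixes W :: "nat list \<Rightarrow> 'k::field"
  assumes S: "linear_subspace S U"
    and cyc: "\<And>u k. \<lbrakk>u \<in> words s (m - 1); k \<le> s\<rbrakk> \<Longrightarrow> W (u @ [k]) = (\<Sum>\<nu>\<le>s. c \<nu> k * W (\<nu> # u))"
    and base: "\<And>p. p \<in> words s (m - N) \<Longrightarrow> word_slice s N W p [] \<in> S"
    and "p \<in> words s a" "q \<in> words s b" "a + N + b = m"
  shows "word_slice s N W p q \<in> S"
  using assms(4-6)
proof (induction b arbitrary: a p q)
  case 0
  then have "a = m - N" by simp
  with 0 base show ?case by simp
next
  case (Suc b)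
  obtain q' k where q: "q = q' @ [k]" "q' \<in> words s b" "k \<le> s" using Suc.prems(2) by (auto simp: words_Suc)
  \<comment> \<open>The last letter \<open>k\<close> of \<open>q\<close> travels to the front of
    \<open>p\<close>, where it becomes a combination of letters \<open>\<nu>\<close>; the window
    \<open>u\<close> in the middle is untouched.\<close>
  have "word_slice s N W p q = (\<lambda>u. \<Sum>\<nu>\<le>s. c \<nu> k * word_slice s N W (\<nu> # p) q' u)"
  proof
    fix u
    show "word_slice s N W p q u = (\<Sum>\<nu>\<le>s. c \<nu> k * word_slice s N W (\<nu> # p) q' u)"
    proof (cases "u \<in> words s N")
      case True
      then have "p @ u @ q' \<in> words s (m - 1)" using Suc.prems q(2) by (auto simp: words_def)
      then have "W ((p @ u @ q') @ [k]) = (\<Sum>\<nu>\<le>s. c \<nu> k * W (\<nu> # p @ u @ q'))" using cyc q(3) by blast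
      then show ?thesis using True q(1) by (simp add: word_slice_def)
    qed (simp add: word_slice_def)
  qed
  moreover have "word_slice s N W (\<nu> # p) q' \<in> S" if "\<nu> \<le> s" for \<nu>
    by (rule Suc.IH[of _ "Suc a"]) (use Suc.prems q that in \<open>auto simp: words_def\<close>)
  ultimately show ?case
    using linear_subspace_sum[OF S, of "{..s}" "\<lambda>\<nu> u. c \<nu> k * word_slice s N W (\<nu> # p) q' u"] linear_subspaceD(3)[OF S]
    by auto
qed

text \<open>The coefficients \<open>c \<nu> k\<close> are the entries of the matrix in condition
  (ii); below, only this componentwise form of that condition is used.\<close>

lemma preregular_cyclic:
  fixes w :: "'k::field vec list \<Rightarrow> 'k"
  assumes "preregular (Suc s) m w"
  obtains c where "\<And>u k. \<lbrakk>u \<in> words s (m - 1); k \<le> s\<rbrakk>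
    \<Longrightarrow> form_component (Suc s) w (u @ [k]) = (\<Sum>\<nu>\<le>s. c \<nu> k * form_component (Suc s) w (\<nu> # u))"
proof -
  have w: "multilinear_form (Suc s) m w" and m: "2 \<le> m" using assms by (auto simp: preregular_def)
  obtain Q where Q: "Q \<in> carrier_mat (Suc s) (Suc s)"
    "\<And>Xs X. \<lbrakk>Xs \<in> vec_lists (Suc s) (m - 1); X \<in> carrier_vec (Suc s)\<rbrakk> \<Longrightarrow> w (Xs @ [X]) = w ((Q *\<^sub>v X) # Xs)"
    using assms unfolding preregular_def by blast
  have "form_component (Suc s) w (u @ [k])
      = (\<Sum>\<nu>\<le>s. (Q *\<^sub>v unit_vec (Suc s) k) $ \<nu> * form_component (Suc s) w (\<nu> # u))"
    if u: "u \<in> words s (m - 1)" "k \<le> s" for u k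
  proof -
    let ?Xs = "map (unit_vec (Suc s)) u" and ?e = "unit_vec (Suc s) k"
    have Xs: "?Xs \<in> vec_lists (Suc s) (m - 1)" "?e # ?Xs \<in> vec_lists (Suc s) m"
      using u m by (auto simp: vec_lists_def words_def)
    have "form_component (Suc s) w (u @ [k]) = w ((Q *\<^sub>v ?e) # ?Xs)"
      using Q(2)[OF Xs(1), of ?e] by (simp add: form_component_def)
    also have "\<dots> = (\<Sum>\<nu>\<le>s. (Q *\<^sub>v ?e) $ \<nu> * w (unit_vec (Suc s) \<nu> # ?Xs))"
      using multilinear_form_expand[OF w Xs(2), of 0 "Q *\<^sub>v ?e"] m Q(1) by simp
    finally show ?thesis by (simp add: form_component_def)
  qed
  then show ?thesis by (rule that)
qed

section \<open>Preregular forms that define the algebra\<close>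

context homogeneous_relations
begin

text \<open>The relations of \<open>w\<close> lie in \<open>I\<close> and have degree
  \<open>N\<close>, hence lie in \<open>R\<close>. This covers the windows at the right end of the
  component tensor; twisted cyclicity extends it to windows at every position.\<close>

lemma preregular_component_in_dual:
  assumes w: "preregular (Suc s) m w" and eq: "A = form_algebra s N m w" and "N \<le> m"
  shows "word_slice s m (form_component (Suc s) w) [] [] \<in> V m"
proof -
  let ?W = "form_component (Suc s) w"
  obtain c where c: "\<And>u k. \<lbrakk>u \<in> words s (m - 1); k \<le> s\<rbrakk> \<Longrightarrow> ?W (u @ [k]) = (\<Sum>\<nu>\<le>s. c \<nu> k * ?W (\<nu> # u))"
    using preregular_cyclic[OF w] by blast
  have tensor: "word_slice s n W p q \<in> tensor_power s n" for n p q and W :: "nat list \<Rightarrow> 'k"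
    by (auto simp: tensor_power_def word_slice_def)
  \<comment> \<open>The zero element of a quotient ring is the ideal itself, so equal quotients have
    equal ideals.\<close>
  have "\<zero>\<^bsub>A\<^esub> = \<zero>\<^bsub>form_algebra s N m w\<^esub>" by (simp add: eq)
  then have ideals: "I = Idl\<^bsub>T\<^esub> form_relations s N m w"
    by (simp add: homogeneous_algebra_def form_algebra_def FactRing_def)
  have base: "word_slice s N ?W p [] \<in> R" if "p \<in> words s (m - N)" for p
  proof -
    let ?r = "word_slice s N ?W p []"
    have "form_relations s N m w \<subseteq> carrier T"
      unfolding form_relations_word_slice using tensor tensor_power_subset_free by blast
    then have "?r \<in> I" unfolding ideals using T.genideal_self that by (auto simp: form_relations_word_slice)
    then have "(\<lambda>u. if length u = N then ?r u else 0) \<in> R" by (rule ideal_low_degrees(2))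
    moreover have "(\<lambda>u. if length u = N then ?r u else 0) = ?r" by (auto simp: word_slice_def words_def)
    ultimately show ?thesis by simp
  qed
  show ?thesis
    unfolding dual_component_iff
  proof (intro conjI allI impI tensor)
    fix p q assume pq: "set p \<subseteq> {..s}" "set q \<subseteq> {..s}" "length p + N + length q = m"
    have "word_slice s N ?W p q \<in> R"
      by (rule cyclic_word_slice[OF relations c base, where a = "length p" and b = "length q"])
        (use pq in \<open>auto simp: words_def\<close>)
    moreover have "slice p q N (word_slice s m ?W [] []) = word_slice s N ?W p q"
      using pq by (auto simp: slice_def word_slice_def words_def)
    ultimately show "slice p q N (word_slice s m ?W [] []) \<in> R" by simp
  qed
qed

lemma algebra_eqI:
  assumes "S \<subseteq> R" "R \<subseteq> Idl\<^bsub>T\<^esub> S"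
  shows "A = homogeneous_algebra s S"
proof -
  have S: "S \<subseteq> carrier T" using assms(1) relations_subset by blast
  have "I \<subseteq> Idl\<^bsub>T\<^esub> S" by (rule T.genideal_minimal[OF T.genideal_ideal[OF S] assms(2)])
  moreover have "Idl\<^bsub>T\<^esub> S \<subseteq> I"
    by (rule T.genideal_minimal[OF I.ideal_axioms]) (use assms(1) T.genideal_self[OF relations_subset] in blast)
  ultimately show ?thesis by (simp add: homogeneous_algebra_def)
qed

text \<open>The relations of a form are merely a spanning family, while
  \<open>cyclic_word_slice\<close> asks for a linear subspace; the homogeneous part of the ideal
  they generate serves as one.\<close>

lemma ideal_degree_subspace:
  assumes "S \<subseteq> carrier T"
  shows "linear_subspace {f \<in> tensor_power s n. f \<in> Idl\<^bsub>T\<^esub> S} (tensor_power s n)"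
proof -
  interpret J: ideal "Idl\<^bsub>T\<^esub> S" T by (rule T.genideal_ideal[OF assms])
  note E = linear_subspaceD[OF linear_subspace_tensor_power[of n]]
  show ?thesis
  proof (rule linear_subspaceI)
    show "(\<lambda>_. 0) \<in> {f \<in> tensor_power s n. f \<in> Idl\<^bsub>T\<^esub> S}"
      using E(1) J.zero_closed by (simp add: free_algebra_simps)
    show "(\<lambda>u. f u + g u) \<in> {f \<in> tensor_power s n. f \<in> Idl\<^bsub>T\<^esub> S}"
      if "f \<in> {f \<in> tensor_power s n. f \<in> Idl\<^bsub>T\<^esub> S}" "g \<in> {f \<in> tensor_power s n. f \<in> Idl\<^bsub>T\<^esub> S}" for f g
      using that E(2) J.a_closed[of f g] by (simp add: free_algebra_simps)
    show "(\<lambda>u. c * f u) \<in> {f \<in> tensor_power s n. f \<in> Idl\<^bsub>T\<^esub> S}"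
      if "f \<in> {f \<in> tensor_power s n. f \<in> Idl\<^bsub>T\<^esub> S}" for c f
    proof -
      have "monomial [] c \<otimes>\<^bsub>T\<^esub> f = (\<lambda>u. c * f u)"
        by (simp add: free_algebra_simps word_mult_monomial_left[abs_def])
      then show ?thesis using that E(3) J.I_l_closed[of f "monomial [] c"] by simp
    qed
  qed auto
qed

end

text \<open>The last two differentials together consume \<open>N\<close> letters, so
  \<open>deg D = deg i + N\<close>. A right contraction of \<open>w\<close> by a tensor of degree
  \<open>deg i\<close> thus has degree \<open>N\<close>, like the left contractions in
  \<open>form_relations\<close>, and cyclicity converts the former into the latter.\<close>

lemma (in homogeneous_relations) koszul_gorenstein_form:
  assumes "1 \<le> s" "koszul s N R" "global_dimension A = enat D" "gorenstein A D"
  obtains i w where "D = Suc (Suc i)" "gap (Suc i) = 1" "deg D = deg i + N" "preregular (Suc s) (deg D) w"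
    "A = form_algebra s N (deg D) w"
    "\<And>v v'. \<lbrakk>v \<in> V (deg D); v' \<in> V (deg D); \<exists>u. v u \<noteq> 0; \<exists>u. v' u \<noteq> 0\<rbrakk> \<Longrightarrow> \<exists>c. c \<noteq> 0 \<and> v' = (\<lambda>u. c * v u)"
proof -
  obtain i w \<phi> where D: "D = Suc (Suc i)" "gap (Suc i) = 1" and w: "w \<in> V (deg D)"
    and one_dim: "\<And>v. v \<in> V (deg D) \<Longrightarrow> \<exists>c. v = (\<lambda>u. c * w u)"
    and dual: "\<And>\<mu> \<nu>. \<lbrakk>\<mu> \<le> s; \<nu> \<le> s\<rbrakk> \<Longrightarrow> \<phi> \<mu> (slice [\<nu>] [] (deg (Suc i)) w) = (if \<mu> = \<nu> then 1 else 0)"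
    and \<phi>: "\<And>\<mu>. \<mu> \<le> s \<Longrightarrow> functional (deg (Suc i)) (\<phi> \<mu>)"
    and span: "\<And>v u. v \<in> V (deg (Suc i)) \<Longrightarrow> v u = (\<Sum>\<nu>\<le>s. \<phi> \<nu> v * w (\<nu> # u))"
    and rel: "\<And>r. r \<in> R \<Longrightarrow> \<exists>\<gamma>. \<forall>u\<in>words s N. r u = (\<Sum>q\<in>words s (deg i). w (u @ q) * \<gamma> q)"
    by (rule koszul_gorenstein_tensor[OF assms]) blast
  define m where "m = deg D"
  have gap_i: "gap i = N - 1" using D(2) two_le_N by (auto simp: gap_def split: if_splits)
  have m: "m = Suc (deg (Suc i))" "m = deg i + N" "m - 1 = deg (Suc i)" "m - N = deg i"
    using two_le_N gap_i D(2) by (simp_all add: m_def D(1) deg_Suc)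
  have w_m: "w \<in> V m" "w \<in> V (deg (Suc i) + 1)" using w m(1) by (simp_all add: m_def)
  have word1: "[\<nu>] \<in> words s 1" if "\<nu> \<le> s" for \<nu> using that by (simp add: words_1)
  define w1 where "w1 \<nu> = slice [\<nu>] [] (deg (Suc i)) w" for \<nu>
  have w1: "w1 \<nu> \<in> V (deg (Suc i))" "w1 \<nu> u = w (\<nu> # u)" if "\<nu> \<le> s" for \<nu> u
    unfolding w1_def using slice_left_dual[OF w_m(2) word1[OF that]] slice_left[OF w_m(2) word1[OF that]] by simp_all
  \<comment> \<open>The right contraction of \<open>w\<close> by the letter \<open>k\<close> lies in
    \<open>V (deg (Suc i))\<close>; \<open>c \<nu> k\<close> are its coordinates with respect to the
    left contractions \<open>w1 \<nu>\<close>, and they become the entries of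
    \<open>Q\<close>.\<close>
  define c where "c \<nu> k = \<phi> \<nu> (slice [] [k] (deg (Suc i)) w)" for \<nu> k
  have cyc: "w (u @ [k]) = (\<Sum>\<nu>\<le>s. c \<nu> k * w (\<nu> # u))" if u: "u \<in> words s (m - 1)" and k: "k \<le> s" for u k
  proof -
    have "slice [] [k] (deg (Suc i)) w \<in> V (deg (Suc i))"
      by (rule dual_component_slice[OF w_m(1)]) (use k m(1) in auto)
    from span[OF this, of u] show ?thesis using u m(3) by (simp add: c_def slice_def words_def)
  qed
  define f where "f = tensor_form s w"
  define Q where "Q = mat (Suc s) (Suc s) (\<lambda>(\<nu>, k). c \<nu> k)"
  have Q: "Q \<in> carrier_mat (Suc s) (Suc s)" by (simp add: Q_def)
  have multi: "multilinear_form (Suc s) m f" unfolding f_def by (rule multilinear_tensor_form)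
  have nondeg: "X = 0\<^sub>v (Suc s)"
    if X: "X \<in> carrier_vec (Suc s)" and zero: "\<forall>Xs\<in>vec_lists (Suc s) (m - 1). f (X # Xs) = 0" for X
  proof (rule eq_vecI)
    fix \<mu> assume "\<mu> < dim_vec (0\<^sub>v (Suc s) :: 'k vec)"
    then have \<mu>: "\<mu> \<le> s" by simp
    have "(\<Sum>l\<le>s. X $ l * w1 l u) = 0" for u
    proof (cases "u \<in> words s (m - 1)")
      case True
      then have "map (unit_vec (Suc s)) u \<in> vec_lists (Suc s) (m - 1)" by (auto simp: vec_lists_def words_def)
      then have "f (X # map (unit_vec (Suc s)) u) = 0" using zero by blast
      then show ?thesis using True w1(2) by (simp add: f_def tensor_form_unit words_def)
    next
      case False
      then show ?thesis using dual_component_supp[OF w1(1), of _ u] m(3) by (intro sum.neutral) auto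
    qed
    \<comment> \<open>The zero tensor is written as an empty sum so that
      \<open>functional_sum\<close> also evaluates \<open>\<phi> \<mu>\<close> there.\<close>
    then have "\<phi> \<mu> (\<lambda>u. \<Sum>l\<le>s. X $ l * w1 l u) = \<phi> \<mu> (\<lambda>u. \<Sum>l\<in>{}. X $ l * w1 l u)" by simp
    moreover have "\<phi> \<mu> (\<lambda>u. \<Sum>l\<le>s. X $ l * w1 l u) = (\<Sum>l\<le>s. X $ l * \<phi> \<mu> (w1 l))"
      by (rule functional_sum[OF \<phi>[OF \<mu>]]) (use w1(1) in auto)
    moreover have "\<phi> \<mu> (\<lambda>u. \<Sum>l\<in>{}. X $ l * w1 l u) = (\<Sum>l\<in>{}. X $ l * \<phi> \<mu> (w1 l))"
      by (rule functional_sum[OF \<phi>[OF \<mu>]]) auto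
    moreover have "(\<Sum>l\<le>s. X $ l * \<phi> \<mu> (w1 l)) = (\<Sum>l\<le>s. if l = \<mu> then X $ l else 0)"
      using \<mu> by (intro sum.cong) (auto simp: dual w1_def)
    ultimately show "X $ \<mu> = 0\<^sub>v (Suc s) $ \<mu>" using \<mu> by simp
  qed (use X in simp)
  have twisted: "f (Xs @ [X]) = f ((Q *\<^sub>v X) # Xs)"
    if Xs: "Xs \<in> vec_lists (Suc s) (m - 1)" and X: "X \<in> carrier_vec (Suc s)" for Xs X
  proof -
    have QX: "(Q *\<^sub>v X) $ \<nu> = (\<Sum>k\<le>s. c \<nu> k * X $ k)" if "\<nu> \<le> s" for \<nu>
      using that X by (simp add: Q_def scalar_prod_def atLeast0LessThan lessThan_Suc_atMost)
    have "f (Xs @ [X]) = (\<Sum>k\<le>s. X $ k * tensor_form s (\<lambda>u. \<Sum>\<nu>\<le>s. c \<nu> k * w (\<nu> # u)) Xs)"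
      unfolding f_def tensor_form_snoc
    proof (rule sum.cong)
      fix k assume "k \<in> {..s}"
      then have "tensor_form s (\<lambda>u. w (u @ [k])) Xs = tensor_form s (\<lambda>u. \<Sum>\<nu>\<le>s. c \<nu> k * w (\<nu> # u)) Xs"
        using Xs by (intro tensor_form_cong cyc) (auto simp: vec_lists_def)
      then show "X $ k * tensor_form s (\<lambda>u. w (u @ [k])) Xs
          = X $ k * tensor_form s (\<lambda>u. \<Sum>\<nu>\<le>s. c \<nu> k * w (\<nu> # u)) Xs" by simp
    qed simp
    also have "\<dots> = (\<Sum>k\<le>s. \<Sum>\<nu>\<le>s. c \<nu> k * X $ k * tensor_form s (\<lambda>u. w (\<nu> # u)) Xs)"
      unfolding tensor_form_sum by (simp add: sum_distrib_left mult_ac)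
    also have "\<dots> = (\<Sum>\<nu>\<le>s. \<Sum>k\<le>s. c \<nu> k * X $ k * tensor_form s (\<lambda>u. w (\<nu> # u)) Xs)" by (rule sum.swap)
    also have "\<dots> = f ((Q *\<^sub>v X) # Xs)" by (simp add: f_def QX sum_distrib_right del: index_mult_mat_vec)
    finally show ?thesis .
  qed
  have "preregular (Suc s) m f"
    unfolding preregular_def
  proof (intro conjI ballI impI bexI[of _ Q])
    show "2 \<le> Suc s" "2 \<le> m" using assms(1) two_le_N m(2) by simp_all
    show "invertible_mat Q"
    proof (rule invertible_mat_if_injective[OF Q])
      show "v = 0\<^sub>v (Suc s)" if "v \<in> carrier_vec (Suc s)" "Q *\<^sub>v v = 0\<^sub>v (Suc s)" for v
        by (rule twisted_cyclic_injective[OF multi _ Q nondeg twisted that]) (use m(1) in auto)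
    qed
  qed (use multi nondeg twisted Q in auto)
  moreover have "A = form_algebra s N m f"
    unfolding form_algebra_def
  proof (rule algebra_eqI)
    have comp: "form_component (Suc s) f u = w u" if "set u \<subseteq> {..s}" for u
      unfolding form_component_def f_def by (rule tensor_form_unit[OF that])
    define J where "J = form_relations s N m f"
    have slice_w: "word_slice s N (form_component (Suc s) f) p q = word_slice s N w p q"
      if "p \<in> words s a" "q \<in> words s b" for p q a b
      using that by (auto simp: word_slice_def words_def comp)
    have J: "J = (\<lambda>v. word_slice s N w v []) ` words s (m - N)"
      unfolding J_def form_relations_word_slice by (rule image_cong) (auto intro: slice_w[where b = 0])
    show "J \<subseteq> R"
      unfolding J
    proof
      fix r assume "r \<in> (\<lambda>v. word_slice s N w v []) ` words s (m - N)"
      then obtain v where v: "v \<in> words s (m - N)" "r = word_slice s N w v []" by blast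
      have "slice v [] N w \<in> R"
        using w_m(1) v(1) m(2) unfolding dual_component_iff by (auto simp: words_def)
      moreover have "slice v [] N w = r"
        using dual_component_supp[OF w_m(1)] unfolding v(2) by (fastforce simp: slice_def word_slice_def words_def)
      ultimately show "r \<in> R" by simp
    qed
    then have JT: "J \<subseteq> carrier T" using relations_subset by blast
    \<comment> \<open>The left contractions of \<open>w\<close> generate the ideal of the form.
      Moving letters from right to left within \<open>S\<close> shows that the contractions on the
      right, which span \<open>R\<close>, lie in the same ideal.\<close>
    define S where "S = {f \<in> tensor_power s N. f \<in> Idl\<^bsub>T\<^esub> J}"
    have S: "linear_subspace S (tensor_power s N)" unfolding S_def by (rule ideal_degree_subspace[OF JT])
    have left: "word_slice s N w p [] \<in> S" if "p \<in> words s (m - N)" for p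
      using that T.genideal_self[OF JT] by (auto simp: S_def J tensor_power_def word_slice_def)
    have slices: "word_slice s N w [] q \<in> S" if "q \<in> words s (deg i)" for q
    proof (rule cyclic_word_slice[OF S cyc left, where m = m and a = 0 and b = "deg i"])
      show "0 + N + deg i = m" using m(2) by simp
    qed (use that in auto)
    show "R \<subseteq> Idl\<^bsub>T\<^esub> J"
    proof
      fix r assume r: "r \<in> R"
      obtain \<gamma> where \<gamma>: "\<And>u. u \<in> words s N \<Longrightarrow> r u = (\<Sum>q\<in>words s (deg i). w (u @ q) * \<gamma> q)" using rel[OF r] by blast
      have "r = (\<lambda>u. \<Sum>q\<in>words s (deg i). \<gamma> q * word_slice s N w [] q u)"
      proof
        fix u
        show "r u = (\<Sum>q\<in>words s (deg i). \<gamma> q * word_slice s N w [] q u)"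
          using \<gamma>[of u] relation_letters[OF r, of u] by (cases "u \<in> words s N") (auto simp: word_slice_def mult.commute)
      qed
      moreover have "(\<lambda>u. \<Sum>q\<in>words s (deg i). \<gamma> q * word_slice s N w [] q u) \<in> S"
        by (rule linear_subspace_sum[OF S]) (use slices linear_subspaceD(3)[OF S] in auto)
      ultimately show "r \<in> Idl\<^bsub>T\<^esub> J" by (simp add: S_def)
    qed
  qed
  moreover have "\<exists>c. c \<noteq> 0 \<and> v' = (\<lambda>u. c * v u)"
    if v: "v \<in> V m" "v' \<in> V m" and nz: "\<exists>u. v u \<noteq> 0" "\<exists>u. v' u \<noteq> 0" for v v'
  proof -
    obtain a a' where a: "v = (\<lambda>u. a * w u)" "v' = (\<lambda>u. a' * w u)" using one_dim v unfolding m_def by blast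
    then have "a \<noteq> 0" "a' \<noteq> 0" using nz by auto
    then show ?thesis using a by (intro exI[of _ "a' / a"]) auto
  qed
  ultimately show ?thesis using that[of i f] D m(2) unfolding m_def by blast
qed

text \<open>If all components vanished, so would \<open>w\<close>, and a basis vector would violate
  nondegeneracy.\<close>

lemma preregular_component_nonzero:
  assumes "preregular (Suc s) m w"
  shows "\<exists>u. word_slice s m (form_component (Suc s) w) [] [] u \<noteq> 0"
proof (rule ccontr)
  assume "\<nexists>u. word_slice s m (form_component (Suc s) w) [] [] u \<noteq> 0"
  then have zero: "form_component (Suc s) w u = 0" if "u \<in> words s m" for u
    using that by (auto simp: word_slice_def split: if_splits)
  have w: "multilinear_form (Suc s) m w" "2 \<le> m" using assms by (auto simp: preregular_def)
  have "w Xs = 0" if Xs: "Xs \<in> vec_lists (Suc s) m" for Xs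
  proof -
    have "w Xs = tensor_form s (\<lambda>u. 0 * form_component (Suc s) w u) Xs"
      unfolding multilinear_form_components[OF w(1) Xs]
      by (rule tensor_form_cong) (use Xs zero in \<open>auto simp: vec_lists_def\<close>)
    then show ?thesis unfolding tensor_form_smult by simp
  qed
  then have "\<forall>Xs\<in>vec_lists (Suc s) (m - 1). w (unit_vec (Suc s) 0 # Xs) = 0"
    using w(2) by (auto simp: vec_lists_def)
  then have "unit_vec (Suc s) 0 = (0\<^sub>v (Suc s) :: 'a vec)"
    using assms unfolding preregular_def by (metis unit_vec_carrier)
  then show False by (metis unit_vec_nonzero zero_less_Suc)
qed

theorem theorem11:
  fixes R :: "(nat list \<Rightarrow> 'k :: {alg_closed_field, field_char_0}) set" and N s D :: nat
  assumes "2 \<le> N" and "1 \<le> s"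
    and "linear_subspace R (tensor_power s N)"
    and "koszul s N R"
    and "global_dimension (homogeneous_algebra s R) = enat D"
    and "gorenstein (homogeneous_algebra s R) D"
  shows "\<exists>m\<ge>N.
    (3 \<le> N \<longrightarrow> (\<exists>p\<ge>1. m = N * p + 1 \<and> D = 2 * p + 1)) \<and>
    (N = 2 \<longrightarrow> m = D) \<and>
    (\<exists>w. preregular (Suc s) m w \<and> homogeneous_algebra s R = form_algebra s N m w) \<and>
    (\<forall>w w'. preregular (Suc s) m w \<and> homogeneous_algebra s R = form_algebra s N m w \<and>
            preregular (Suc s) m w' \<and> homogeneous_algebra s R = form_algebra s N m w' \<longrightarrow>
      (\<exists>c. c \<noteq> 0 \<and> (\<forall>Xs\<in>vec_lists (Suc s) m. w' Xs = c * w Xs)))"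
proof -
  interpret homogeneous_relations s N R by unfold_locales (rule assms)+
  obtain i w where D: "D = Suc (Suc i)" "gap (Suc i) = 1" "deg D = deg i + N" and w: "preregular (Suc s) (deg D) w"
    "A = form_algebra s N (deg D) w"
    and one_dim: "\<And>v v'. \<lbrakk>v \<in> V (deg D); v' \<in> V (deg D); \<exists>u. v u \<noteq> 0; \<exists>u. v' u \<noteq> 0\<rbrakk>
      \<Longrightarrow> \<exists>c. c \<noteq> 0 \<and> v' = (\<lambda>u. c * v u)"
    by (rule koszul_gorenstein_form[OF assms(2,4-6)]) blast
  have ge: "N \<le> deg D" using D(3) by simp
  have "\<exists>p\<ge>1. deg D = N * p + 1 \<and> D = 2 * p + 1" if "3 \<le> N"
  proof -
    \<comment> \<open>For \<open>3 \<le> N\<close> the gap \<open>N - 1\<close> differs from 1, so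
      \<open>D - 1\<close>, which is \<open>Suc i\<close>, cannot be odd.\<close>
    have "even (Suc i)" using D(2) that by (auto simp: gap_def split: if_splits)
    then obtain p where p: "Suc i = 2 * p" by (rule evenE)
    then have D_eq: "D = 2 * p + 1" using D(1) by simp
    moreover have "deg D = N * p + 1" unfolding D_eq deg_def by simp
    moreover have "1 \<le> p" using p by (cases p) auto
    ultimately show ?thesis by blast
  qed
  moreover have "deg D = D" if "N = 2"
  proof -
    have "deg D = N * (D div 2) + D mod 2" by (rule deg_def)
    then show ?thesis using that by simp
  qed
  moreover have "\<exists>c. c \<noteq> 0 \<and> (\<forall>Xs\<in>vec_lists (Suc s) (deg D). w2 Xs = c * w1 Xs)"
    if w1: "preregular (Suc s) (deg D) w1" "A = form_algebra s N (deg D) w1"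
      and w2: "preregular (Suc s) (deg D) w2" "A = form_algebra s N (deg D) w2" for w1 w2
  proof -
    \<comment> \<open>The component tensors of both forms are nonzero elements of the line
      \<open>V (deg D)\<close>.\<close>
    obtain c where c: "c \<noteq> 0" "word_slice s (deg D) (form_component (Suc s) w2) [] []
        = (\<lambda>u. c * word_slice s (deg D) (form_component (Suc s) w1) [] [] u)"
      using one_dim[OF preregular_component_in_dual[OF w1 ge] preregular_component_in_dual[OF w2 ge]
          preregular_component_nonzero[OF w1(1)] preregular_component_nonzero[OF w2(1)]] by blast
    have "form_component (Suc s) w2 u = c * form_component (Suc s) w1 u" if "u \<in> words s (deg D)" for u
      using fun_cong[OF c(2), of u] that by (simp add: word_slice_def)
    then have "tensor_form s (form_component (Suc s) w2) Xs = c * tensor_form s (form_component (Suc s) w1) Xs"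
      if "Xs \<in> vec_lists (Suc s) (deg D)" for Xs
      unfolding tensor_form_smult[symmetric] using that by (intro tensor_form_cong) (auto simp: vec_lists_def)
    moreover have "multilinear_form (Suc s) (deg D) w1" "multilinear_form (Suc s) (deg D) w2"
      using w1(1) w2(1) by (auto simp: preregular_def)
    ultimately show ?thesis using c(1) multilinear_form_components by metis
  qed
  ultimately show ?thesis using ge w by (intro exI[of _ "deg D"]) blast
qed

end
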